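(* Let the two-stage data be as in the context, with $\Xi$ nonempty and bounded. Assume that the two-stage problem has complete recourse (there exists $y^+\in\mathbb R^{D_2}$ with $Wy^+>0$ componentwise) and that $P$ has full column rank. Then the two-stage robust optimization problem $$\inf_{x\in\mathcal X}\ \sup_{\xi\in\Xi}\ \|A(x)\xi\|^2+b(x)^\top\xi+c(x)+\mathcal R(x,\xi)$$ with $$\mathcal R(x,\xi)=\inf_{y\in\mathbb R^{D_2}}\left\{\|Py\|^2+(R\xi+r)^\top y:\ T(x)\xi+h(x)\le Wy\right\}$$ is equivalent to the copositive program $$\begin{array}{cl}\inf & c(x)-\frac14 r^\top(P^\top P)^{-1}r+\bar t^\top\psi+(\bar t\circ\bar t)^\top\phi+\tau\\ \text{s.t.}& x\in\mathcal X,\ \tau\in\mathbb R,\ \psi,\phi\in\mathbb R^{J'},\ \gamma\in\mathbb R^{LQ},\ H\in\mathbb S_+^{K'},\\ & \begin{bmatrix}\mathbb I&\bar A(x)\\ \bar A(x)^\top&H\end{bmatrix}\succeq0,\\ & \begin{bmatrix}\bar S^\top\operatorname{diag}(\phi)\bar S-H-\mathcal P(x)-\operatorname{diag}\left([\gamma^\top\ 0^\top]^\top\right)&\frac12\left(\bar S^\top\psi-\bar b(x)+[\gamma^\top\ 0^\top]^\top\right)\\ \frac12\left(\bar S^\top\psi-\bar b(x)+[\gamma^\top\ 0^\top]^\top\right)^\top&\tau\end{bmatrix}\succeq_{\mathcal C}0,\end{array}$$ where $\bar S,\bar t,\bar A(x),\bar b(x),\mathcal P(x)$, $J'$, $K'$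 are defined in the context. That is, for every fixed $x\in\mathcal X$ the infimum of the copositive program over $(\tau,\psi,\phi,\gamma,H)$ equals $\sup_{\xi\in\Xi}\|A(x)\xi\|^2+b(x)^\top\xi+c(x)+\mathcal R(x,\xi)$, so that the two problems have the same optimal value.
   Context: Problem data. $\mathcal X\subseteq\mathbb R^D$ is a polytope; $A:\mathcal X\to\mathbb R^{M\times K}$, $b:\mathcal X\to\mathbb R^K$, $T(\cdot):\mathcal X\to\mathbb R^{T\times K}$ and $h:\mathcal X\to\mathbb R^T$ are affine; $c:\mathcal X\to\mathbb R$ is a convex quadratic function; $P$ is a real matrix with $D_2$ columns, $R\in\mathbb R^{D_2\times K}$, $r\in\mathbb R^{D_2}$, $W\in\mathbb R^{T\times D_2}$ (here $T$ also denotes the number of second-stage constraints). The uncertainty set is $\Xi=\{\xi\in\mathbb R_+^K: S\xi=t,\ \xi_\ell\in\mathbb Z\ \forall \ell\in[L]\}$ with $S\in\mathbb R^{J\times K}$, $t\in\mathbb R^J$, $0\le L\le K$, $[L]=\{1,\dots,L\}$. $\Xi$ is bounded, and $Q\in\mathbb Z_+$ is a fixed integer such that $\xi_\ell\in\{0,\dots,2^Q-1\}$ for all $\xi\in\Xi$ and $\ell\in[L]$. Lifted data. Let $v_Q=[2^0\ 2^1\ \cdots\ 2^{Q-1}]^\top$, $J'=LQ+J+L$, $K'=2LQ+K+T$. Vectors of $\mathbb R^{K'}$ are partitioned into blocks of sizes $LQ$, $LQ$, $K$, $T$ (in this order). With $\mathbf e$ the all-ones vector, $$\bar S=\begin{bmatrix}0&0&S&0\\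 -\mathbb I_L\otimes v_Q^\top&0&[\mathbb I_L\ 0]&0\\ \mathbb I_{LQ}&\mathbb I_{LQ}&0&0\end{bmatrix}\in\mathbb R^{J'\times K'},\qquad \bar t=\begin{bmatrix}t\\0\\ \mathbf e\end{bmatrix}\in\mathbb R^{J'},$$ $\bar A(x)=[0\ \ 0\ \ A(x)\ \ 0]\in\mathbb R^{M\times K'}$, $$\bar b(x)=\begin{bmatrix}0\\0\\ b(x)-\frac12R^\top(P^\top P)^{-1}r\\ h(x)+\frac12W(P^\top P)^{-1}r\end{bmatrix}\in\mathbb R^{K'},$$ and $\mathcal P(x)\in\mathbb S^{K'}$ is zero except for its lower-right $(K+T)\times(K+T)$ block, which equals $$\begin{bmatrix}-\frac14R^\top(P^\top P)^{-1}R&\frac12\left(T(x)+\frac12W(P^\top P)^{-1}R\right)^\top\\ \frac12\left(T(x)+\frac12W(P^\top P)^{-1}R\right)&-\frac14W(P^\top P)^{-1}W^\top\end{bmatrix}.$$ Notation. $\mathbb S^n$ ($\mathbb S^n_+$): symmetric (positive semidefinite) $n\times n$ matrices. $\mathcal C$: copositive matrices, i.e. $N\in\mathbb S^n$ with $z^\top Nz\ge0$ for all $z\ge0$; $N\succeq_{\mathcal C}0$ means $N\in\mathcal C$; $N\succeq0$ means positive semidefinite. $\circ$ is the entrywise product, $\|\cdot\|$ the Euclidean norm. $[\gamma^\top\ 0^\top]^\top\in\mathbb R^{K'}$ is $\gamma\in\mathbb R^{LQ}$ padded with zeros; $\operatorname{diag}$ of a vector is the corresponding diagonal matrix. *)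

theory Defs
  imports
    "HOL-Analysis.Polytope"
    "HOL-Library.Extended_Real"
    "Jordan_Normal_Form.DL_Rank"
    "Jordan_Normal_Form.Gauss_Jordan_Elimination"
begin

text \<open>
  All dimensions except that of the first-stage space are natural numbers related by arithmetic
  (and some may vanish), so matrices and vectors are the carrier-based ones of
  Jordan-Normal-Form, indexed from 0. The notation \<open>$\<close> and the scalar product bullet refer to
  these; on the first-stage space \<open>real^'d\<close> the prefix constants are used.
\<close>

unbundle no vec_syntax
unbundle no inner_syntax

definition affine_fun_on :: "(real^'d) set \<Rightarrow> (real^'d \<Rightarrow> real) \<Rightarrow> bool" where
  "affine_fun_on X f \<longleftrightarrow> (\<exists>u v. \<forall>x\<in>X. f x = inner u x + v)"

definition affine_vec_on :: "(real^'d) set \<Rightarrow> nat \<Rightarrow> (real^'d \<Rightarrow> real Matrix.vec) \<Rightarrow> bool" where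
  "affine_vec_on X n f \<longleftrightarrow>
     (\<forall>x\<in>X. f x \<in> carrier_vec n) \<and> (\<forall>i<n. affine_fun_on X (\<lambda>x. f x $ i))"

definition affine_mat_on :: "(real^'d) set \<Rightarrow> nat \<Rightarrow> nat \<Rightarrow> (real^'d \<Rightarrow> real Matrix.mat) \<Rightarrow> bool" where
  "affine_mat_on X m n F \<longleftrightarrow>
     (\<forall>x\<in>X. F x \<in> carrier_mat m n) \<and> (\<forall>i<m. \<forall>j<n. affine_fun_on X (\<lambda>x. F x $$ (i, j)))"

definition convex_quadratic_on :: "(real^'d) set \<Rightarrow> (real^'d \<Rightarrow> real) \<Rightarrow> bool" where
  "convex_quadratic_on X c \<longleftrightarrow> convex_on X c \<and>
     (\<exists>(C :: real^'d^'d) u v. \<forall>x\<in>X. c x = inner x (C *v x) + inner u x + v)"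

definition eucl_norm :: "real Matrix.vec \<Rightarrow> real" where
  "eucl_norm v = sqrt (v \<bullet> v)"

definition bounded_vecs :: "real Matrix.vec set \<Rightarrow> bool" where
  "bounded_vecs U \<longleftrightarrow> (\<exists>B. \<forall>u\<in>U. eucl_norm u \<le> B)"

definition psd_mat :: "nat \<Rightarrow> real Matrix.mat \<Rightarrow> bool" where
  "psd_mat n N \<longleftrightarrow> N \<in> carrier_mat n n \<and> transpose_mat N = N \<and>
     (\<forall>z\<in>carrier_vec n. 0 \<le> z \<bullet> (N *\<^sub>v z))"

definition copositive_mat :: "nat \<Rightarrow> real Matrix.mat \<Rightarrow> bool" where
  "copositive_mat n N \<longleftrightarrow> N \<in> carrier_mat n n \<and> transpose_mat N = N \<and>
     (\<forall>z\<in>carrier_vec n. 0\<^sub>v n \<le> z \<longrightarrow> 0 \<le> z \<bullet> (N *\<^sub>v z))"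

definition full_column_rank :: "real Matrix.mat \<Rightarrow> bool" where
  "full_column_rank P \<longleftrightarrow> vec_space.rank (dim_row P) P = dim_col P"

definition hadamard_vec :: "real Matrix.vec \<Rightarrow> real Matrix.vec \<Rightarrow> real Matrix.vec" where
  "hadamard_vec u v = Matrix.vec (dim_vec u) (\<lambda>i. u $ i * v $ i)"

definition diag_of_vec :: "real Matrix.vec \<Rightarrow> real Matrix.mat" where
  "diag_of_vec v = mat_diag (dim_vec v) (\<lambda>i. v $ i)"

definition kronecker :: "real Matrix.mat \<Rightarrow> real Matrix.mat \<Rightarrow> real Matrix.mat" where
  "kronecker A B = Matrix.mat (dim_row A * dim_row B) (dim_col A * dim_col B)
     (\<lambda>(i, j). A $$ (i div dim_row B, j div dim_col B) * B $$ (i mod dim_row B, j mod dim_col B))"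

definition append_cols :: "real Matrix.mat \<Rightarrow> real Matrix.mat \<Rightarrow> real Matrix.mat"
    (infixr \<open>@\<^sub>c\<close> 70) where
  "A @\<^sub>c B = four_block_mat A B (0\<^sub>m 0 (dim_col A)) (0\<^sub>m 0 (dim_col B))"

text \<open>The symmetric block matrix with diagonal blocks \<open>N\<close> and the scalar \<open>\<tau>\<close>, bordered by \<open>q\<close>.\<close>

definition bordered_mat :: "real Matrix.mat \<Rightarrow> real Matrix.vec \<Rightarrow> real \<Rightarrow> real Matrix.mat" where
  "bordered_mat N q \<tau> =
     four_block_mat N (mat_of_cols (dim_vec q) [q]) (mat_of_rows (dim_vec q) [q])
       (Matrix.mat 1 1 (\<lambda>_. \<tau>))"

definition uncertainty_set ::
    "nat \<Rightarrow> nat \<Rightarrow> real Matrix.mat \<Rightarrow> real Matrix.vec \<Rightarrow> real Matrix.vec set" where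
  "uncertainty_set K L S t =
     {\<xi> \<in> carrier_vec K. 0\<^sub>v K \<le> \<xi> \<and> S *\<^sub>v \<xi> = t \<and> (\<forall>l<L. \<xi> $ l \<in> \<int>)}"

text \<open>
  Values are extended reals: an infimum over the empty set is \<open>\<infinity>\<close> and unbounded problems have
  infinite value. The arguments \<open>Tx\<close>, \<open>hx\<close>, and below \<open>Ax\<close>, \<open>bx\<close>, are the values of
  the corresponding affine maps at the first-stage decision.
\<close>

definition recourse ::
    "real Matrix.mat \<Rightarrow> real Matrix.mat \<Rightarrow> real Matrix.vec \<Rightarrow> real Matrix.mat \<Rightarrow>
     real Matrix.mat \<Rightarrow> real Matrix.vec \<Rightarrow> real Matrix.vec \<Rightarrow> ereal" where
  "recourse P R r W Tx hx \<xi> =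
     (INF y \<in> {y \<in> carrier_vec (dim_col P). Tx *\<^sub>v \<xi> + hx \<le> W *\<^sub>v y}.
        ereal ((eucl_norm (P *\<^sub>v y))\<^sup>2 + (R *\<^sub>v \<xi> + r) \<bullet> y))"

definition complete_recourse :: "real Matrix.mat \<Rightarrow> bool" where
  "complete_recourse W \<longleftrightarrow>
     (\<exists>y \<in> carrier_vec (dim_col W). \<forall>i<dim_row W. 0 < (W *\<^sub>v y) $ i)"

text \<open>\<open>(P\<^sup>T P)\<^sup>-\<^sup>1\<close>; the underlying \<open>mat_inverse\<close> returns \<open>None\<close> on singular matrices, which is
  excluded when \<open>P\<close> has full column rank.\<close>

definition gram_inv :: "real Matrix.mat \<Rightarrow> real Matrix.mat" where
  "gram_inv P = the (mat_inverse (transpose_mat P * P))"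

definition pow2_vec :: "nat \<Rightarrow> real Matrix.vec" where
  "pow2_vec Q = Matrix.vec Q (\<lambda>q. 2 ^ q)"

definition lifted_S :: "nat \<Rightarrow> nat \<Rightarrow> nat \<Rightarrow> nat \<Rightarrow> nat \<Rightarrow> real Matrix.mat \<Rightarrow> real Matrix.mat" where
  "lifted_S J K nT L Q S =
     (0\<^sub>m J (L * Q) @\<^sub>c 0\<^sub>m J (L * Q) @\<^sub>c S @\<^sub>c 0\<^sub>m J nT) @\<^sub>r
     (- kronecker (1\<^sub>m L) (mat_of_rows Q [pow2_vec Q]) @\<^sub>c 0\<^sub>m L (L * Q) @\<^sub>c
        (1\<^sub>m L @\<^sub>c 0\<^sub>m L (K - L)) @\<^sub>c 0\<^sub>m L nT) @\<^sub>r
     (1\<^sub>m (L * Q) @\<^sub>c 1\<^sub>m (L * Q) @\<^sub>c 0\<^sub>m (L * Q) K @\<^sub>c 0\<^sub>m (L * Q) nT)"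

definition lifted_t :: "nat \<Rightarrow> nat \<Rightarrow> real Matrix.vec \<Rightarrow> real Matrix.vec" where
  "lifted_t L Q t = t @\<^sub>v 0\<^sub>v L @\<^sub>v Matrix.vec (L * Q) (\<lambda>_. 1)"

definition lifted_A :: "nat \<Rightarrow> nat \<Rightarrow> nat \<Rightarrow> nat \<Rightarrow> real Matrix.mat \<Rightarrow> real Matrix.mat" where
  "lifted_A M nT L Q Ax = 0\<^sub>m M (L * Q) @\<^sub>c 0\<^sub>m M (L * Q) @\<^sub>c Ax @\<^sub>c 0\<^sub>m M nT"

definition lifted_b ::
    "nat \<Rightarrow> nat \<Rightarrow> real Matrix.mat \<Rightarrow> real Matrix.mat \<Rightarrow> real Matrix.vec \<Rightarrow> real Matrix.mat \<Rightarrow>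
     real Matrix.vec \<Rightarrow> real Matrix.vec \<Rightarrow> real Matrix.vec" where
  "lifted_b L Q P R r W bx hx =
     0\<^sub>v (L * Q) @\<^sub>v 0\<^sub>v (L * Q) @\<^sub>v
     (bx - (1/2) \<cdot>\<^sub>v (transpose_mat R *\<^sub>v (gram_inv P *\<^sub>v r))) @\<^sub>v
     (hx + (1/2) \<cdot>\<^sub>v (W *\<^sub>v (gram_inv P *\<^sub>v r)))"

definition lifted_P ::
    "nat \<Rightarrow> nat \<Rightarrow> nat \<Rightarrow> nat \<Rightarrow> real Matrix.mat \<Rightarrow> real Matrix.mat \<Rightarrow> real Matrix.mat \<Rightarrow>
     real Matrix.mat \<Rightarrow> real Matrix.mat" where
  "lifted_P K nT L Q P R W Tx =
     (let G = gram_inv P;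
          C = (1/2) \<cdot>\<^sub>m (Tx + (1/2) \<cdot>\<^sub>m (W * G * R))
      in four_block_mat
           (0\<^sub>m (2 * L * Q) (2 * L * Q)) (0\<^sub>m (2 * L * Q) (K + nT))
           (0\<^sub>m (K + nT) (2 * L * Q))
           (four_block_mat
              ((-1/4) \<cdot>\<^sub>m (transpose_mat R * G * R)) (transpose_mat C)
              C ((-1/4) \<cdot>\<^sub>m (W * G * transpose_mat W))))"

text \<open>
  Constraints on \<open>(\<tau>, \<psi>, \<phi>, \<gamma>, H)\<close> for a fixed first-stage decision; \<open>J'\<close> and \<open>K'\<close> are the
  dimensions of the lifted constraint matrix \<open>Sb\<close>, and \<open>n\<close> is the dimension of \<open>\<gamma>\<close>.
\<close>

definition cop_feasible ::
    "nat \<Rightarrow> nat \<Rightarrow> real Matrix.mat \<Rightarrow> real Matrix.mat \<Rightarrow> real Matrix.vec \<Rightarrow> real Matrix.mat \<Rightarrow>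
     (real \<times> real Matrix.vec \<times> real Matrix.vec \<times> real Matrix.vec \<times> real Matrix.mat) set" where
  "cop_feasible M n Sb Ab bb Pb =
     (let J' = dim_row Sb; K' = dim_col Sb in
      {(\<tau>, \<psi>, \<phi>, \<gamma>, H).
         \<psi> \<in> carrier_vec J' \<and> \<phi> \<in> carrier_vec J' \<and> \<gamma> \<in> carrier_vec n \<and> psd_mat K' H \<and>
         psd_mat (M + K') (four_block_mat (1\<^sub>m M) Ab (transpose_mat Ab) H) \<and>
         (let g = \<gamma> @\<^sub>v 0\<^sub>v (K' - n) in
          copositive_mat (K' + 1)
            (bordered_mat
               (transpose_mat Sb * diag_of_vec \<phi> * Sb - H - Pb - diag_of_vec g)
               ((1/2) \<cdot>\<^sub>v (transpose_mat Sb *\<^sub>v \<psi> - bb + g))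
               \<tau>))})"

end

theory Submission
  imports Defs "HOL-Analysis.Function_Topology"
begin

unbundle no vec_syntax
unbundle no inner_syntax

text \<open>
  Fix the first-stage decision. The recourse problem is a strictly convex quadratic program. Complete
  recourse makes its Lagrangian dual coercive on the nonnegative orthant, so the dual optimum is
  attained, and its optimality conditions produce a primal point of the same value. Appending the
  dual variables and the binary expansions of the integer components turns the worst-case problem
  into the maximization of a quadratic over \<open>z \<ge> 0\<close>, \<open>Sb z = tb\<close>, with some \<open>z\<^sub>i\<close> binary.

  The copositive program is never smaller, by evaluating the copositive form at \<open>(z, 1)\<close>. Conversely,
  for \<open>v\<close> strictly above the worst case take \<open>H = Ab\<^sup>T Ab\<close> and multipliers for which the copositive
  form becomes \<open>v s\<^sup>2\<close> minus the homogenized objective, plus the penalty terms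
  \<open>\<rho>\<^sup>3 |Sb z - s tb|\<^sup>2 + \<rho> (\<Sum>i. z\<^sub>i (s - z\<^sub>i))\<close>. If this failed to be copositive for every \<open>\<rho>\<close>, then a limit
  point on the simplex would be a ray over a feasible \<open>z\<close> of value at least \<open>v\<close> (if \<open>s > 0\<close>), or a nonzero
  recession direction with nonnegative quadratic part (if \<open>s = 0\<close>). The latter is impossible because
  the uncertainty set is bounded and the dual quadratic is strictly concave on the orthant.
\<close>

section \<open>Exact penalties by compactness\<close>

text \<open>Three obstacles shape the argument. Copositivity is an inequality on the whole orthant
  in \<open>(z, s)\<close>, including points with \<open>z $ i > s\<close>, where the penalty
  \<open>z $ i * (s - z $ i)\<close> is negative. What helps are the complements
  \<open>\<beta>'\<close> with \<open>\<beta> + \<beta>' = 1\<close>: they turn such an excess into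
  a violated equation, for which the stronger penalty \<open>\<rho> ^ 3\<close> pays. Secondly, no
  Slater point and no attained optimum of the copositive program is assumed. Instead, every real
  \<open>v\<close> strictly above the worst case is shown to be the objective value of an explicit
  feasible point; strictness is what survives the passage to a limit point. Thirdly, the quadratic
  part of the dual recourse problem may be singular. Complete recourse only keeps the kernel of the
  transpose of \<open>W\<close> away from the nonzero points of the orthant, so coercivity holds on
  the orthant alone and comes from compactness of the simplex rather than from an eigenvalue
  bound.\<close>

text \<open>
  The exponent 3 makes the possibly negative \<open>p\<close> harmless in the limit: completing the square gives
  \<open>\<rho>\<^sup>3 a - \<rho> \<kappa> (sqrt a) \<ge> - \<kappa>\<^sup>2 / (4 \<rho>)\<close>, whereas exponent 2 would only give a constant.
\<close>

lemma penalty_bound_on_compact: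
  fixes a p f :: "'a::first_countable_topology \<Rightarrow> real"
  assumes C: "compact C"
    and cont: "continuous_on C a" "continuous_on C p" "continuous_on C f"
    and a0: "\<And>c. c \<in> C \<Longrightarrow> 0 \<le> a c"
    and pa: "\<And>c. c \<in> C \<Longrightarrow> - \<kappa> * sqrt (a c) \<le> p c"
    and neg: "\<And>c. c \<in> C \<Longrightarrow> a c = 0 \<Longrightarrow> p c \<le> 0 \<Longrightarrow> f c < 0"
  obtains \<rho> where "\<And>c. c \<in> C \<Longrightarrow> f c \<le> \<rho> ^ 3 * a c + \<rho> * p c"
proof -
  have "\<exists>\<rho>. \<forall>c\<in>C. f c \<le> \<rho> ^ 3 * a c + \<rho> * p c"
  proof (rule ccontr)
    assume "\<not> ?thesis"
    then have "\<forall>n. \<exists>c\<in>C. f c > real (Suc n) ^ 3 * a c + real (Suc n) * p c"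
      by (meson not_le)
    then obtain X where X: "\<And>n. X n \<in> C"
        "\<And>n. f (X n) > real (Suc n) ^ 3 * a (X n) + real (Suc n) * p (X n)"
      by metis
    obtain l r where l: "l \<in> C" and r: "strict_mono (r :: nat \<Rightarrow> nat)" and lim: "(X \<circ> r) \<longlonglongrightarrow> l"
      using compact_imp_seq_compact[OF C] X(1) unfolding seq_compact_def by metis
    define m where "m k = real (Suc (r k))" for k
    have m0: "m k > 0" for k by (simp add: m_def)
    have "filterlim (\<lambda>k. real (Suc k)) at_top sequentially"
      using filterlim_real_sequentially filterlim_sequentially_Suc by blast
    then have mtop: "filterlim m at_top sequentially"
      unfolding m_def using filterlim_compose filterlim_subseq[OF r] by blast
    have inv: "(\<lambda>k. inverse (m k)) \<longlonglongrightarrow> 0"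
      using tendsto_inverse_0_at_top[OF mtop] .
    have conv: "(\<lambda>k. g (X (r k))) \<longlonglongrightarrow> g l" if "continuous_on C g" for g :: "'a \<Rightarrow> real"
      using continuous_on_tendsto_compose[OF that lim l] X(1) by (simp add: o_def)
    note fl = conv[OF cont(3)] and pl = conv[OF cont(2)] and al = conv[OF cont(1)]
    have lt: "f (X (r k)) > m k ^ 3 * a (X (r k)) + m k * p (X (r k))" for k
      using X(2)[of "r k"] by (simp add: m_def)
    \<comment> \<open>The inequality \<open>lt\<close> is read at three scales: divided by
      \<open>m k\<close> it gives \<open>p l \<le> 0\<close>, divided by \<open>m k ^ 3\<close> it
      gives \<open>a l \<le> 0\<close>, and undivided, with the square completed, it gives
      \<open>0 \<le> f l\<close>. Together these contradict \<open>neg\<close>.\<close>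
    have "p (X (r k)) \<le> f (X (r k)) * inverse (m k)" for k
    proof -
      have "m k * p (X (r k)) \<le> f (X (r k))"
        using lt[of k] mult_nonneg_nonneg[of "m k ^ 3" "a (X (r k))"] a0[OF X(1), of "r k"] m0[of k]
        by (smt (verit) zero_le_power)
      then show ?thesis using m0[of k] by (simp add: field_simps)
    qed
    then have "p l \<le> f l * 0"
      by (intro LIMSEQ_le[OF pl tendsto_mult[OF fl inv]]) auto
    moreover have "a (X (r k)) \<le> f (X (r k)) * inverse (m k) ^ 3 - p (X (r k)) * inverse (m k) ^ 2" for k
      using lt[of k] m0[of k] by (simp add: field_simps power2_eq_square power3_eq_cube)
    then have "a l \<le> f l * 0 ^ 3 - p l * 0 ^ 2"
      by (intro LIMSEQ_le[OF al tendsto_diff[OF tendsto_mult[OF fl tendsto_power[OF inv]]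
            tendsto_mult[OF pl tendsto_power[OF inv]]]]) auto
    moreover have "- (\<kappa>\<^sup>2 / 4) * inverse (m k) \<le> f (X (r k))" for k
    proof -
      define w where "w = sqrt (a (X (r k)))"
      have w: "a (X (r k)) = w\<^sup>2" unfolding w_def using a0[OF X(1)] by simp
      have "m k * p (X (r k)) \<ge> m k * (- \<kappa> * w)"
        using pa[OF X(1), of "r k"] m0[of k] unfolding w_def by (intro mult_left_mono) auto
      moreover have "m k ^ 3 * w\<^sup>2 + m k * (- \<kappa> * w) + (\<kappa>\<^sup>2 / 4) * inverse (m k)
          = inverse (m k) * (m k ^ 2 * w - \<kappa> / 2)\<^sup>2"
        using m0[of k] by (simp add: field_simps power2_eq_square power3_eq_cube)
      moreover have "inverse (m k) * (m k ^ 2 * w - \<kappa> / 2)\<^sup>2 \<ge> 0"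
        using m0[of k] by simp
      ultimately show ?thesis using lt[of k] unfolding w by linarith
    qed
    then have "- (\<kappa>\<^sup>2 / 4) * 0 \<le> f l"
      by (intro LIMSEQ_le[OF tendsto_mult[OF tendsto_const inv] fl]) auto
    ultimately show False
      using neg[OF l] a0[OF l] by simp
  qed
  then show ?thesis using that by blast
qed

section \<open>Compact pieces of the orthant and continuity of forms on them\<close>

definition orthant_simplex :: "nat \<Rightarrow> (nat \<Rightarrow> real) set" where
  "orthant_simplex n = {f. (\<forall>i<n. 0 \<le> f i) \<and> (\<Sum>i<n. f i) = 1 \<and> (\<forall>i\<ge>n. f i = 0)}"

lemma continuous_on_coordinate: "continuous_on A (\<lambda>f :: nat \<Rightarrow> real. f i)"
  by (rule continuous_on_subset[OF continuous_on_product_coordinates]) simp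

text \<open>As in \<open>orthant_simplex\<close>, the coordinates from \<open>n\<close> on are
  pinned to 0: left free, they would destroy compactness in the product topology on
  \<open>nat \<Rightarrow> real\<close>.\<close>

definition orthant_box :: "nat \<Rightarrow> real \<Rightarrow> (nat \<Rightarrow> real) set" where
  "orthant_box n B = {f. (\<forall>i<n. f i \<in> {0..B}) \<and> (\<forall>i\<ge>n. f i = 0)}"

lemma compact_orthant_box: "compact (orthant_box n B)"
proof -
  have eq: "orthant_box n B = PiE UNIV (\<lambda>i. if i < n then {0..B} else {0})"
    by (auto simp: orthant_box_def PiE_def Pi_def not_less split: if_splits)
  have "compactin (product_topology (\<lambda>i. euclidean) UNIV)
      (PiE UNIV (\<lambda>i. if i < n then {0..B} else {0::real}))"
    unfolding compactin_PiE by auto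
  then show ?thesis
    unfolding eq by (simp add: euclidean_product_topology)
qed

lemma compact_orthant_simplex: "compact (orthant_simplex n)"
proof -
  have "f i \<le> 1" if "\<forall>i<n. 0 \<le> f i" "(\<Sum>i<n. f i) = 1" "i < n" for f :: "nat \<Rightarrow> real" and i
    using member_le_sum[of i "{..<n}" f] that by auto
  then have eq: "orthant_simplex n =
      orthant_box n 1 \<inter> {f. (\<Sum>i<n. f i) = 1}"
    unfolding orthant_simplex_def orthant_box_def by auto
  have "closed {f :: nat \<Rightarrow> real. (\<Sum>i<n. f i) = 1}"
    by (intro closed_Collect_eq continuous_on_sum continuous_on_coordinate continuous_intros)
  then show ?thesis unfolding eq using compact_orthant_box compact_Int_closed by blast
qed

lemma continuous_on_scalar_prod_vec:
  assumes "\<And>i. i < n \<Longrightarrow> continuous_on C (\<lambda>f. u f $ i)"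
    and "\<And>i. i < n \<Longrightarrow> continuous_on C (\<lambda>f. w f $ i)"
    and "\<And>f. dim_vec (w f) = n"
  shows "continuous_on C (\<lambda>f. u f \<bullet> w f :: real)"
  unfolding scalar_prod_def assms(3) using assms(1,2) by (intro continuous_intros) auto

lemma continuous_on_mult_mat_vec:
  assumes "N \<in> carrier_mat m n" "i < m"
    and "\<And>i. i < n \<Longrightarrow> continuous_on C (\<lambda>f. w f $ i :: real)"
    and "\<And>f. dim_vec (w f) = n"
  shows "continuous_on C (\<lambda>f. (N *\<^sub>v w f) $ i)"
  using assms by (auto intro!: continuous_on_scalar_prod_vec[where n = n] continuous_on_const)

lemma continuous_on_vec_index:
  "i < n \<Longrightarrow> continuous_on A (\<lambda>f :: nat \<Rightarrow> real. Matrix.vec n f $ i)"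
  by (simp add: continuous_on_coordinate)

lemma continuous_on_quadratic_form:
  "N \<in> carrier_mat n n \<Longrightarrow>
    continuous_on A (\<lambda>f :: nat \<Rightarrow> real. Matrix.vec n f \<bullet> (N *\<^sub>v Matrix.vec n f))"
  by (intro continuous_on_scalar_prod_vec[where n = n] continuous_on_mult_mat_vec
      continuous_on_vec_index) auto

lemma continuous_on_linear_form:
  "q \<in> carrier_vec n \<Longrightarrow> continuous_on A (\<lambda>f :: nat \<Rightarrow> real. q \<bullet> Matrix.vec n f)"
  by (intro continuous_on_scalar_prod_vec[where n = n] continuous_on_vec_index continuous_on_const) auto

lemma quadratic_form_smult:
  fixes N :: "real Matrix.mat"
  assumes "N \<in> carrier_mat n n" "z \<in> carrier_vec n"
  shows "(c \<cdot>\<^sub>v z) \<bullet> (N *\<^sub>v (c \<cdot>\<^sub>v z)) = c\<^sup>2 * (z \<bullet> (N *\<^sub>v z))"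
  using assms by (simp add: mult_mat_vec[of N n n] power2_eq_square)

lemma vec_nonneg_iff: "z \<in> carrier_vec n \<Longrightarrow> 0\<^sub>v n \<le> (z :: real Matrix.vec) \<longleftrightarrow> (\<forall>i<n. 0 \<le> z $ i)"
  by (auto simp: less_eq_vec_def)

lemma scalar_prod_self_nonneg: "0 \<le> (u :: real Matrix.vec) \<bullet> u"
  by (simp add: scalar_prod_def sum_nonneg)

lemma index_sq_le_scalar_prod_self:
  "j < dim_vec u \<Longrightarrow> ((u :: real Matrix.vec) $ j)\<^sup>2 \<le> u \<bullet> u"
  using member_le_sum[of j "{0..<dim_vec u}" "\<lambda>j. u $ j * u $ j"]
  by (simp add: scalar_prod_def power2_eq_square)

lemma index_le_sqrt_scalar_prod_self:
  "j < dim_vec u \<Longrightarrow> (u :: real Matrix.vec) $ j \<le> sqrt (u \<bullet> u)"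
  using index_sq_le_scalar_prod_self real_le_rsqrt by blast

lemma scalar_prod_self_eq_0_iff:
  "u \<in> carrier_vec n \<Longrightarrow> (u :: real Matrix.vec) \<bullet> u = 0 \<longleftrightarrow> u = 0\<^sub>v n"
proof
  assume u: "u \<in> carrier_vec n" "u \<bullet> u = 0"
  show "u = 0\<^sub>v n"
  proof (rule eq_vecI)
    show "u $ i = 0\<^sub>v n $ i" if "i < dim_vec (0\<^sub>v n)" for i
      using index_sq_le_scalar_prod_self[of i u] u that by auto
  qed (use u in auto)
qed auto

text \<open>
  The hypothesis \<open>row\<close> abstracts the constraints \<open>z\<^sub>i + z\<^sub>i' = 1\<close>: they bound \<open>z\<^sub>i - s\<close> by the residual
  \<open>|Sb z - s tb|\<close>, which controls the terms \<open>z\<^sub>i (s - z\<^sub>i)\<close> where \<open>z\<^sub>i > s\<close>.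
\<close>

lemma homogenized_penalty:
  fixes N Sb :: "real Matrix.mat"
  assumes N: "N \<in> carrier_mat n n" and q: "q \<in> carrier_vec n"
    and Sb: "Sb \<in> carrier_mat m n" and tb: "tb \<in> carrier_vec m" and kn: "k \<le> n"
    and row: "\<And>i z. i < k \<Longrightarrow> z \<in> carrier_vec n \<Longrightarrow> 0\<^sub>v n \<le> z
      \<Longrightarrow> \<exists>j<m. tb $ j = 1 \<and> z $ i \<le> (Sb *\<^sub>v z) $ j"
    and lt: "\<And>z. z \<in> carrier_vec n \<Longrightarrow> 0\<^sub>v n \<le> z \<Longrightarrow> Sb *\<^sub>v z = tb \<Longrightarrow> (\<forall>i<k. z $ i \<in> {0, 1})
      \<Longrightarrow> z \<bullet> (N *\<^sub>v z) + q \<bullet> z < v"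
    and rec: "\<And>z. z \<in> carrier_vec n \<Longrightarrow> 0\<^sub>v n \<le> z \<Longrightarrow> Sb *\<^sub>v z = 0\<^sub>v m \<Longrightarrow> (\<forall>i<k. z $ i = 0)
      \<Longrightarrow> z \<noteq> 0\<^sub>v n \<Longrightarrow> z \<bullet> (N *\<^sub>v z) < 0"
  obtains \<rho> where "\<And>z s. z \<in> carrier_vec n \<Longrightarrow> 0\<^sub>v n \<le> z \<Longrightarrow> 0 \<le> s \<Longrightarrow>
    z \<bullet> (N *\<^sub>v z) + s * (q \<bullet> z) - v * s\<^sup>2
      \<le> \<rho> ^ 3 * ((Sb *\<^sub>v z - s \<cdot>\<^sub>v tb) \<bullet> (Sb *\<^sub>v z - s \<cdot>\<^sub>v tb)) + \<rho> * (\<Sum>i<k. z $ i * (s - z $ i))"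
proof -
  define F where "F z s = z \<bullet> (N *\<^sub>v z) + s * (q \<bullet> z) - v * s\<^sup>2" for z s
  define D where "D z s = Sb *\<^sub>v z - s \<cdot>\<^sub>v tb" for z s
  define B where "B z s = (\<Sum>i<k. z $ i * (s - z $ i))" for z :: "real Matrix.vec" and s
  have F_smult: "F (c \<cdot>\<^sub>v z) (c * s) = c\<^sup>2 * F z s" if "z \<in> carrier_vec n" for z c s
    unfolding F_def quadratic_form_smult[OF N that] using q that
    by (simp add: algebra_simps power2_eq_square)
  have D_smult: "D (c \<cdot>\<^sub>v z) (c * s) = c \<cdot>\<^sub>v D z s" if "z \<in> carrier_vec n" for z c s
    unfolding D_def using Sb tb that
    by (auto simp: mult_mat_vec[OF Sb] algebra_simps intro!: eq_vecI)
  have D_carrier: "D z s \<in> carrier_vec m" for z s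
    unfolding D_def using tb by (intro carrier_vecI) simp
  have B_smult: "B (c \<cdot>\<^sub>v z) (c * s) = c\<^sup>2 * B z s" if "z \<in> carrier_vec n" for z c s
    unfolding B_def sum_distrib_left using kn that
    by (intro sum.cong) (auto simp: algebra_simps power2_eq_square)
  \<comment> \<open>Both sides of the claim are homogeneous of degree 2 in \<open>(z, s)\<close>, so
    it suffices to treat a simplex with one more coordinate; coordinate \<open>n\<close> plays the
    role of \<open>s\<close>.\<close>
  let ?C = "orthant_simplex (Suc n)"
  let ?z = "\<lambda>f. Matrix.vec n f"
  have zC: "0\<^sub>v n \<le> ?z f" "?z f \<in> carrier_vec n" "0 \<le> f n" "\<And>i. i < n \<Longrightarrow> f i \<le> 1" if "f \<in> ?C" for f
    using that member_le_sum[of _ "{..<Suc n}" f] by (auto simp: orthant_simplex_def vec_nonneg_iff)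
  have excess: "z $ i - s \<le> sqrt (D z s \<bullet> D z s)"
    if z: "z \<in> carrier_vec n" "0\<^sub>v n \<le> z" and i: "i < k" for z :: "real Matrix.vec" and i s
  proof -
    obtain j where j: "j < m" "tb $ j = 1" "z $ i \<le> (Sb *\<^sub>v z) $ j"
      using row[OF i z] by blast
    then have "z $ i - s \<le> D z s $ j" unfolding D_def using Sb tb by simp
    also have "\<dots> \<le> sqrt (D z s \<bullet> D z s)"
      using index_le_sqrt_scalar_prod_self[of j "D z s"] D_carrier[of z s] j by auto
    finally show ?thesis .
  qed
  obtain \<rho> where \<rho>: "\<And>f. f \<in> ?C \<Longrightarrow>
      F (?z f) (f n) \<le> \<rho> ^ 3 * (D (?z f) (f n) \<bullet> D (?z f) (f n)) + \<rho> * B (?z f) (f n)"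
  proof (rule penalty_bound_on_compact[where C = ?C and a = "\<lambda>f. D (?z f) (f n) \<bullet> D (?z f) (f n)"
        and p = "\<lambda>f. B (?z f) (f n)" and f = "\<lambda>f. F (?z f) (f n)" and \<kappa> = "real k"])
    show "compact ?C" by (rule compact_orthant_simplex)
    show "continuous_on ?C (\<lambda>f. F (?z f) (f n))"
      unfolding F_def
      by (intro continuous_intros continuous_on_quadratic_form[OF N] continuous_on_linear_form[OF q]
          continuous_on_coordinate)
    have "continuous_on ?C (\<lambda>f. (Sb *\<^sub>v ?z f) $ j - f n * tb $ j)" if "j < m" for j
      using Sb that
      by (intro continuous_intros continuous_on_mult_mat_vec[OF Sb] continuous_on_vec_index
          continuous_on_coordinate) auto
    then have "continuous_on ?C (\<lambda>f. D (?z f) (f n) $ j)" if "j < m" for j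
      using that tb Sb unfolding D_def by simp
    then show "continuous_on ?C (\<lambda>f. D (?z f) (f n) \<bullet> D (?z f) (f n))"
      using D_carrier by (intro continuous_on_scalar_prod_vec[where n = m]) auto
    show "continuous_on ?C (\<lambda>f. B (?z f) (f n))"
      unfolding B_def using kn
      by (intro continuous_intros continuous_on_vec_index continuous_on_coordinate) auto
    show "0 \<le> D (?z f) (f n) \<bullet> D (?z f) (f n)" for f by (rule scalar_prod_self_nonneg)
    show "- real k * sqrt (D (?z f) (f n) \<bullet> D (?z f) (f n)) \<le> B (?z f) (f n)" if f: "f \<in> ?C" for f
    proof -
      define w where "w = sqrt (D (?z f) (f n) \<bullet> D (?z f) (f n))"
      have w0: "0 \<le> w" unfolding w_def by (simp add: scalar_prod_self_nonneg)
      \<comment> \<open>Each of the \<open>k\<close> summands is at least \<open>- w\<close>: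
        \<open>excess\<close> bounds the second factor below by \<open>- w\<close>, and the first
        factor is at most 1 on the simplex. Hence the choice
        \<open>\<kappa> = real k\<close>.\<close>
      have "- w \<le> ?z f $ i * (f n - ?z f $ i)" if i: "i < k" for i
      proof -
        have fi: "0 \<le> ?z f $ i" "?z f $ i \<le> 1"
          using zC[OF f] i kn by (auto simp: vec_nonneg_iff)
        have "- w \<le> ?z f $ i * (- w)" using fi w0 by (simp add: mult_left_le_one_le)
        also have "\<dots> \<le> ?z f $ i * (f n - ?z f $ i)"
          using excess[OF zC(2,1)[OF f] i, of "f n"] fi unfolding w_def by (intro mult_left_mono) auto
        finally show ?thesis .
      qed
      then have "(\<Sum>i<k. - w) \<le> B (?z f) (f n)"
        unfolding B_def by (intro sum_mono) auto
      then show ?thesis unfolding w_def by simp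
    qed
    show "F (?z f) (f n) < 0"
      if f: "f \<in> ?C" and D0: "D (?z f) (f n) \<bullet> D (?z f) (f n) = 0" and B0: "B (?z f) (f n) \<le> 0" for f
    proof -
      note z = zC(2,1)[OF f]
      let ?s = "f n"
      \<comment> \<open>A zero residual turns \<open>excess\<close> into
        \<open>z $ i \<le> s\<close>, so all summands of \<open>B\<close> are nonnegative. As their
        sum is at most 0, each vanishes, and every \<open>z $ i\<close> is 0 or
        \<open>s\<close>.\<close>
      have le: "?z f $ i \<le> ?s" if "i < k" for i
        using excess[OF z that, of ?s] D0 by simp
      have nn: "0 \<le> ?z f $ i * (?s - ?z f $ i)" if "i < k" for i
        using le[OF that] z that kn by (simp add: vec_nonneg_iff)
      have "B (?z f) ?s = 0"
        using B0 sum_nonneg[of "{..<k}" "\<lambda>i. ?z f $ i * (?s - ?z f $ i)"] nn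
        unfolding B_def by fastforce
      then have bin: "?z f $ i * (?s - ?z f $ i) = 0" if "i < k" for i
        using sum_nonneg_eq_0_iff[of "{..<k}" "\<lambda>i. ?z f $ i * (?s - ?z f $ i)"] nn that
        unfolding B_def by auto
      have Dz: "Sb *\<^sub>v ?z f = ?s \<cdot>\<^sub>v tb"
      proof -
        have "D (?z f) ?s = 0\<^sub>v m" using D0 scalar_prod_self_eq_0_iff[OF D_carrier] by simp
        then have "D (?z f) ?s $ j = 0" if "j < m" for j using that by simp
        then show ?thesis unfolding D_def using Sb tb by (intro eq_vecI) auto
      qed
      show ?thesis
      proof (cases "?s = 0")
        case True
        have "?z f $ i = 0" if "i < k" for i using bin[OF that] True by simp
        moreover have "Sb *\<^sub>v ?z f = 0\<^sub>v m" using Dz True tb by auto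
        moreover have "?z f \<noteq> 0\<^sub>v n"
        proof
          assume "?z f = 0\<^sub>v n"
          then have "\<forall>i<n. f i = 0" by (metis index_vec index_zero_vec(1))
          then show False using f True by (auto simp: orthant_simplex_def)
        qed
        ultimately show ?thesis using rec[OF z] True by (auto simp: F_def)
      next
        case False
        then have s: "?s > 0" using zC(3)[OF f] by simp
        define y where "y = (1 / ?s) \<cdot>\<^sub>v ?z f"
        have y: "y \<in> carrier_vec n" "0\<^sub>v n \<le> y"
          using z s by (auto simp: y_def vec_nonneg_iff)
        have "Sb *\<^sub>v y = tb"
          unfolding y_def mult_mat_vec[OF Sb z(1)] Dz using s tb by (auto intro!: eq_vecI)
        moreover have "\<forall>i<k. y $ i \<in> {0, 1}"
          using bin kn s by (auto simp: y_def)
        ultimately have "F y 1 < 0" using lt[OF y] by (simp add: F_def)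
        moreover have "F (?z f) ?s = ?s\<^sup>2 * F y 1"
          using F_smult[OF y(1), of ?s 1] s z by (simp add: y_def smult_smult_assoc)
        ultimately show ?thesis using s by (simp add: mult_pos_neg)
      qed
    qed
  qed (auto intro: that)
  show ?thesis
  proof (rule that[of \<rho>], fold D_def B_def F_def)
    fix z :: "real Matrix.vec" and s :: real
    assume z: "z \<in> carrier_vec n" "0\<^sub>v n \<le> z" and s: "0 \<le> s"
    define \<sigma> where "\<sigma> = (\<Sum>i<n. z $ i) + s"
    show "F z s \<le> \<rho> ^ 3 * (D z s \<bullet> D z s) + \<rho> * B z s"
    \<comment> \<open>The origin is the only point of the orthant that cannot be scaled onto the
      simplex; both sides vanish there.\<close>
    proof (cases "\<sigma> = 0")
      case True
      have nn: "\<forall>i<n. 0 \<le> z $ i" using z by (simp add: vec_nonneg_iff)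
      then have sum0: "(\<Sum>i<n. z $ i) = 0" and s0: "s = 0"
        using True s sum_nonneg[of "{..<n}" "\<lambda>i. z $ i"] unfolding \<sigma>_def by auto
      then have "z $ i = 0" if "i < n" for i
        using sum_nonneg_eq_0_iff[of "{..<n}" "\<lambda>i. z $ i"] nn that by auto
      then have "z = 0\<^sub>v n" using z by (intro eq_vecI) auto
      then have "F z s = 0" "D z s = 0\<^sub>v m" "B z s = 0"
        using s0 N q Sb tb kn by (auto simp: F_def D_def B_def intro!: eq_vecI)
      then show ?thesis by simp
    next
      case False
      have nn: "\<forall>i<n. 0 \<le> z $ i" using z by (simp add: vec_nonneg_iff)
      then have \<sigma>: "\<sigma> > 0"
        using False s sum_nonneg[of "{..<n}" "\<lambda>i. z $ i"] unfolding \<sigma>_def by force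
      define f where "f i = (if i < n then z $ i / \<sigma> else if i = n then s / \<sigma> else 0)" for i
      have "(\<Sum>i<Suc n. f i) = (\<Sum>i<n. z $ i) / \<sigma> + s / \<sigma>"
        by (simp add: f_def sum_divide_distrib)
      also have "\<dots> = 1" using \<sigma> by (simp add: \<sigma>_def add_divide_distrib[symmetric])
      finally have fC: "f \<in> ?C"
        using nn s \<sigma> unfolding orthant_simplex_def by (auto simp: f_def)
      have zf: "?z f = (1 / \<sigma>) \<cdot>\<^sub>v z" "f n = (1 / \<sigma>) * s"
        using z by (auto simp: f_def)
      have "(1 / \<sigma>)\<^sup>2 * F z s \<le> (1 / \<sigma>)\<^sup>2 * (\<rho> ^ 3 * (D z s \<bullet> D z s) + \<rho> * B z s)"
        using \<rho>[OF fC] D_carrier[of z s]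
        unfolding zf F_smult[OF z(1)] D_smult[OF z(1)] B_smult[OF z(1)]
        by (simp add: algebra_simps power2_eq_square)
      then show ?thesis using \<sigma> by (simp add: mult_le_cancel_left_pos)
    qed
  qed
qed

section \<open>Duality for the copositive program\<close>

lemma scalar_prod_transpose_mult:
  fixes A :: "real Matrix.mat"
  assumes "A \<in> carrier_mat m n" "x \<in> carrier_vec n" "y \<in> carrier_vec m"
  shows "x \<bullet> (transpose_mat A *\<^sub>v y) = (A *\<^sub>v x) \<bullet> y"
  using transpose_vec_mult_scalar[OF assms] assms
  by (metis comm_scalar_prod mult_mat_vec_carrier transpose_carrier_mat)

lemma transpose_minus_symmetric:
  fixes A B :: "real Matrix.mat"
  assumes "A \<in> carrier_mat n n" "B \<in> carrier_mat n n" "transpose_mat A = A" "transpose_mat B = B"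
  shows "transpose_mat (A - B) = A - B"
  using transpose_minus[OF assms(1,2)] assms(3,4) by simp

lemma bordered_mat_carrier:
  "N \<in> carrier_mat n n \<Longrightarrow> q \<in> carrier_vec n \<Longrightarrow> bordered_mat N q \<tau> \<in> carrier_mat (n + 1) (n + 1)"
  unfolding bordered_mat_def by (auto intro!: four_block_carrier_mat)

lemma bordered_mat_transpose:
  assumes "N \<in> carrier_mat n n" "q \<in> carrier_vec n" "transpose_mat N = N"
  shows "transpose_mat (bordered_mat N q \<tau>) = bordered_mat N q \<tau>"
proof -
  have 1: "transpose_mat (mat_of_cols n [q]) = mat_of_rows n [q]"
    "transpose_mat (mat_of_rows n [q]) = mat_of_cols n [q]"
    by (auto simp: mat_of_cols_def mat_of_rows_def)
  have 2: "transpose_mat (Matrix.mat 1 1 (\<lambda>_. \<tau>)) = Matrix.mat 1 1 (\<lambda>_. \<tau>)"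
    by auto
  show ?thesis
    unfolding bordered_mat_def using assms(2) 1 2
    by (subst transpose_four_block_mat[OF assms(1)]) (auto simp: assms(3))
qed

lemma bordered_mat_form:
  assumes N: "N \<in> carrier_mat n n" and q: "q \<in> carrier_vec n" and z: "z \<in> carrier_vec n"
  shows "(z @\<^sub>v Matrix.vec 1 (\<lambda>_. s)) \<bullet> (bordered_mat N q \<tau> *\<^sub>v (z @\<^sub>v Matrix.vec 1 (\<lambda>_. s)))
    = z \<bullet> (N *\<^sub>v z) + 2 * s * (q \<bullet> z) + \<tau> * s\<^sup>2"
proof -
  let ?s = "Matrix.vec 1 (\<lambda>_. s)"
  have s: "?s \<in> carrier_vec 1" by simp
  have col: "mat_of_cols n [q] *\<^sub>v ?s = s \<cdot>\<^sub>v q"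
    using q by (intro eq_vecI) (auto simp: scalar_prod_def mat_of_cols_def)
  have row: "mat_of_rows n [q] *\<^sub>v z = Matrix.vec 1 (\<lambda>_. q \<bullet> z)"
    using q by (intro eq_vecI) auto
  have one: "Matrix.mat 1 1 (\<lambda>_. \<tau>) *\<^sub>v ?s = Matrix.vec 1 (\<lambda>_. \<tau> * s)"
    by (intro eq_vecI) (auto simp: scalar_prod_def)
  have "bordered_mat N q \<tau> *\<^sub>v (z @\<^sub>v ?s)
      = (N *\<^sub>v z + s \<cdot>\<^sub>v q) @\<^sub>v (Matrix.vec 1 (\<lambda>_. q \<bullet> z) + Matrix.vec 1 (\<lambda>_. \<tau> * s))"
    unfolding bordered_mat_def using q
    by (subst four_block_mat_mult_vec[OF N _ _ mat_carrier z s]) (auto simp: col[simplified] row one[simplified])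
  also have "(z @\<^sub>v ?s) \<bullet> \<dots> = z \<bullet> (N *\<^sub>v z + s \<cdot>\<^sub>v q)
      + ?s \<bullet> (Matrix.vec 1 (\<lambda>_. q \<bullet> z) + Matrix.vec 1 (\<lambda>_. \<tau> * s))"
    by (rule scalar_prod_append[OF z s]) (use N q in \<open>auto intro!: carrier_vecI\<close>)
  also have "z \<bullet> (N *\<^sub>v z + s \<cdot>\<^sub>v q) = z \<bullet> (N *\<^sub>v z) + s * (q \<bullet> z)"
    using N q z by (subst scalar_prod_add_distrib[of _ n]) (auto simp: comm_scalar_prod[of z n])
  also have "?s \<bullet> (Matrix.vec 1 (\<lambda>_. q \<bullet> z) + Matrix.vec 1 (\<lambda>_. \<tau> * s)) = s * (q \<bullet> z) + \<tau> * s\<^sup>2"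
    by (simp add: scalar_prod_def algebra_simps power2_eq_square)
  finally show ?thesis by simp
qed

lemma diag_of_vec_mult:
  "v \<in> carrier_vec n \<Longrightarrow> u \<in> carrier_vec n \<Longrightarrow> diag_of_vec v *\<^sub>v u = hadamard_vec v u"
  unfolding diag_of_vec_def hadamard_vec_def mat_diag_def
  by (intro eq_vecI) (auto simp: scalar_prod_def if_distrib[of "\<lambda>x. x * _"] cong: if_cong)

lemma diag_of_vec_carrier: "v \<in> carrier_vec n \<Longrightarrow> diag_of_vec v \<in> carrier_mat n n"
  unfolding diag_of_vec_def by auto

lemma diag_of_vec_transpose: "transpose_mat (diag_of_vec v) = diag_of_vec v"
  unfolding diag_of_vec_def mat_diag_def by (intro eq_matI) auto

lemma scalar_prod_hadamard:
  assumes "\<phi> \<in> carrier_vec m" "u \<in> carrier_vec m"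
  shows "u \<bullet> hadamard_vec \<phi> u = hadamard_vec u u \<bullet> \<phi>"
  using assms by (auto simp: scalar_prod_def hadamard_vec_def intro!: sum.cong)

lemma padded_scalar_prod:
  assumes "\<gamma> \<in> carrier_vec k" "z \<in> carrier_vec n" "k \<le> n"
  shows "(\<gamma> @\<^sub>v 0\<^sub>v (n - k)) \<bullet> z = (\<Sum>i<k. \<gamma> $ i * z $ i)"
proof -
  have "(\<gamma> @\<^sub>v 0\<^sub>v (n - k)) \<bullet> z = (\<Sum>i\<in>{0..<n}. if i < k then \<gamma> $ i * z $ i else 0)"
    using assms by (auto simp: scalar_prod_def intro!: sum.cong)
  also have "\<dots> = (\<Sum>i<k. \<gamma> $ i * z $ i)"
    using assms by (intro sum.mono_neutral_cong_right) auto
  finally show ?thesis .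
qed

lemma padded_diag_form:
  assumes "\<gamma> \<in> carrier_vec k" "z \<in> carrier_vec n" "k \<le> n"
  shows "z \<bullet> (diag_of_vec (\<gamma> @\<^sub>v 0\<^sub>v (n - k)) *\<^sub>v z) = (\<Sum>i<k. \<gamma> $ i * (z $ i)\<^sup>2)"
proof -
  let ?g = "\<gamma> @\<^sub>v 0\<^sub>v (n - k)"
  have g: "?g \<in> carrier_vec n" using assms(1,3) by (intro carrier_vecI) auto
  have "z \<bullet> (diag_of_vec ?g *\<^sub>v z) = ?g \<bullet> hadamard_vec z z"
    using assms g by (auto simp: diag_of_vec_mult scalar_prod_def hadamard_vec_def intro!: sum.cong)
  also have "\<dots> = (\<Sum>i<k. \<gamma> $ i * hadamard_vec z z $ i)"
    by (rule padded_scalar_prod[OF assms(1) _ assms(3)])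
      (use assms in \<open>auto simp: hadamard_vec_def\<close>)
  finally show ?thesis using assms by (auto simp: hadamard_vec_def power2_eq_square)
qed

text \<open>Used in both directions: \<open>u = - (Ab *\<^sub>v z)\<close> turns semidefiniteness of
  the block matrix into a lower bound for \<open>H\<close>, and for
  \<open>H = transpose_mat Ab * Ab\<close> the form is the square of
  \<open>u + Ab *\<^sub>v z\<close>.\<close>

lemma schur_block_form:
  fixes Ab H :: "real Matrix.mat"
  assumes Ab: "Ab \<in> carrier_mat M n" and H: "H \<in> carrier_mat n n" and u: "u \<in> carrier_vec M" and z: "z \<in> carrier_vec n"
  shows "(u @\<^sub>v z) \<bullet> (four_block_mat (1\<^sub>m M) Ab (transpose_mat Ab) H *\<^sub>v (u @\<^sub>v z))
    = u \<bullet> u + 2 * (u \<bullet> (Ab *\<^sub>v z)) + z \<bullet> (H *\<^sub>v z)"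
proof -
  have Az: "Ab *\<^sub>v z \<in> carrier_vec M" using Ab z by simp
  have "four_block_mat (1\<^sub>m M) Ab (transpose_mat Ab) H *\<^sub>v (u @\<^sub>v z)
      = (u + Ab *\<^sub>v z) @\<^sub>v (transpose_mat Ab *\<^sub>v u + H *\<^sub>v z)"
    using u by (subst four_block_mat_mult_vec[OF _ Ab _ H u z]) (use Ab in auto)
  also have "(u @\<^sub>v z) \<bullet> \<dots> = u \<bullet> (u + Ab *\<^sub>v z) + z \<bullet> (transpose_mat Ab *\<^sub>v u + H *\<^sub>v z)"
    by (rule scalar_prod_append[OF u z]) (use u Az Ab H z in \<open>auto intro!: carrier_vecI\<close>)
  also have "u \<bullet> (u + Ab *\<^sub>v z) = u \<bullet> u + u \<bullet> (Ab *\<^sub>v z)"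
    using u Az by (intro scalar_prod_add_distrib) auto
  also have "z \<bullet> (transpose_mat Ab *\<^sub>v u + H *\<^sub>v z) = u \<bullet> (Ab *\<^sub>v z) + z \<bullet> (H *\<^sub>v z)"
    using u z Ab H Az
    by (subst scalar_prod_add_distrib[of _ n])
      (auto simp: scalar_prod_transpose_mult[OF Ab z u] comm_scalar_prod[OF Az u])
  finally show ?thesis by simp
qed

section \<open>Weak and strong duality for abstract lifted data\<close>

context
  fixes m n k M :: nat and Sb Ab Pb :: "real Matrix.mat" and tb bb :: "real Matrix.vec"
  assumes Sb: "Sb \<in> carrier_mat m n" and Ab: "Ab \<in> carrier_mat M n" and Pb: "Pb \<in> carrier_mat n n"
    and tb: "tb \<in> carrier_vec m" and bb: "bb \<in> carrier_vec n" and kn: "k \<le> n"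
begin

text \<open>The Lagrangian reading of the copositive constraint: \<open>\<phi>\<close> multiplies
  the squared entries of \<open>Sb *\<^sub>v z\<close>, \<open>\<psi>\<close> the entries
  themselves, and \<open>\<gamma>\<close> the binary conditions. Since \<open>\<gamma>\<close>
  occurs with opposite signs on the diagonal and in the border, it produces exactly the products
  \<open>z $ i * (s - z $ i)\<close>, which vanish at binary \<open>z\<close> and
  \<open>s = 1\<close>.\<close>

lemma cop_constraint_form:
  assumes \<psi>: "\<psi> \<in> carrier_vec m" and \<phi>: "\<phi> \<in> carrier_vec m" and \<gamma>: "\<gamma> \<in> carrier_vec k"
    and H: "H \<in> carrier_mat n n" and z: "z \<in> carrier_vec n"
    and N: "N = transpose_mat Sb * diag_of_vec \<phi> * Sb - H - Pb - diag_of_vec (\<gamma> @\<^sub>v 0\<^sub>v (n - k))"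
    and q: "q = (1/2) \<cdot>\<^sub>v (transpose_mat Sb *\<^sub>v \<psi> - bb + (\<gamma> @\<^sub>v 0\<^sub>v (n - k)))"
  shows "N \<in> carrier_mat n n" "q \<in> carrier_vec n"
    "z \<bullet> (N *\<^sub>v z) + 2 * s * (q \<bullet> z) + \<tau> * s\<^sup>2
      = hadamard_vec (Sb *\<^sub>v z) (Sb *\<^sub>v z) \<bullet> \<phi> + s * (\<psi> \<bullet> (Sb *\<^sub>v z)) + \<tau> * s\<^sup>2
        - z \<bullet> (H *\<^sub>v z) - z \<bullet> (Pb *\<^sub>v z) - s * (bb \<bullet> z) + (\<Sum>i<k. \<gamma> $ i * (z $ i * (s - z $ i)))"
proof -
  let ?g = "\<gamma> @\<^sub>v 0\<^sub>v (n - k)"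
  have g: "?g \<in> carrier_vec n" using \<gamma> kn by (intro carrier_vecI) auto
  note dg = diag_of_vec_carrier[OF g] and d\<phi> = diag_of_vec_carrier[OF \<phi>]
  let ?T = "transpose_mat Sb * diag_of_vec \<phi> * Sb"
  have T: "?T \<in> carrier_mat n n" using Sb d\<phi> by auto
  have Sz: "Sb *\<^sub>v z \<in> carrier_vec m" using Sb z by simp
  show "N \<in> carrier_mat n n" unfolding N using dg by (intro minus_carrier_mat)
  show "q \<in> carrier_vec n"
    using \<gamma> kn unfolding q by (auto intro!: carrier_vecI)
  have "?T *\<^sub>v z = transpose_mat Sb *\<^sub>v (diag_of_vec \<phi> *\<^sub>v (Sb *\<^sub>v z))"
    using Sb d\<phi> z Sz
    by (subst assoc_mult_mat_vec[of _ n m _ n], simp_all)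
  then have Tz: "z \<bullet> (?T *\<^sub>v z) = hadamard_vec (Sb *\<^sub>v z) (Sb *\<^sub>v z) \<bullet> \<phi>"
    using scalar_prod_transpose_mult[OF Sb z mult_mat_vec_carrier[OF d\<phi> Sz]]
    by (simp add: diag_of_vec_mult[OF \<phi> Sz] scalar_prod_hadamard[OF \<phi> Sz])
  have "N *\<^sub>v z = ?T *\<^sub>v z - H *\<^sub>v z - Pb *\<^sub>v z - diag_of_vec ?g *\<^sub>v z"
    unfolding N
    by (simp only: minus_mult_distrib_mat_vec[OF minus_carrier_mat[OF Pb] dg z]
        minus_mult_distrib_mat_vec[OF minus_carrier_mat[OF H] Pb z] minus_mult_distrib_mat_vec[OF T H z])
  then have Nz: "z \<bullet> (N *\<^sub>v z) = z \<bullet> (?T *\<^sub>v z) - z \<bullet> (H *\<^sub>v z) - z \<bullet> (Pb *\<^sub>v z)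
      - z \<bullet> (diag_of_vec ?g *\<^sub>v z)"
    using T H Pb dg z by (simp add: scalar_prod_minus_distrib[of _ n])
  have "2 * (q \<bullet> z) = \<psi> \<bullet> (Sb *\<^sub>v z) - bb \<bullet> z + ?g \<bullet> z"
  proof -
    have a: "transpose_mat Sb *\<^sub>v \<psi> \<in> carrier_vec n" using Sb by (intro carrier_vecI) auto
    have c: "transpose_mat Sb *\<^sub>v \<psi> - bb \<in> carrier_vec n" using a bb by simp
    show ?thesis
      unfolding q smult_scalar_prod_distrib[OF add_carrier_vec[OF c g] z]
        add_scalar_prod_distrib[OF c g z] minus_scalar_prod_distrib[OF a bb z]
        transpose_vec_mult_scalar[OF Sb z \<psi>] by simp
  qed
  then have "2 * s * (q \<bullet> z) = s * (\<psi> \<bullet> (Sb *\<^sub>v z) - bb \<bullet> z + ?g \<bullet> z)" by simp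
  then show "z \<bullet> (N *\<^sub>v z) + 2 * s * (q \<bullet> z) + \<tau> * s\<^sup>2
      = hadamard_vec (Sb *\<^sub>v z) (Sb *\<^sub>v z) \<bullet> \<phi> + s * (\<psi> \<bullet> (Sb *\<^sub>v z)) + \<tau> * s\<^sup>2
        - z \<bullet> (H *\<^sub>v z) - z \<bullet> (Pb *\<^sub>v z) - s * (bb \<bullet> z) + (\<Sum>i<k. \<gamma> $ i * (z $ i * (s - z $ i)))"
    unfolding Nz Tz padded_diag_form[OF \<gamma> z kn] padded_scalar_prod[OF \<gamma> z kn]
    by (simp add: algebra_simps sum.distrib sum_subtractf sum_distrib_left power2_eq_square)
qed

lemma cop_weak_duality:
  assumes p: "(\<tau>, \<psi>, \<phi>, \<gamma>, H) \<in> cop_feasible M k Sb Ab bb Pb"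
    and z: "z \<in> carrier_vec n" "0\<^sub>v n \<le> z" "Sb *\<^sub>v z = tb" "\<forall>i<k. z $ i \<in> {0, 1}"
  shows "(Ab *\<^sub>v z) \<bullet> (Ab *\<^sub>v z) + z \<bullet> (Pb *\<^sub>v z) + bb \<bullet> z
    \<le> tb \<bullet> \<psi> + hadamard_vec tb tb \<bullet> \<phi> + \<tau>"
proof -
  have dims: "dim_row Sb = m" "dim_col Sb = n" using Sb by auto
  define N where "N = transpose_mat Sb * diag_of_vec \<phi> * Sb - H - Pb - diag_of_vec (\<gamma> @\<^sub>v 0\<^sub>v (n - k))"
  define q where "q = (1/2) \<cdot>\<^sub>v (transpose_mat Sb *\<^sub>v \<psi> - bb + (\<gamma> @\<^sub>v 0\<^sub>v (n - k)))"
  from p have \<psi>: "\<psi> \<in> carrier_vec m" and \<phi>: "\<phi> \<in> carrier_vec m" and \<gamma>: "\<gamma> \<in> carrier_vec k"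
    and H: "psd_mat n H"
    and blk: "psd_mat (M + n) (four_block_mat (1\<^sub>m M) Ab (transpose_mat Ab) H)"
    and cop: "copositive_mat (n + 1) (bordered_mat N q \<tau>)"
    unfolding cop_feasible_def Let_def dims N_def q_def by auto
  have Hc: "H \<in> carrier_mat n n" using H by (simp add: psd_mat_def)
  note form = cop_constraint_form[OF \<psi> \<phi> \<gamma> Hc z(1) N_def q_def]
  have Az: "Ab *\<^sub>v z \<in> carrier_vec M" using Ab z by simp
  have "0\<^sub>v (n + 1) \<le> z @\<^sub>v Matrix.vec 1 (\<lambda>_. 1)"
    using z by (auto simp: less_eq_vec_def)
  moreover have "z @\<^sub>v Matrix.vec 1 (\<lambda>_. 1) \<in> carrier_vec (n + 1)"
    using z by (intro append_carrier_vec) auto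
  ultimately have "0 \<le> z \<bullet> (N *\<^sub>v z) + 2 * 1 * (q \<bullet> z) + \<tau> * 1\<^sup>2"
    using cop unfolding copositive_mat_def bordered_mat_form[OF form(1,2) z(1), symmetric] by blast
  moreover have "(\<Sum>i<k. \<gamma> $ i * (z $ i * (1 - z $ i))) = 0"
    using z(4) by (intro sum.neutral) auto
  ultimately have "z \<bullet> (H *\<^sub>v z) + z \<bullet> (Pb *\<^sub>v z) + bb \<bullet> z \<le> hadamard_vec tb tb \<bullet> \<phi> + \<psi> \<bullet> tb + \<tau>"
    unfolding form(3) z(3) by simp
  moreover have "(Ab *\<^sub>v z) \<bullet> (Ab *\<^sub>v z) \<le> z \<bullet> (H *\<^sub>v z)"
  proof -
    \<comment> \<open>For given \<open>z\<close> this is the \<open>u\<close> that minimizes the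
      block form; what remains is \<open>z \<bullet> (H *\<^sub>v z)\<close> minus the square of
      \<open>Ab *\<^sub>v z\<close>.\<close>
    have mAz: "- (Ab *\<^sub>v z) \<in> carrier_vec M" using Az by simp
    then have "- (Ab *\<^sub>v z) @\<^sub>v z \<in> carrier_vec (M + n)" using z by auto
    then have "0 \<le> - (Ab *\<^sub>v z) \<bullet> - (Ab *\<^sub>v z) + 2 * (- (Ab *\<^sub>v z) \<bullet> (Ab *\<^sub>v z)) + z \<bullet> (H *\<^sub>v z)"
      using blk unfolding psd_mat_def schur_block_form[OF Ab Hc mAz z(1), symmetric] by blast
    then show ?thesis by simp
  qed
  moreover have "\<psi> \<bullet> tb = tb \<bullet> \<psi>" using \<psi> tb by (rule comm_scalar_prod)
  ultimately show ?thesis by simp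
qed

lemma cop_strong_duality:
  assumes sym: "transpose_mat Pb = Pb"
    and row: "\<And>i z. i < k \<Longrightarrow> z \<in> carrier_vec n \<Longrightarrow> 0\<^sub>v n \<le> z
      \<Longrightarrow> \<exists>j<m. tb $ j = 1 \<and> z $ i \<le> (Sb *\<^sub>v z) $ j"
    and lt: "\<And>z. z \<in> carrier_vec n \<Longrightarrow> 0\<^sub>v n \<le> z \<Longrightarrow> Sb *\<^sub>v z = tb \<Longrightarrow> (\<forall>i<k. z $ i \<in> {0, 1})
      \<Longrightarrow> (Ab *\<^sub>v z) \<bullet> (Ab *\<^sub>v z) + z \<bullet> (Pb *\<^sub>v z) + bb \<bullet> z < v"
    and rec: "\<And>z. z \<in> carrier_vec n \<Longrightarrow> 0\<^sub>v n \<le> z \<Longrightarrow> Sb *\<^sub>v z = 0\<^sub>v m \<Longrightarrow> (\<forall>i<k. z $ i = 0)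
      \<Longrightarrow> z \<noteq> 0\<^sub>v n \<Longrightarrow> (Ab *\<^sub>v z) \<bullet> (Ab *\<^sub>v z) + z \<bullet> (Pb *\<^sub>v z) < 0"
  obtains \<tau> \<psi> \<phi> \<gamma> H where "(\<tau>, \<psi>, \<phi>, \<gamma>, H) \<in> cop_feasible M k Sb Ab bb Pb"
    "tb \<bullet> \<psi> + hadamard_vec tb tb \<bullet> \<phi> + \<tau> = v"
proof -
  \<comment> \<open>By the Schur complement, this is the smallest \<open>H\<close> that the block
    constraint admits, hence the one that weakens the copositive form least.\<close>
  let ?H = "transpose_mat Ab * Ab"
  have H: "?H \<in> carrier_mat n n" using Ab by auto
  have Hz: "z \<bullet> (?H *\<^sub>v z) = (Ab *\<^sub>v z) \<bullet> (Ab *\<^sub>v z)" if "z \<in> carrier_vec n" for z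
    using Ab that by (simp add: assoc_mult_mat_vec[of _ n M] scalar_prod_transpose_mult[OF Ab that])
  have HPz: "z \<bullet> ((?H + Pb) *\<^sub>v z) = (Ab *\<^sub>v z) \<bullet> (Ab *\<^sub>v z) + z \<bullet> (Pb *\<^sub>v z)"
    if "z \<in> carrier_vec n" for z
    using H Pb that
    by (simp add: add_mult_distrib_mat_vec[of _ n n] scalar_prod_add_distrib[of _ n] Hz)
  obtain \<rho> where \<rho>: "\<And>z s. z \<in> carrier_vec n \<Longrightarrow> 0\<^sub>v n \<le> z \<Longrightarrow> 0 \<le> s \<Longrightarrow>
    z \<bullet> ((?H + Pb) *\<^sub>v z) + s * (bb \<bullet> z) - v * s\<^sup>2
      \<le> \<rho> ^ 3 * ((Sb *\<^sub>v z - s \<cdot>\<^sub>v tb) \<bullet> (Sb *\<^sub>v z - s \<cdot>\<^sub>v tb)) + \<rho> * (\<Sum>i<k. z $ i * (s - z $ i))"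
    by (rule homogenized_penalty[OF _ bb Sb tb kn row, of "?H + Pb" v])
      (use H Pb lt rec in \<open>auto simp: HPz\<close>)
  \<comment> \<open>The multipliers are read off from the expanded square
    \<open>\<rho> ^ 3 |Sb z - s tb|^2\<close>: the square of \<open>Sb z\<close> goes to
    \<open>\<phi>\<close>, the cross term to \<open>\<psi>\<close>, the remainder to
    \<open>\<tau>\<close>. In the objective they contribute
    \<open>\<rho> ^ 3 * (tb \<bullet> tb)\<close> times 1, -2 and 1, so the value is
    \<open>v\<close> whatever \<open>\<rho>\<close> is.\<close>
  define \<phi> where "\<phi> = Matrix.vec m (\<lambda>_. \<rho> ^ 3)"
  define \<psi> where "\<psi> = (- 2 * \<rho> ^ 3) \<cdot>\<^sub>v tb"
  define \<gamma> where "\<gamma> = Matrix.vec k (\<lambda>_. \<rho>)"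
  define \<tau> where "\<tau> = v + \<rho> ^ 3 * (tb \<bullet> tb)"
  have \<psi>: "\<psi> \<in> carrier_vec m" and \<phi>: "\<phi> \<in> carrier_vec m" and \<gamma>: "\<gamma> \<in> carrier_vec k"
    using tb by (auto simp: \<phi>_def \<psi>_def \<gamma>_def)
  have had: "hadamard_vec u u \<bullet> \<phi> = \<rho> ^ 3 * (u \<bullet> u)" if "u \<in> carrier_vec m" for u
    using that by (auto simp: scalar_prod_def hadamard_vec_def \<phi>_def sum_distrib_left intro!: sum.cong)
  define N where "N = transpose_mat Sb * diag_of_vec \<phi> * Sb - ?H - Pb - diag_of_vec (\<gamma> @\<^sub>v 0\<^sub>v (n - k))"
  define q where "q = (1/2) \<cdot>\<^sub>v (transpose_mat Sb *\<^sub>v \<psi> - bb + (\<gamma> @\<^sub>v 0\<^sub>v (n - k)))"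
  note form = cop_constraint_form[OF \<psi> \<phi> \<gamma> H _ N_def q_def]
  have Nc: "N \<in> carrier_mat n n" and qc: "q \<in> carrier_vec n"
    using form(1,2)[of "0\<^sub>v n"] by auto
  have symH: "transpose_mat ?H = ?H" using Ab by (simp add: transpose_mult[of _ n M])
  have psdH: "psd_mat n ?H"
    unfolding psd_mat_def using H symH Hz scalar_prod_self_nonneg by auto
  have blk: "psd_mat (M + n) (four_block_mat (1\<^sub>m M) Ab (transpose_mat Ab) ?H)"
    unfolding psd_mat_def
  proof (intro conjI ballI)
    show "four_block_mat (1\<^sub>m M) Ab (transpose_mat Ab) ?H \<in> carrier_mat (M + n) (M + n)"
      using H by (intro four_block_carrier_mat) auto
    show "transpose_mat (four_block_mat (1\<^sub>m M) Ab (transpose_mat Ab) ?H)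
        = four_block_mat (1\<^sub>m M) Ab (transpose_mat Ab) ?H"
      using Ab H symH by (subst transpose_four_block_mat[OF one_carrier_mat Ab _ H]) auto
    fix w :: "real Matrix.vec" assume w: "w \<in> carrier_vec (M + n)"
    define u z where "u = vec_first w M" and "z = vec_last w n"
    have uz: "w = u @\<^sub>v z" "u \<in> carrier_vec M" "z \<in> carrier_vec n"
      using w unfolding u_def z_def by auto
    have Az: "Ab *\<^sub>v z \<in> carrier_vec M" using Ab uz by simp
    have "(u + Ab *\<^sub>v z) \<bullet> (u + Ab *\<^sub>v z) = u \<bullet> u + 2 * (u \<bullet> (Ab *\<^sub>v z)) + (Ab *\<^sub>v z) \<bullet> (Ab *\<^sub>v z)"
      using uz Az
      by (simp add: scalar_prod_add_distrib[of _ M] add_scalar_prod_distrib[of _ M] comm_scalar_prod[OF Az uz(2)])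
    then show "0 \<le> w \<bullet> (four_block_mat (1\<^sub>m M) Ab (transpose_mat Ab) ?H *\<^sub>v w)"
      unfolding uz(1) schur_block_form[OF Ab H uz(2,3)] Hz[OF uz(3)]
      using scalar_prod_self_nonneg[of "u + Ab *\<^sub>v z"] by simp
  qed
  have cop: "copositive_mat (n + 1) (bordered_mat N q \<tau>)"
    unfolding copositive_mat_def
  proof (intro conjI ballI impI)
    show "bordered_mat N q \<tau> \<in> carrier_mat (n + 1) (n + 1)"
      by (rule bordered_mat_carrier[OF Nc qc])
    have g: "\<gamma> @\<^sub>v 0\<^sub>v (n - k) \<in> carrier_vec n" using \<gamma> kn by (intro carrier_vecI) auto
    have T: "transpose_mat Sb * diag_of_vec \<phi> * Sb \<in> carrier_mat n n"
      using Sb diag_of_vec_carrier[OF \<phi>] by auto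
    have "transpose_mat (transpose_mat Sb * diag_of_vec \<phi>) = diag_of_vec \<phi> * Sb"
      using Sb diag_of_vec_carrier[OF \<phi>]
      by (subst transpose_mult[of _ n m _ m]) (auto simp: diag_of_vec_transpose)
    then have "transpose_mat (transpose_mat Sb * diag_of_vec \<phi> * Sb)
        = transpose_mat Sb * (diag_of_vec \<phi> * Sb)"
      using Sb diag_of_vec_carrier[OF \<phi>] by (subst transpose_mult[of _ n m _ n]) auto
    also have "\<dots> = transpose_mat Sb * diag_of_vec \<phi> * Sb"
      using Sb diag_of_vec_carrier[OF \<phi>] by (subst assoc_mult_mat[of _ n m _ m]) auto
    finally have "transpose_mat (transpose_mat Sb * diag_of_vec \<phi> * Sb)
        = transpose_mat Sb * diag_of_vec \<phi> * Sb" .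
    then have "transpose_mat N = N"
      unfolding N_def
      by (intro transpose_minus_symmetric[of _ n] minus_carrier_mat Pb H diag_of_vec_carrier g
          diag_of_vec_transpose symH sym T)
    then show "transpose_mat (bordered_mat N q \<tau>) = bordered_mat N q \<tau>"
      by (rule bordered_mat_transpose[OF Nc qc])
    fix w :: "real Matrix.vec" assume w: "w \<in> carrier_vec (n + 1)" "0\<^sub>v (n + 1) \<le> w"
    define z s where "z = vec_first w n" and "s = w $ n"
    have ws: "w = z @\<^sub>v Matrix.vec 1 (\<lambda>_. s)"
      using w(1) unfolding z_def s_def vec_first_def by (intro eq_vecI) (auto simp: less_Suc_eq)
    have z: "z \<in> carrier_vec n" "0\<^sub>v n \<le> z" "0 \<le> s"
      using w unfolding z_def s_def vec_first_def by (auto simp: less_eq_vec_def)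
    have Sz: "Sb *\<^sub>v z \<in> carrier_vec m" using Sb z by simp
    have "(Sb *\<^sub>v z - s \<cdot>\<^sub>v tb) \<bullet> (Sb *\<^sub>v z - s \<cdot>\<^sub>v tb)
        = (Sb *\<^sub>v z) \<bullet> (Sb *\<^sub>v z) - 2 * s * (tb \<bullet> (Sb *\<^sub>v z)) + s\<^sup>2 * (tb \<bullet> tb)"
      using Sz tb
      by (simp add: scalar_prod_minus_distrib[of _ m] minus_scalar_prod_distrib[of _ m]
          comm_scalar_prod[OF Sz tb] power2_eq_square algebra_simps)
    then have sq: "\<rho> ^ 3 * ((Sb *\<^sub>v z - s \<cdot>\<^sub>v tb) \<bullet> (Sb *\<^sub>v z - s \<cdot>\<^sub>v tb))
        = \<rho> ^ 3 * ((Sb *\<^sub>v z) \<bullet> (Sb *\<^sub>v z)) - 2 * s * \<rho> ^ 3 * (tb \<bullet> (Sb *\<^sub>v z)) + \<rho> ^ 3 * s\<^sup>2 * (tb \<bullet> tb)"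
      by (simp only:) (simp add: algebra_simps)
    have "(\<Sum>i<k. \<gamma> $ i * (z $ i * (s - z $ i))) = \<rho> * (\<Sum>i<k. z $ i * (s - z $ i))"
      by (simp add: \<gamma>_def sum_distrib_left)
    then have "z \<bullet> (N *\<^sub>v z) + 2 * s * (q \<bullet> z) + \<tau> * s\<^sup>2 \<ge> 0"
      unfolding form(3)[OF z(1)] using \<rho>[OF z] Sz tb
      by (simp add: sq HPz[OF z(1)] Hz[OF z(1)] had[OF Sz] \<psi>_def \<tau>_def algebra_simps)
    then show "0 \<le> w \<bullet> (bordered_mat N q \<tau> *\<^sub>v w)"
      unfolding ws bordered_mat_form[OF Nc qc z(1)] .
  qed
  have dims: "dim_row Sb = m" "dim_col Sb = n" using Sb by auto
  show ?thesis
  proof (rule that)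
    show "(\<tau>, \<psi>, \<phi>, \<gamma>, ?H) \<in> cop_feasible M k Sb Ab bb Pb"
      unfolding cop_feasible_def Let_def dims
      using \<psi> \<phi> \<gamma> psdH blk cop unfolding N_def q_def by auto
    show "tb \<bullet> \<psi> + hadamard_vec tb tb \<bullet> \<phi> + \<tau> = v"
      using tb by (simp add: had \<psi>_def \<tau>_def)
  qed
qed

end

section \<open>Duality for the second-stage problem\<close>

lemma full_column_rank_kernel:
  fixes P :: "real Matrix.mat"
  assumes P: "P \<in> carrier_mat n d" and rank: "full_column_rank P"
    and y: "y \<in> carrier_vec d" "P *\<^sub>v y = 0\<^sub>v n"
  shows "y = 0\<^sub>v d"
proof (rule ccontr)
  assume "y \<noteq> 0\<^sub>v d"
  interpret vec_space "TYPE(real)" n .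
  have r: "rank P = d" using rank P by (simp add: full_column_rank_def)
  \<comment> \<open>Linear independence concerns the set of columns, in which a repeated column
    would go unnoticed. A repetition would make this set too small to have rank
    \<open>d\<close>.\<close>
  have "distinct (cols P)"
  proof (rule ccontr)
    assume nd: "\<not> distinct (cols P)"
    obtain S where S: "maximal S (\<lambda>T. T \<subseteq> set (cols P) \<and> lin_indpt T)"
      using maximal_exists[of "(\<lambda>T. T \<subseteq> set (cols P) \<and> lin_indpt T)" "card (set (cols P))" "{}"]
      by (meson List.finite_set card_mono empty_iff empty_subsetI finite_lin_indpt2 rev_finite_subset)
    then have "card S \<le> card (set (cols P))" by (simp add: card_mono maximal_def)
    also have "\<dots> < length (cols P)"
      using nd card_distinct card_length nat_less_le by blast
    finally show False using rank_card_indpt[OF P S] r P by simp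
  qed
  then show False
    using full_rank_lin_indpt[OF P r] lin_depI[OF P y(1) \<open>y \<noteq> 0\<^sub>v d\<close> y(2)] by blast
qed

text \<open>\<open>P\<close> and its Gram matrix have the same kernel, because
  \<open>y \<bullet> (P^T P y) = |P y|^2\<close>; so the Gram matrix \<open>B\<close> is invertible
  and \<open>gram_inv P\<close> is its genuine inverse \<open>G\<close>. Symmetry of
  \<open>G\<close> comes from bracketing \<open>G^T B G\<close> in two ways.\<close>

lemma gram_inv_props:
  fixes P :: "real Matrix.mat"
  assumes P: "P \<in> carrier_mat n d" and rank: "full_column_rank P"
  shows "gram_inv P \<in> carrier_mat d d"
    "transpose_mat P * P * gram_inv P = 1\<^sub>m d" "gram_inv P * (transpose_mat P * P) = 1\<^sub>m d"
    "transpose_mat (gram_inv P) = gram_inv P"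
proof -
  let ?B = "transpose_mat P * P"
  have B: "?B \<in> carrier_mat d d" using P by auto
  have "y = 0\<^sub>v d" if y: "y \<in> carrier_vec d" "?B *\<^sub>v y = 0\<^sub>v d" for y
  proof -
    have Py: "P *\<^sub>v y \<in> carrier_vec n" using P y by simp
    have "(P *\<^sub>v y) \<bullet> (P *\<^sub>v y) = y \<bullet> (?B *\<^sub>v y)"
      using P y Py by (simp add: scalar_prod_transpose_mult[OF P y(1) Py, symmetric] assoc_mult_mat_vec[of _ d n])
    then have "P *\<^sub>v y = 0\<^sub>v n" using y scalar_prod_self_eq_0_iff[OF Py] by simp
    then show ?thesis by (rule full_column_rank_kernel[OF P rank y(1)])
  qed
  then have "det ?B \<noteq> 0" using det_0_iff_vec_prod_zero_field[OF B] by blast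
  then have "mat_inverse ?B \<noteq> None"
    using det_non_zero_imp_unit[OF B, of "()"] mat_inverse(1)[OF B, of "()"] by blast
  then have "mat_inverse ?B = Some (gram_inv P)" unfolding gram_inv_def by auto
  from mat_inverse(2)[OF B this]
  show BG: "?B * gram_inv P = 1\<^sub>m d" and GB: "gram_inv P * ?B = 1\<^sub>m d" and G: "gram_inv P \<in> carrier_mat d d"
    by auto
  have Gt: "transpose_mat (gram_inv P) \<in> carrier_mat d d" using G by simp
  have Bt: "transpose_mat ?B = ?B" using P by (simp add: transpose_mult[of _ d n])
  have "transpose_mat (gram_inv P) * ?B = transpose_mat (?B * gram_inv P)"
    using transpose_mult[OF B G] Bt by simp
  then have GtB: "transpose_mat (gram_inv P) * ?B = 1\<^sub>m d" unfolding BG by simp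
  have "transpose_mat (gram_inv P) = transpose_mat (gram_inv P) * (?B * gram_inv P)"
    using Gt by (simp add: BG)
  also have "\<dots> = (transpose_mat (gram_inv P) * ?B) * gram_inv P"
    using assoc_mult_mat[OF Gt B G] by simp
  finally show "transpose_mat (gram_inv P) = gram_inv P" using G by (simp add: GtB)
qed

text \<open>Pairing \<open>\<theta>\<close> with the strictly positive vector
  \<open>W *\<^sub>v y\<close> of complete recourse writes 0 as a sum of the entries of
  \<open>\<theta>\<close> with positive weights. This is Gordan's alternative, and the form in which
  complete recourse is used from here on.\<close>

lemma complete_recourse_dual_trivial:
  assumes W: "W \<in> carrier_mat m d" and cr: "complete_recourse W"
    and \<theta>: "\<theta> \<in> carrier_vec m" "0\<^sub>v m \<le> \<theta>" "transpose_mat W *\<^sub>v \<theta> = 0\<^sub>v d"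
  shows "\<theta> = 0\<^sub>v m"
proof -
  obtain y where y: "y \<in> carrier_vec d" "\<forall>i<m. 0 < (W *\<^sub>v y) $ i"
    using cr W unfolding complete_recourse_def by auto
  have "0 = y \<bullet> (transpose_mat W *\<^sub>v \<theta>)" using \<theta> y by simp
  also have "\<dots> = (\<Sum>i\<in>{0..<m}. (W *\<^sub>v y) $ i * \<theta> $ i)"
    using scalar_prod_transpose_mult[OF W y(1) \<theta>(1)] \<theta>(1) by (simp add: scalar_prod_def)
  finally have "(\<Sum>i\<in>{0..<m}. (W *\<^sub>v y) $ i * \<theta> $ i) = 0" ..
  moreover have nn: "\<And>i. i \<in> {0..<m} \<Longrightarrow> 0 \<le> (W *\<^sub>v y) $ i * \<theta> $ i"
    using y(2) \<theta>(1,2) by (simp add: vec_nonneg_iff less_imp_le)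
  ultimately have "\<forall>i\<in>{0..<m}. (W *\<^sub>v y) $ i * \<theta> $ i = 0"
    using sum_nonneg_eq_0_iff[of "{0..<m}" "\<lambda>i. (W *\<^sub>v y) $ i * \<theta> $ i"] by blast
  then have "\<theta> $ i = 0" if "i < m" for i using y(2) that by force
  then show ?thesis using \<theta>(1) by (intro eq_vecI) auto
qed

section \<open>Maximizing a quadratic over the orthant\<close>

text \<open>Only strict copositivity of \<open>N\<close> is assumed. Compactness of the simplex
  makes it uniform: the form is at least \<open>\<mu>\<close> times the squared coordinate sum, with
  \<open>\<mu> > 0\<close>, and so dominates the linear part far out.\<close>

lemma concave_quadratic_attains_max_on_orthant:
  fixes N :: "real Matrix.mat"
  assumes N: "N \<in> carrier_mat n n" and q: "q \<in> carrier_vec n"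
    and pos: "\<And>z. z \<in> carrier_vec n \<Longrightarrow> 0\<^sub>v n \<le> z \<Longrightarrow> z \<noteq> 0\<^sub>v n \<Longrightarrow> 0 < z \<bullet> (N *\<^sub>v z)"
  obtains z where "z \<in> carrier_vec n" "0\<^sub>v n \<le> z"
    "\<And>w. w \<in> carrier_vec n \<Longrightarrow> 0\<^sub>v n \<le> w \<Longrightarrow> q \<bullet> w - w \<bullet> (N *\<^sub>v w) \<le> q \<bullet> z - z \<bullet> (N *\<^sub>v z)"
\<comment> \<open>In dimension 0 the simplex is empty and there is no minimum over it to start
  from.\<close>
proof (cases "n = 0")
  case True
  then have 0: "a \<bullet> b = 0" if "b \<in> carrier_vec n" for a b :: "real Matrix.vec"
    using that by (simp add: scalar_prod_def)
  show ?thesis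
    by (rule that[of "0\<^sub>v n"]) (use 0[OF mult_mat_vec_carrier[OF N]] 0 in auto)
next
  case False
  let ?C = "orthant_simplex n"
  let ?z = "\<lambda>f. Matrix.vec n f"
  have "(\<lambda>i. if i = 0 then 1 else 0) \<in> ?C"
    using False unfolding orthant_simplex_def by auto
  then have C0: "?C \<noteq> {}" by blast
  have C: "?z f \<in> carrier_vec n" "0\<^sub>v n \<le> ?z f" "?z f \<noteq> 0\<^sub>v n" if "f \<in> ?C" for f
  proof -
    show "0\<^sub>v n \<le> ?z f" using that by (auto simp: vec_nonneg_iff orthant_simplex_def)
    show "?z f \<noteq> 0\<^sub>v n"
    proof
      assume "?z f = 0\<^sub>v n"
      then have "\<forall>i<n. f i = 0" by (metis index_vec index_zero_vec(1))
      then show False using that by (auto simp: orthant_simplex_def)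
    qed
  qed simp
  obtain f0 where f0: "f0 \<in> ?C" "\<And>f. f \<in> ?C \<Longrightarrow> ?z f0 \<bullet> (N *\<^sub>v ?z f0) \<le> ?z f \<bullet> (N *\<^sub>v ?z f)"
    using continuous_attains_inf[OF compact_orthant_simplex C0 continuous_on_quadratic_form[OF N]] by blast
  obtain f1 where f1: "f1 \<in> ?C" "\<And>f. f \<in> ?C \<Longrightarrow> q \<bullet> ?z f \<le> q \<bullet> ?z f1"
    using continuous_attains_sup[OF compact_orthant_simplex C0 continuous_on_linear_form[OF q]] by blast
  define \<mu> where "\<mu> = ?z f0 \<bullet> (N *\<^sub>v ?z f0)"
  define \<nu> where "\<nu> = \<bar>q \<bullet> ?z f1\<bar>"
  \<comment> \<open>At coordinate sum \<open>\<sigma>\<close> the linear part is at most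
    \<open>\<sigma> * \<nu>\<close> and the quadratic part at least
    \<open>\<sigma>^2 * \<mu>\<close>; these bounds balance at \<open>\<sigma> = B\<close>.\<close>
  define B where "B = \<nu> / \<mu>"
  have \<mu>: "\<mu> > 0" unfolding \<mu>_def using C[OF f0(1)] pos by blast
  have B0: "B \<ge> 0" unfolding B_def \<nu>_def using \<mu> by simp
  have outside: "q \<bullet> w - w \<bullet> (N *\<^sub>v w) \<le> 0"
    if w: "w \<in> carrier_vec n" "0\<^sub>v n \<le> w" and big: "(\<Sum>i<n. w $ i) > B" for w
  proof -
    define \<sigma> where "\<sigma> = (\<Sum>i<n. w $ i)"
    have \<sigma>: "\<sigma> > 0" using big B0 unfolding \<sigma>_def by simp
    define f where "f i = (if i < n then w $ i / \<sigma> else 0)" for i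
    have "(\<Sum>i<n. f i) = 1" using \<sigma> by (simp add: f_def \<sigma>_def sum_divide_distrib[symmetric])
    then have f: "f \<in> ?C"
      using w \<sigma> by (auto simp: orthant_simplex_def f_def vec_nonneg_iff)
    have wf: "w = \<sigma> \<cdot>\<^sub>v ?z f" using w(1) \<sigma> by (intro eq_vecI) (auto simp: f_def)
    have "q \<bullet> w = \<sigma> * (q \<bullet> ?z f)" unfolding wf using q by simp
    also have "\<dots> \<le> \<sigma> * \<nu>" using f1(2)[OF f] \<sigma> unfolding \<nu>_def by (intro mult_left_mono) auto
    also have "\<nu> \<le> \<sigma> * \<mu>" using big \<mu> unfolding B_def \<sigma>_def by (simp add: field_simps)
    then have "\<sigma> * \<nu> \<le> \<sigma> * (\<sigma> * \<mu>)" using \<sigma> by (intro mult_left_mono) auto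
    also have "\<sigma> * (\<sigma> * \<mu>) \<le> \<sigma>\<^sup>2 * (?z f \<bullet> (N *\<^sub>v ?z f))"
      using f0(2)[OF f] \<sigma> unfolding \<mu>_def power2_eq_square mult.assoc by (intro mult_left_mono) auto
    also have "\<dots> = w \<bullet> (N *\<^sub>v w)"
      unfolding wf by (rule quadratic_form_smult[OF N, symmetric]) simp
    finally show ?thesis by simp
  qed
  \<comment> \<open>The box contains 0, of value 0, and every \<open>w \<ge> 0\<close> with
    coordinate sum at most \<open>B\<close>; by \<open>outside\<close>, points with a larger sum
    have value at most 0.\<close>
  let ?D = "orthant_box n B"
  have D0: "(\<lambda>_. 0) \<in> ?D" using B0 by (auto simp: orthant_box_def)
  have cont: "continuous_on ?D (\<lambda>f. q \<bullet> ?z f - ?z f \<bullet> (N *\<^sub>v ?z f))"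
    by (intro continuous_intros continuous_on_quadratic_form[OF N] continuous_on_linear_form[OF q])
  obtain g where g: "g \<in> ?D"
      "\<And>f. f \<in> ?D \<Longrightarrow> q \<bullet> ?z f - ?z f \<bullet> (N *\<^sub>v ?z f) \<le> q \<bullet> ?z g - ?z g \<bullet> (N *\<^sub>v ?z g)"
    using continuous_attains_sup[OF compact_orthant_box _ cont] D0 by blast
  show ?thesis
  proof (rule that)
    show "?z g \<in> carrier_vec n" by simp
    show "0\<^sub>v n \<le> ?z g" using g(1) by (auto simp: vec_nonneg_iff orthant_box_def)
    fix w :: "real Matrix.vec" assume w: "w \<in> carrier_vec n" "0\<^sub>v n \<le> w"
    show "q \<bullet> w - w \<bullet> (N *\<^sub>v w) \<le> q \<bullet> ?z g - ?z g \<bullet> (N *\<^sub>v ?z g)"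
    proof (cases "(\<Sum>i<n. w $ i) > B")
      case True
      have z0: "?z (\<lambda>_. 0) = 0\<^sub>v n" by auto
      have "q \<bullet> 0\<^sub>v n = 0" "0\<^sub>v n \<bullet> (N *\<^sub>v 0\<^sub>v n) = 0"
        using q scalar_prod_left_zero[OF mult_mat_vec_carrier[OF N zero_carrier_vec]] by auto
      then have "0 \<le> q \<bullet> ?z g - ?z g \<bullet> (N *\<^sub>v ?z g)"
        using g(2)[OF D0] unfolding z0 by linarith
      then show ?thesis using outside[OF w True] by simp
    next
      case False
      define f where "f i = (if i < n then w $ i else 0)" for i
      have "w $ i \<le> B" if "i < n" for i
        using member_le_sum[of i "{..<n}" "\<lambda>i. w $ i"] w that False by (auto simp: vec_nonneg_iff)
      then have "f \<in> ?D" using w by (auto simp: f_def vec_nonneg_iff orthant_box_def)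
      moreover have "w = ?z f" using w(1) by (auto simp: f_def)
      ultimately show ?thesis using g(2) by simp
    qed
  qed
qed

lemma mult_mat_zero_vec: "A \<in> carrier_mat m n \<Longrightarrow> A *\<^sub>v 0\<^sub>v n = (0\<^sub>v m :: real Matrix.vec)"
  by (intro eq_vecI) auto

lemma quadratic_form_add:
  fixes N :: "real Matrix.mat"
  assumes N: "N \<in> carrier_mat n n" "transpose_mat N = N"
    and z: "z \<in> carrier_vec n" and w: "w \<in> carrier_vec n"
  shows "(z + w) \<bullet> (N *\<^sub>v (z + w)) = z \<bullet> (N *\<^sub>v z) + 2 * (w \<bullet> (N *\<^sub>v z)) + w \<bullet> (N *\<^sub>v w)"
proof -
  have Nz: "N *\<^sub>v z \<in> carrier_vec n" and Nw: "N *\<^sub>v w \<in> carrier_vec n" using N z w by auto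
  have "z \<bullet> (N *\<^sub>v w) = w \<bullet> (N *\<^sub>v z)"
    using scalar_prod_transpose_mult[OF N(1) z w] N(2) comm_scalar_prod[OF Nz w] by simp
  then show ?thesis
    unfolding mult_add_distrib_mat_vec[OF N(1) z w] add_scalar_prod_distrib[OF z w add_carrier_vec[OF Nz Nw]]
      scalar_prod_add_distrib[OF z Nz Nw] scalar_prod_add_distrib[OF w Nz Nw] by simp
qed

text \<open>At a maximum the value cannot increase to first order along a direction that stays in
  the orthant. Unit vectors give the sign of the gradient \<open>g\<close>. Complementary slackness
  uses both \<open>z\<close> and \<open>- z\<close>; the latter is admissible because only steps of
  length at most 1 are considered.\<close>

lemma quadratic_orthant_max_kkt:
  fixes N :: "real Matrix.mat"
  assumes N: "N \<in> carrier_mat n n" "transpose_mat N = N" and q: "q \<in> carrier_vec n"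
    and z: "z \<in> carrier_vec n" "0\<^sub>v n \<le> z"
    and max: "\<And>w. w \<in> carrier_vec n \<Longrightarrow> 0\<^sub>v n \<le> w \<Longrightarrow> q \<bullet> w - w \<bullet> (N *\<^sub>v w) \<le> q \<bullet> z - z \<bullet> (N *\<^sub>v z)"
  defines "g \<equiv> q - 2 \<cdot>\<^sub>v (N *\<^sub>v z)"
  shows "i < n \<Longrightarrow> g $ i \<le> 0" and "g \<bullet> z = 0"
proof -
  have Nz: "N *\<^sub>v z \<in> carrier_vec n" using N z by simp
  have g: "g \<in> carrier_vec n" using q Nz by (simp add: g_def)
  have dir: "g \<bullet> d \<le> 0"
    if d: "d \<in> carrier_vec n" and feas: "\<And>\<epsilon>. 0 < \<epsilon> \<Longrightarrow> \<epsilon> \<le> 1 \<Longrightarrow> 0\<^sub>v n \<le> z + \<epsilon> \<cdot>\<^sub>v d" for d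
  proof -
    have gd: "g \<bullet> d = q \<bullet> d - 2 * (d \<bullet> (N *\<^sub>v z))"
      unfolding g_def using q Nz d
      by (simp add: minus_scalar_prod_distrib[of _ n] comm_scalar_prod[OF Nz d])
    have bound: "g \<bullet> d \<le> \<epsilon> * (d \<bullet> (N *\<^sub>v d))" if \<epsilon>: "0 < \<epsilon>" "\<epsilon> \<le> 1" for \<epsilon>
    proof -
      have ed: "\<epsilon> \<cdot>\<^sub>v d \<in> carrier_vec n" using d by simp
      have "q \<bullet> (z + \<epsilon> \<cdot>\<^sub>v d) = q \<bullet> z + \<epsilon> * (q \<bullet> d)"
        using q z d by (simp add: scalar_prod_add_distrib[of _ n])
      moreover have "(\<epsilon> \<cdot>\<^sub>v d) \<bullet> (N *\<^sub>v z) = \<epsilon> * (d \<bullet> (N *\<^sub>v z))" using d Nz by simp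
      ultimately have "\<epsilon> * (g \<bullet> d) \<le> \<epsilon>\<^sup>2 * (d \<bullet> (N *\<^sub>v d))"
        using max[OF add_carrier_vec[OF z(1) ed] feas[OF \<epsilon>]]
        unfolding quadratic_form_add[OF N z(1) ed] quadratic_form_smult[OF N(1) d] gd
        by (simp add: algebra_simps)
      then show ?thesis using \<epsilon> by (simp add: power2_eq_square mult.assoc)
    qed
    show ?thesis
    proof (rule LIMSEQ_le[OF tendsto_const])
      show "(\<lambda>k. inverse (real (Suc k)) * (d \<bullet> (N *\<^sub>v d))) \<longlonglongrightarrow> 0"
        using tendsto_mult[OF LIMSEQ_inverse_real_of_nat tendsto_const] by force
      show "\<exists>k. \<forall>j\<ge>k. g \<bullet> d \<le> inverse (real (Suc j)) * (d \<bullet> (N *\<^sub>v d))"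
        by (intro exI[of _ 0] allI impI bound) (auto simp: field_simps)
    qed
  qed
  show "g $ i \<le> 0" if i: "i < n"
    using dir[of "unit_vec n i"] z i g by (auto simp: vec_nonneg_iff)
  have "g \<bullet> z \<le> 0"
    using dir[OF z(1)] z by (auto simp: vec_nonneg_iff)
  moreover have "z $ i * \<epsilon> \<le> z $ i" if "i < n" "0 < \<epsilon>" "\<epsilon> \<le> 1" for i \<epsilon>
    using z that by (intro mult_right_le_one_le) (auto simp: vec_nonneg_iff)
  then have "g \<bullet> (- z) \<le> 0"
    using z by (intro dir) (auto simp: vec_nonneg_iff mult.commute)
  then have "0 \<le> g \<bullet> z" using g z by simp
  ultimately show "g \<bullet> z = 0" by simp
qed

section \<open>Completing the square with the inverse Gram matrix\<close>

context
  fixes P :: "real Matrix.mat" and N d :: nat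
  assumes P: "P \<in> carrier_mat N d" and rank: "full_column_rank P"
begin

lemma gram_inv_form:
  assumes u: "u \<in> carrier_vec d"
  shows "u \<bullet> (gram_inv P *\<^sub>v u) = (P *\<^sub>v (gram_inv P *\<^sub>v u)) \<bullet> (P *\<^sub>v (gram_inv P *\<^sub>v u))"
proof -
  note G = gram_inv_props[OF P rank]
  have Gu: "gram_inv P *\<^sub>v u \<in> carrier_vec d" using G u by simp
  have PGu: "P *\<^sub>v (gram_inv P *\<^sub>v u) \<in> carrier_vec N" using P Gu by simp
  have B: "transpose_mat P * P \<in> carrier_mat d d" using P by auto
  have "transpose_mat P *\<^sub>v (P *\<^sub>v (gram_inv P *\<^sub>v u)) = (transpose_mat P * P) *\<^sub>v (gram_inv P *\<^sub>v u)"
    using P Gu by (simp add: assoc_mult_mat_vec[of _ d N])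
  also have "\<dots> = (transpose_mat P * P * gram_inv P) *\<^sub>v u"
    using assoc_mult_mat_vec[OF B G(1) u] by simp
  also have "\<dots> = u" using u by (simp add: G(2))
  finally have "(P *\<^sub>v (gram_inv P *\<^sub>v u)) \<bullet> (P *\<^sub>v (gram_inv P *\<^sub>v u)) = (gram_inv P *\<^sub>v u) \<bullet> u"
    using scalar_prod_transpose_mult[OF P Gu PGu] by simp
  then show ?thesis using comm_scalar_prod[OF u Gu] by simp
qed

lemma gram_inv_form_pos:
  assumes u: "u \<in> carrier_vec d" "u \<noteq> 0\<^sub>v d"
  shows "0 < u \<bullet> (gram_inv P *\<^sub>v u)"
proof -
  note G = gram_inv_props[OF P rank]
  let ?v = "gram_inv P *\<^sub>v u"
  have v: "?v \<in> carrier_vec d" and Pv: "P *\<^sub>v ?v \<in> carrier_vec N" using G(1) P u by auto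
  have B: "transpose_mat P * P \<in> carrier_mat d d" using P by auto
  have "(P *\<^sub>v ?v) \<bullet> (P *\<^sub>v ?v) \<noteq> 0"
  proof
    assume "(P *\<^sub>v ?v) \<bullet> (P *\<^sub>v ?v) = 0"
    then have "P *\<^sub>v ?v = 0\<^sub>v N" using scalar_prod_self_eq_0_iff[OF Pv] by simp
    then have "?v = 0\<^sub>v d" by (rule full_column_rank_kernel[OF P rank v])
    moreover have "u = (transpose_mat P * P) *\<^sub>v ?v"
      using assoc_mult_mat_vec[OF B G(1) u(1)] u(1) by (simp add: G(2))
    moreover have "(transpose_mat P * P) *\<^sub>v 0\<^sub>v d = 0\<^sub>v d"
      by (rule mult_mat_zero_vec[OF B])
    ultimately show False using u(2) by simp
  qed
  then show ?thesis
    unfolding gram_inv_form[OF u(1)] using scalar_prod_self_nonneg[of "P *\<^sub>v ?v"] by linarith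
qed

text \<open>The Gram matrix sends \<open>gram_inv P *\<^sub>v w\<close> back to \<open>w\<close>, so
  the cross term of the square is \<open>w \<bullet> y\<close>. The unconstrained minimizer is thus
  minus half of \<open>gram_inv P *\<^sub>v w\<close>; the factors \<open>-1/4\<close> in the lifted
  data originate here.\<close>

lemma complete_square:
  assumes y: "y \<in> carrier_vec d" and w: "w \<in> carrier_vec d"
  shows "(P *\<^sub>v y) \<bullet> (P *\<^sub>v y) + w \<bullet> y
    = (P *\<^sub>v (y + (1/2) \<cdot>\<^sub>v (gram_inv P *\<^sub>v w))) \<bullet> (P *\<^sub>v (y + (1/2) \<cdot>\<^sub>v (gram_inv P *\<^sub>v w)))
      - 1/4 * (w \<bullet> (gram_inv P *\<^sub>v w))"
proof -
  note G = gram_inv_props[OF P rank]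
  let ?v = "gram_inv P *\<^sub>v w"
  have v: "?v \<in> carrier_vec d" using G w by simp
  have Py: "P *\<^sub>v y \<in> carrier_vec N" and Pv: "P *\<^sub>v ?v \<in> carrier_vec N" using P y v by auto
  have B: "transpose_mat P * P \<in> carrier_mat d d" using P by auto
  have "transpose_mat P *\<^sub>v (P *\<^sub>v ?v) = (transpose_mat P * P) *\<^sub>v ?v"
    using P v by (simp add: assoc_mult_mat_vec[of _ d N])
  also have "\<dots> = w" using assoc_mult_mat_vec[OF B G(1) w] w by (simp add: G(2))
  finally have "(P *\<^sub>v y) \<bullet> (P *\<^sub>v ?v) = w \<bullet> y"
    using scalar_prod_transpose_mult[OF P y Pv] comm_scalar_prod[OF w y] by simp
  moreover have "(P *\<^sub>v (y + (1/2) \<cdot>\<^sub>v ?v)) = P *\<^sub>v y + (1/2) \<cdot>\<^sub>v (P *\<^sub>v ?v)"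
    using P y v by (simp add: mult_add_distrib_mat_vec[of _ N d] mult_mat_vec[of _ N d])
  ultimately show ?thesis
    using Py Pv unfolding gram_inv_form[OF w]
    by (simp add: scalar_prod_add_distrib[of _ N] add_scalar_prod_distrib[of _ N] comm_scalar_prod[OF Pv Py]
        field_simps)
qed

end

section \<open>Lagrangian duality for the recourse problem\<close>

context
  fixes P W :: "real Matrix.mat" and N d m :: nat
  assumes P: "P \<in> carrier_mat N d" and rank: "full_column_rank P" and W: "W \<in> carrier_mat m d"
begin

text \<open>The Lagrangian dual function of minimizing \<open>|P y|^2 + q \<bullet> y\<close>
  subject to \<open>a \<le> W *\<^sub>v y\<close>: the minimum over \<open>y\<close> of the
  Lagrangian with multiplier \<open>\<theta>\<close>, in closed form.\<close>

definition dual_value :: "real Matrix.vec \<Rightarrow> real Matrix.vec \<Rightarrow> real Matrix.vec \<Rightarrow> real" where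
  "dual_value q a \<theta> = a \<bullet> \<theta>
     - 1/4 * ((q - transpose_mat W *\<^sub>v \<theta>) \<bullet> (gram_inv P *\<^sub>v (q - transpose_mat W *\<^sub>v \<theta>)))"

lemma lagrangian_complete_square:
  assumes q: "q \<in> carrier_vec d" and a: "a \<in> carrier_vec m"
    and \<theta>: "\<theta> \<in> carrier_vec m" and y: "y \<in> carrier_vec d"
  defines "x \<equiv> y + (1/2) \<cdot>\<^sub>v (gram_inv P *\<^sub>v (q - transpose_mat W *\<^sub>v \<theta>))"
  shows "(P *\<^sub>v y) \<bullet> (P *\<^sub>v y) + q \<bullet> y + (a - W *\<^sub>v y) \<bullet> \<theta>
    = (P *\<^sub>v x) \<bullet> (P *\<^sub>v x) + dual_value q a \<theta>"
proof -
  have Wt: "transpose_mat W *\<^sub>v \<theta> \<in> carrier_vec d" and Wy: "W *\<^sub>v y \<in> carrier_vec m"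
    using W \<theta> y by (auto intro!: carrier_vecI)
  have "(q - transpose_mat W *\<^sub>v \<theta>) \<bullet> y = q \<bullet> y - (W *\<^sub>v y) \<bullet> \<theta>"
    unfolding minus_scalar_prod_distrib[OF q Wt y] transpose_vec_mult_scalar[OF W y \<theta>]
    using comm_scalar_prod[OF \<theta> Wy] by simp
  moreover have "(a - W *\<^sub>v y) \<bullet> \<theta> = a \<bullet> \<theta> - (W *\<^sub>v y) \<bullet> \<theta>"
    by (rule minus_scalar_prod_distrib[OF a Wy \<theta>])
  ultimately show ?thesis
    using complete_square[OF P rank y minus_carrier_vec[OF q Wt]]
    unfolding x_def dual_value_def by simp
qed

lemma dual_value_le:
  assumes q: "q \<in> carrier_vec d" and a: "a \<in> carrier_vec m"
    and \<theta>: "\<theta> \<in> carrier_vec m" "0\<^sub>v m \<le> \<theta>" and y: "y \<in> carrier_vec d" "a \<le> W *\<^sub>v y"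
  shows "dual_value q a \<theta> \<le> (P *\<^sub>v y) \<bullet> (P *\<^sub>v y) + q \<bullet> y"
proof -
  have "(a - W *\<^sub>v y) \<bullet> \<theta> \<le> 0"
    unfolding scalar_prod_def
    using a \<theta> y W by (intro sum_nonpos mult_nonpos_nonneg) (auto simp: less_eq_vec_def)
  then show ?thesis
    using lagrangian_complete_square[OF q a \<theta>(1) y(1)]
      scalar_prod_self_nonneg[of "P *\<^sub>v (y + (1/2) \<cdot>\<^sub>v (gram_inv P *\<^sub>v (q - transpose_mat W *\<^sub>v \<theta>)))"]
    by linarith
qed

lemma dual_form_mult:
  assumes "\<theta> \<in> carrier_vec m"
  shows "(W * gram_inv P * transpose_mat W) *\<^sub>v \<theta> = W *\<^sub>v (gram_inv P *\<^sub>v (transpose_mat W *\<^sub>v \<theta>))"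
proof -
  note G = gram_inv_props(1)[OF P rank]
  have "transpose_mat W *\<^sub>v \<theta> \<in> carrier_vec d" using W by (auto intro!: carrier_vecI)
  then show ?thesis
    using assoc_mult_mat_vec[OF mult_carrier_mat[OF W G] transpose_carrier_mat[THEN iffD2, OF W] assms]
      assoc_mult_mat_vec[OF W G] by simp
qed

lemma dual_form:
  assumes "\<theta> \<in> carrier_vec m"
  shows "\<theta> \<bullet> ((W * gram_inv P * transpose_mat W) *\<^sub>v \<theta>)
    = (transpose_mat W *\<^sub>v \<theta>) \<bullet> (gram_inv P *\<^sub>v (transpose_mat W *\<^sub>v \<theta>))"
proof -
  note G = gram_inv_props(1)[OF P rank]
  have Wt: "transpose_mat W *\<^sub>v \<theta> \<in> carrier_vec d" using W by (auto intro!: carrier_vecI)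
  then have "gram_inv P *\<^sub>v (transpose_mat W *\<^sub>v \<theta>) \<in> carrier_vec d" using G by simp
  from transpose_vec_mult_scalar[OF W this assms] show ?thesis
    unfolding dual_form_mult[OF assms] by simp
qed

text \<open>This matrix is singular whenever the transpose of \<open>W\<close> has a nontrivial
  kernel, so it need not be positive definite; complete recourse excludes precisely the kernel
  vectors in the orthant.\<close>

lemma dual_form_pos:
  assumes cr: "complete_recourse W"
    and \<theta>: "\<theta> \<in> carrier_vec m" "0\<^sub>v m \<le> \<theta>" "\<theta> \<noteq> 0\<^sub>v m"
  shows "0 < \<theta> \<bullet> ((W * gram_inv P * transpose_mat W) *\<^sub>v \<theta>)"
proof -
  have "transpose_mat W *\<^sub>v \<theta> \<in> carrier_vec d" using W by (auto intro!: carrier_vecI)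
  moreover have "transpose_mat W *\<^sub>v \<theta> \<noteq> 0\<^sub>v d"
    using complete_recourse_dual_trivial[OF W cr \<theta>(1,2)] \<theta>(3) by blast
  ultimately show ?thesis
    unfolding dual_form[OF \<theta>(1)] by (rule gram_inv_form_pos[OF P rank])
qed

text \<open>Separating the powers of \<open>\<theta>\<close> exhibits a quadratic program over the
  orthant, with coefficients that can be matched to the blocks of \<open>lifted_P\<close> and
  \<open>lifted_b\<close>.\<close>

lemma dual_value_expand:
  assumes q: "q \<in> carrier_vec d" and a: "a \<in> carrier_vec m" and \<theta>: "\<theta> \<in> carrier_vec m"
  shows "dual_value q a \<theta> = a \<bullet> \<theta> + 1/2 * ((W *\<^sub>v (gram_inv P *\<^sub>v q)) \<bullet> \<theta>)
    - 1/4 * (\<theta> \<bullet> ((W * gram_inv P * transpose_mat W) *\<^sub>v \<theta>)) - 1/4 * (q \<bullet> (gram_inv P *\<^sub>v q))"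
proof -
  note G = gram_inv_props[OF P rank]
  let ?u = "transpose_mat W *\<^sub>v \<theta>"
  have u: "?u \<in> carrier_vec d" using W by (auto intro!: carrier_vecI)
  then have mu: "- ?u \<in> carrier_vec d" by simp
  have Gq: "gram_inv P *\<^sub>v q \<in> carrier_vec d" using G q by simp
  have "q - ?u = q + - ?u" using q u by auto
  moreover have "- ?u = (-1) \<cdot>\<^sub>v ?u" by auto
  moreover have "?u \<bullet> (gram_inv P *\<^sub>v q) = (W *\<^sub>v (gram_inv P *\<^sub>v q)) \<bullet> \<theta>"
    using transpose_vec_mult_scalar[OF W Gq \<theta>] comm_scalar_prod[OF \<theta> mult_mat_vec_carrier[OF W Gq]] by simp
  ultimately show ?thesis
    unfolding dual_value_def dual_form[OF \<theta>]
    using quadratic_form_add[OF G(1,4) q mu] quadratic_form_smult[OF G(1) u, of "-1"] u Gq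
    by (simp add: algebra_simps)
qed

text \<open>The gradient of the dual function at \<open>\<theta>\<close> is
  \<open>a - W *\<^sub>v y\<close>, where \<open>y\<close> minimizes the Lagrangian for
  \<open>\<theta>\<close>. The optimality conditions of the dual maximizer are therefore primal
  feasibility of \<open>y\<close> and complementary slackness, which close the duality gap.\<close>

lemma dual_attained:
  assumes cr: "complete_recourse W" and q: "q \<in> carrier_vec d" and a: "a \<in> carrier_vec m"
  obtains \<theta> y where "\<theta> \<in> carrier_vec m" "0\<^sub>v m \<le> \<theta>" "y \<in> carrier_vec d" "a \<le> W *\<^sub>v y"
    "(P *\<^sub>v y) \<bullet> (P *\<^sub>v y) + q \<bullet> y = dual_value q a \<theta>"
proof -
  note G = gram_inv_props[OF P rank]
  let ?M = "W * gram_inv P * transpose_mat W"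
  let ?N = "(1/4) \<cdot>\<^sub>m ?M"
  let ?p = "a + (1/2) \<cdot>\<^sub>v (W *\<^sub>v (gram_inv P *\<^sub>v q))"
  have M: "?M \<in> carrier_mat m m" using W G by auto
  then have N: "?N \<in> carrier_mat m m" by simp
  have WG: "W * gram_inv P \<in> carrier_mat m d" using W G by auto
  have "transpose_mat ?M = W * (gram_inv P * transpose_mat W)"
    using transpose_mult[OF WG, of "transpose_mat W" m] transpose_mult[OF W G(1)] W G(4) by simp
  also have "\<dots> = ?M" using assoc_mult_mat[OF W G(1), of "transpose_mat W" m] W by simp
  finally have "transpose_mat ?M = ?M" .
  moreover have "transpose_mat ?N = (1/4) \<cdot>\<^sub>m transpose_mat ?M"
    by (intro eq_matI) auto
  ultimately have sym: "transpose_mat ?N = ?N" by simp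
  have Wq: "W *\<^sub>v (gram_inv P *\<^sub>v q) \<in> carrier_vec m" using W G q by auto
  have p: "?p \<in> carrier_vec m" using a Wq by simp
  have Nv: "?N *\<^sub>v z = (1/4) \<cdot>\<^sub>v (?M *\<^sub>v z)" if "z \<in> carrier_vec m" for z
    using M that by (intro eq_vecI) auto
  have form: "z \<bullet> (?N *\<^sub>v z) = 1/4 * (z \<bullet> (?M *\<^sub>v z))" if "z \<in> carrier_vec m" for z
    unfolding Nv[OF that] using M that by simp
  have pz: "?p \<bullet> z = a \<bullet> z + 1/2 * ((W *\<^sub>v (gram_inv P *\<^sub>v q)) \<bullet> z)" if "z \<in> carrier_vec m" for z
    using a Wq that by (simp add: add_scalar_prod_distrib[of _ m])
  have pos: "0 < z \<bullet> (?N *\<^sub>v z)" if "z \<in> carrier_vec m" "0\<^sub>v m \<le> z" "z \<noteq> 0\<^sub>v m" for z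
    using dual_form_pos[OF cr that] form[OF that(1)] by simp
  obtain \<theta> where \<theta>: "\<theta> \<in> carrier_vec m" "0\<^sub>v m \<le> \<theta>"
    and max: "\<And>w. w \<in> carrier_vec m \<Longrightarrow> 0\<^sub>v m \<le> w \<Longrightarrow>
      ?p \<bullet> w - w \<bullet> (?N *\<^sub>v w) \<le> ?p \<bullet> \<theta> - \<theta> \<bullet> (?N *\<^sub>v \<theta>)"
    using concave_quadratic_attains_max_on_orthant[OF N p pos] by blast
  note kkt = quadratic_orthant_max_kkt[OF N sym p \<theta> max]
  let ?u = "transpose_mat W *\<^sub>v \<theta>"
  have u: "?u \<in> carrier_vec d" using W by (auto intro!: carrier_vecI)
  have Gq: "gram_inv P *\<^sub>v q \<in> carrier_vec d" and Gu: "gram_inv P *\<^sub>v ?u \<in> carrier_vec d"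
    using G u q by auto
  \<comment> \<open>The choice that makes the square in \<open>lagrangian_complete_square\<close>
    zero.\<close>
  define y where "y = (-1/2) \<cdot>\<^sub>v (gram_inv P *\<^sub>v (q - ?u))"
  have y: "y \<in> carrier_vec d" unfolding y_def using G u q by simp
  have Wy: "W *\<^sub>v y \<in> carrier_vec m" using W y by simp
  have Wu: "W *\<^sub>v (gram_inv P *\<^sub>v ?u) \<in> carrier_vec m" using W Gu by simp
  have "W *\<^sub>v y = (-1/2) \<cdot>\<^sub>v (W *\<^sub>v (gram_inv P *\<^sub>v q) - W *\<^sub>v (gram_inv P *\<^sub>v ?u))"
    unfolding y_def mult_minus_distrib_mat_vec[OF G(1) q u]
      mult_mat_vec[OF W minus_carrier_vec[OF Gq Gu]] mult_minus_distrib_mat_vec[OF W Gq Gu] ..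
  then have grad: "?p - 2 \<cdot>\<^sub>v (?N *\<^sub>v \<theta>) = a - W *\<^sub>v y"
    unfolding Nv[OF \<theta>(1)] dual_form_mult[OF \<theta>(1)]
    using a Wq Wu by (intro eq_vecI) (auto simp: algebra_simps)
  have "a \<le> W *\<^sub>v y"
    using kkt(1) a Wy W unfolding grad by (auto simp: less_eq_vec_def)
  moreover have "y + (1/2) \<cdot>\<^sub>v (gram_inv P *\<^sub>v (q - ?u)) = 0\<^sub>v d"
    unfolding y_def using G(1) by (intro eq_vecI) auto
  moreover have "P *\<^sub>v 0\<^sub>v d = 0\<^sub>v N" by (rule mult_mat_zero_vec[OF P])
  ultimately have "(P *\<^sub>v y) \<bullet> (P *\<^sub>v y) + q \<bullet> y = dual_value q a \<theta>"
    using lagrangian_complete_square[OF q a \<theta>(1) y] kkt(2) unfolding grad by simp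
  then show ?thesis using that \<theta> y \<open>a \<le> W *\<^sub>v y\<close> by blast
qed

text \<open>The two halves serve opposite inequalities: the first bounds the value of every lifted
  point by the worst case, the second supplies for each scenario a lifted point that reaches its
  recourse value.\<close>

lemma recourse_dual:
  assumes cr: "complete_recourse W" and R: "R \<in> carrier_mat d K" and r: "r \<in> carrier_vec d"
    and Tx: "Tx \<in> carrier_mat m K" and hx: "hx \<in> carrier_vec m" and \<xi>: "\<xi> \<in> carrier_vec K"
  shows "\<theta> \<in> carrier_vec m \<Longrightarrow> 0\<^sub>v m \<le> \<theta> \<Longrightarrow>
      ereal (dual_value (R *\<^sub>v \<xi> + r) (Tx *\<^sub>v \<xi> + hx) \<theta>) \<le> recourse P R r W Tx hx \<xi>"
    and "\<exists>\<theta>\<in>carrier_vec m. 0\<^sub>v m \<le> \<theta> \<and>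
      recourse P R r W Tx hx \<xi> \<le> ereal (dual_value (R *\<^sub>v \<xi> + r) (Tx *\<^sub>v \<xi> + hx) \<theta>)"
proof -
  have q: "R *\<^sub>v \<xi> + r \<in> carrier_vec d" and a: "Tx *\<^sub>v \<xi> + hx \<in> carrier_vec m"
    using R r Tx hx \<xi> by auto
  have norm: "(eucl_norm v)\<^sup>2 = v \<bullet> v" for v
    unfolding eucl_norm_def using scalar_prod_self_nonneg by simp
  show "ereal (dual_value (R *\<^sub>v \<xi> + r) (Tx *\<^sub>v \<xi> + hx) \<theta>) \<le> recourse P R r W Tx hx \<xi>"
    if "\<theta> \<in> carrier_vec m" "0\<^sub>v m \<le> \<theta>"
    unfolding recourse_def norm using dual_value_le[OF q a that] P by (intro INF_greatest) auto
  obtain \<theta> y where "\<theta> \<in> carrier_vec m" "0\<^sub>v m \<le> \<theta>" and y: "y \<in> carrier_vec d" "Tx *\<^sub>v \<xi> + hx \<le> W *\<^sub>v y"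
    and eq: "(P *\<^sub>v y) \<bullet> (P *\<^sub>v y) + (R *\<^sub>v \<xi> + r) \<bullet> y = dual_value (R *\<^sub>v \<xi> + r) (Tx *\<^sub>v \<xi> + hx) \<theta>"
    using dual_attained[OF cr q a] by blast
  moreover have "recourse P R r W Tx hx \<xi> \<le> ereal (dual_value (R *\<^sub>v \<xi> + r) (Tx *\<^sub>v \<xi> + hx) \<theta>)"
    unfolding recourse_def norm eq[symmetric] using y P by (intro INF_lower) auto
  ultimately show "\<exists>\<theta>\<in>carrier_vec m. 0\<^sub>v m \<le> \<theta> \<and>
      recourse P R r W Tx hx \<xi> \<le> ereal (dual_value (R *\<^sub>v \<xi> + r) (Tx *\<^sub>v \<xi> + hx) \<theta>)"
    by blast
qed

end

section \<open>The lifted data\<close>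

lemma append_cols_carrier:
  "A \<in> carrier_mat m a \<Longrightarrow> B \<in> carrier_mat m b \<Longrightarrow> A @\<^sub>c B \<in> carrier_mat m (a + b)"
  unfolding append_cols_def by (auto intro!: carrier_matI)

lemma append_cols_mult:
  assumes A: "A \<in> carrier_mat m a" and B: "B \<in> carrier_mat m b"
    and u: "u \<in> carrier_vec a" and w: "w \<in> carrier_vec b"
  shows "(A @\<^sub>c B) *\<^sub>v (u @\<^sub>v w) = A *\<^sub>v u + B *\<^sub>v w"
proof -
  have "(A @\<^sub>c B) *\<^sub>v (u @\<^sub>v w)
      = (A *\<^sub>v u + B *\<^sub>v w) @\<^sub>v (0\<^sub>m 0 (dim_col A) *\<^sub>v u + 0\<^sub>m 0 (dim_col B) *\<^sub>v w)"
    unfolding append_cols_def using A B u w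
    by (intro four_block_mat_mult_vec[of _ m a _ b _ 0]) auto
  also have "\<dots> = A *\<^sub>v u + B *\<^sub>v w" by (intro eq_vecI) auto
  finally show ?thesis .
qed

lemma append_vec_assoc': "(u @\<^sub>v v) @\<^sub>v w = u @\<^sub>v (v @\<^sub>v (w :: real Matrix.vec))"
  by (intro eq_vecI) (auto simp: less_diff_conv2)

lemma zero_mat_mult_vec: "u \<in> carrier_vec n \<Longrightarrow> 0\<^sub>m m n *\<^sub>v u = (0\<^sub>v m :: real Matrix.vec)"
  by (intro eq_vecI) auto

lemma kronecker_one_pow2_carrier:
  "kronecker (1\<^sub>m L) (mat_of_rows Q [pow2_vec Q]) \<in> carrier_mat L (L * Q)"
  unfolding kronecker_def by simp

lemma kronecker_one_pow2_mult:
  assumes \<beta>: "\<beta> \<in> carrier_vec (L * Q)" and l: "l < L"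
  shows "(kronecker (1\<^sub>m L) (mat_of_rows Q [pow2_vec Q]) *\<^sub>v \<beta>) $ l = (\<Sum>q<Q. 2 ^ q * \<beta> $ (l * Q + q))"
proof -
  let ?f = "\<lambda>j. (if l = j div Q then 2 ^ (j mod Q) else 0) * \<beta> $ j"
  have "j mod Q < Q" if "j < L * Q" for j using that by (cases "Q = 0") auto
  then have "(kronecker (1\<^sub>m L) (mat_of_rows Q [pow2_vec Q]) *\<^sub>v \<beta>) $ l = (\<Sum>j<L * Q. ?f j)"
    using \<beta> l
    by (auto simp: kronecker_def scalar_prod_def pow2_vec_def mat_of_rows_def lessThan_atLeast0
        less_mult_imp_div_less intro!: sum.cong)
  \<comment> \<open>Column \<open>j\<close> carries bit \<open>j mod Q\<close> of integer coordinate
    \<open>j div Q\<close>; after grouping by \<open>j div Q\<close>, only the group of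
    \<open>l\<close> meets row \<open>l\<close>.\<close>
  also have "\<dots> = (\<Sum>k<L. sum ?f {k * Q..<k * Q + Q})" by (rule sum.nat_group[symmetric])
  also have "\<dots> = (\<Sum>k<L. if k = l then (\<Sum>q<Q. 2 ^ q * \<beta> $ (l * Q + q)) else 0)"
  proof (rule sum.cong)
    fix k
    have "sum g {k * Q..<k * Q + Q} = (\<Sum>q<Q. g (k * Q + q))" for g :: "nat \<Rightarrow> real"
      using sum.shift_bounds_nat_ivl[of g 0 "k * Q" Q] by (simp add: add.commute lessThan_atLeast0)
    then have "sum ?f {k * Q..<k * Q + Q} = (\<Sum>q<Q. ?f (k * Q + q))" .
    also have "\<dots> = (if k = l then (\<Sum>q<Q. 2 ^ q * \<beta> $ (l * Q + q)) else 0)"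
      by (auto intro!: sum.cong sum.neutral)
    finally show "sum ?f {k * Q..<k * Q + Q} = (if k = l then (\<Sum>q<Q. 2 ^ q * \<beta> $ (l * Q + q)) else 0)" .
  qed simp
  also have "\<dots> = (\<Sum>q<Q. 2 ^ q * \<beta> $ (l * Q + q))" using l by simp
  finally show ?thesis .
qed

lemma binary_expansion: "n < 2 ^ Q \<Longrightarrow> (\<Sum>q<Q. 2 ^ q * of_bool (bit n q)) = (n :: nat)"
  using take_bit_sum[of Q n] take_bit_nat_eq_self[of n Q]
  by (simp add: push_bit_eq_mult mult.commute lessThan_atLeast0)

text \<open>Since \<open>d\<close> vanishes on the integer coordinates, moving along it from a
  scenario keeps integrality as well as the linear constraints; a nonzero \<open>d\<close> would
  make the set unbounded. Nonemptiness provides the starting scenario.\<close>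

lemma uncertainty_set_recession:
  assumes S: "S \<in> carrier_mat J K" and LK: "L \<le> K" and ne: "uncertainty_set K L S t \<noteq> {}"
    and bdd: "bounded_vecs (uncertainty_set K L S t)"
    and d: "d \<in> carrier_vec K" "0\<^sub>v K \<le> d" "S *\<^sub>v d = 0\<^sub>v J" "\<forall>l<L. d $ l = 0"
  shows "d = 0\<^sub>v K"
proof -
  obtain \<xi> where \<xi>: "\<xi> \<in> uncertainty_set K L S t" using ne by blast
  obtain B where B: "\<And>u. u \<in> uncertainty_set K L S t \<Longrightarrow> eucl_norm u \<le> B"
    using bdd unfolding bounded_vecs_def by blast
  have \<xi>K: "\<xi> \<in> carrier_vec K" "0\<^sub>v K \<le> \<xi>" "S *\<^sub>v \<xi> = t" "\<forall>l<L. \<xi> $ l \<in> \<int>"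
    using \<xi> unfolding uncertainty_set_def by auto
  have mem: "\<xi> + real k \<cdot>\<^sub>v d \<in> uncertainty_set K L S t" for k
  proof -
    have kd: "real k \<cdot>\<^sub>v d \<in> carrier_vec K" using d by simp
    have "t \<in> carrier_vec J" using \<xi>K S by auto
    then have "S *\<^sub>v (\<xi> + real k \<cdot>\<^sub>v d) = t"
      unfolding mult_add_distrib_mat_vec[OF S \<xi>K(1) kd] mult_mat_vec[OF S d(1)] \<xi>K(3) d(3)
      by (intro eq_vecI) auto
    then show ?thesis
      using \<xi>K d LK unfolding uncertainty_set_def by (auto simp: vec_nonneg_iff)
  qed
  have "d $ i = 0" if i: "i < K" for i
  proof (rule ccontr)
    assume "d $ i \<noteq> 0"
    then have di: "d $ i > 0" using d i by (auto simp: vec_nonneg_iff order.strict_iff_order)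
    obtain k where k: "real k * d $ i > B" using reals_Archimedean3[OF di] by blast
    have "real k * d $ i \<le> (\<xi> + real k \<cdot>\<^sub>v d) $ i"
      using \<xi>K d i by (auto simp: vec_nonneg_iff)
    also have "\<dots> \<le> eucl_norm (\<xi> + real k \<cdot>\<^sub>v d)"
      unfolding eucl_norm_def using d i by (intro index_le_sqrt_scalar_prod_self) simp
    also have "\<dots> \<le> B" by (rule B[OF mem])
    finally show False using k by simp
  qed
  then show ?thesis using d by (intro eq_vecI) auto
qed

section \<open>The lifted constraint matrix\<close>

context
  fixes J K nT L Q :: nat and S :: "real Matrix.mat"
  assumes S: "S \<in> carrier_mat J K" and LK: "L \<le> K"
begin

lemma lifted_S_carrier:
  "lifted_S J K nT L Q S \<in> carrier_mat (J + (L + L * Q)) (L * Q + (L * Q + (K + nT)))"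
proof -
  have 1: "1\<^sub>m L @\<^sub>c 0\<^sub>m L (K - L) \<in> carrier_mat L K"
    using append_cols_carrier[OF one_carrier_mat[of L] zero_carrier_mat[of L "K - L"]] LK by simp
  show ?thesis
    unfolding lifted_S_def
    by (intro carrier_append_rows append_cols_carrier S 1 zero_carrier_mat one_carrier_mat
        uminus_carrier_mat kronecker_one_pow2_carrier)
qed

lemma lifted_S_mult:
  assumes \<beta>: "\<beta> \<in> carrier_vec (L * Q)" and \<beta>': "\<beta>' \<in> carrier_vec (L * Q)"
    and \<xi>: "\<xi> \<in> carrier_vec K" and \<theta>: "\<theta> \<in> carrier_vec nT"
  shows "lifted_S J K nT L Q S *\<^sub>v (\<beta> @\<^sub>v \<beta>' @\<^sub>v \<xi> @\<^sub>v \<theta>)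
    = (S *\<^sub>v \<xi>) @\<^sub>v Matrix.vec L (\<lambda>l. \<xi> $ l - (\<Sum>q<Q. 2 ^ q * \<beta> $ (l * Q + q))) @\<^sub>v (\<beta> + \<beta>')"
proof -
  let ?Kr = "kronecker (1\<^sub>m L) (mat_of_rows Q [pow2_vec Q])"
  let ?E = "1\<^sub>m L @\<^sub>c 0\<^sub>m L (K - L)"
  note Kr = kronecker_one_pow2_carrier[of L Q]
  have E: "?E \<in> carrier_mat L K"
    using append_cols_carrier[OF one_carrier_mat[of L] zero_carrier_mat[of L "K - L"]] LK by simp
  have mult: "(A1 @\<^sub>c A2 @\<^sub>c A3 @\<^sub>c A4) *\<^sub>v (\<beta> @\<^sub>v \<beta>' @\<^sub>v \<xi> @\<^sub>v \<theta>)
      = A1 *\<^sub>v \<beta> + (A2 *\<^sub>v \<beta>' + (A3 *\<^sub>v \<xi> + A4 *\<^sub>v \<theta>))"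
    and carr: "A1 @\<^sub>c A2 @\<^sub>c A3 @\<^sub>c A4 \<in> carrier_mat m (L * Q + (L * Q + (K + nT)))"
    if "A1 \<in> carrier_mat m (L * Q)" "A2 \<in> carrier_mat m (L * Q)" "A3 \<in> carrier_mat m K"
      "A4 \<in> carrier_mat m nT" for A1 A2 A3 A4 m
  proof -
    note c3 = append_cols_carrier[OF that(3,4)]
    note c2 = append_cols_carrier[OF that(2) c3]
    show "A1 @\<^sub>c A2 @\<^sub>c A3 @\<^sub>c A4 \<in> carrier_mat m (L * Q + (L * Q + (K + nT)))"
      by (rule append_cols_carrier[OF that(1) c2])
    show "(A1 @\<^sub>c A2 @\<^sub>c A3 @\<^sub>c A4) *\<^sub>v (\<beta> @\<^sub>v \<beta>' @\<^sub>v \<xi> @\<^sub>v \<theta>)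
        = A1 *\<^sub>v \<beta> + (A2 *\<^sub>v \<beta>' + (A3 *\<^sub>v \<xi> + A4 *\<^sub>v \<theta>))"
      using append_cols_mult[OF that(1) c2 \<beta>] append_cols_mult[OF that(2) c3 \<beta>']
        append_cols_mult[OF that(3,4) \<xi> \<theta>] \<beta>' \<xi> \<theta> by simp
  qed
  have "\<xi> = vec_first \<xi> L @\<^sub>v vec_last \<xi> (K - L)"
    using \<xi> LK by (subst vec_first_last_append) auto
  then have "?E *\<^sub>v \<xi> = ?E *\<^sub>v (vec_first \<xi> L @\<^sub>v vec_last \<xi> (K - L))" by simp
  also have "\<dots> = 1\<^sub>m L *\<^sub>v vec_first \<xi> L + 0\<^sub>m L (K - L) *\<^sub>v vec_last \<xi> (K - L)"
    by (rule append_cols_mult) auto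
  also have "\<dots> = Matrix.vec L (\<lambda>l. \<xi> $ l)"
    by (subst zero_mat_mult_vec) (auto simp: vec_first_def)
  finally have E\<xi>: "?E *\<^sub>v \<xi> = Matrix.vec L (\<lambda>l. \<xi> $ l)" .
  have z: "\<beta> @\<^sub>v \<beta>' @\<^sub>v \<xi> @\<^sub>v \<theta> \<in> carrier_vec (L * Q + (L * Q + (K + nT)))"
    using \<beta> \<beta>' \<xi> \<theta> by (intro append_carrier_vec)
  have S\<xi>: "S *\<^sub>v \<xi> \<in> carrier_vec J" using S \<xi> by simp
  note c1 = carr[OF zero_carrier_mat zero_carrier_mat S zero_carrier_mat]
  note c2 = carr[OF uminus_carrier_mat[OF Kr] zero_carrier_mat E zero_carrier_mat]
  note c3 = carr[OF one_carrier_mat one_carrier_mat zero_carrier_mat zero_carrier_mat]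
  note m1 = mult[OF zero_carrier_mat zero_carrier_mat S zero_carrier_mat]
  note m2 = mult[OF uminus_carrier_mat[OF Kr] zero_carrier_mat E zero_carrier_mat]
  note m3 = mult[OF one_carrier_mat one_carrier_mat zero_carrier_mat zero_carrier_mat]
  have "0\<^sub>m J (L * Q) *\<^sub>v \<beta> + (0\<^sub>m J (L * Q) *\<^sub>v \<beta>' + (S *\<^sub>v \<xi> + 0\<^sub>m J nT *\<^sub>v \<theta>)) = S *\<^sub>v \<xi>"
    using S\<xi> by (simp add: zero_mat_mult_vec[OF \<beta>] zero_mat_mult_vec[OF \<beta>'] zero_mat_mult_vec[OF \<theta>])
  moreover have "- ?Kr *\<^sub>v \<beta> + (0\<^sub>m L (L * Q) *\<^sub>v \<beta>' + (?E *\<^sub>v \<xi> + 0\<^sub>m L nT *\<^sub>v \<theta>))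
      = Matrix.vec L (\<lambda>l. \<xi> $ l - (\<Sum>q<Q. 2 ^ q * \<beta> $ (l * Q + q)))"
  proof (rule eq_vecI)
    fix l assume "l < dim_vec (Matrix.vec L (\<lambda>l. \<xi> $ l - (\<Sum>q<Q. 2 ^ q * \<beta> $ (l * Q + q))))"
    then have l: "l < L" by simp
    have "- ?Kr *\<^sub>v \<beta> = - (?Kr *\<^sub>v \<beta>)"
      using \<beta> Kr by (intro uminus_mult_mat_vec) auto
    then show "(- ?Kr *\<^sub>v \<beta> + (0\<^sub>m L (L * Q) *\<^sub>v \<beta>' + (?E *\<^sub>v \<xi> + 0\<^sub>m L nT *\<^sub>v \<theta>))) $ l
        = Matrix.vec L (\<lambda>l. \<xi> $ l - (\<Sum>q<Q. 2 ^ q * \<beta> $ (l * Q + q))) $ l"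
      using l kronecker_one_pow2_mult[OF \<beta> l] carrier_matD(1)[OF Kr]
      by (simp add: zero_mat_mult_vec[OF \<beta>'] zero_mat_mult_vec[OF \<theta>] E\<xi> del: index_mult_mat_vec)
  qed simp
  moreover have "1\<^sub>m (L * Q) *\<^sub>v \<beta> + (1\<^sub>m (L * Q) *\<^sub>v \<beta>' + (0\<^sub>m (L * Q) K *\<^sub>v \<xi> + 0\<^sub>m (L * Q) nT *\<^sub>v \<theta>)) = \<beta> + \<beta>'"
    using \<beta> \<beta>' by (simp add: zero_mat_mult_vec[OF \<xi>] zero_mat_mult_vec[OF \<theta>])
  ultimately show ?thesis
    unfolding lifted_S_def mat_mult_append[OF c1 carrier_append_rows[OF c2 c3] z]
      mat_mult_append[OF c2 c3 z] m1 m2 m3 by simp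
qed

end

lemma lifted_A_carrier:
  "Ax \<in> carrier_mat M K \<Longrightarrow> lifted_A M nT L Q Ax \<in> carrier_mat M (L * Q + (L * Q + (K + nT)))"
  unfolding lifted_A_def by (intro append_cols_carrier zero_carrier_mat)

lemma lifted_A_mult:
  assumes A: "Ax \<in> carrier_mat M K"
    and \<beta>: "\<beta> \<in> carrier_vec (L * Q)" and \<beta>': "\<beta>' \<in> carrier_vec (L * Q)"
    and \<xi>: "\<xi> \<in> carrier_vec K" and \<theta>: "\<theta> \<in> carrier_vec nT"
  shows "lifted_A M nT L Q Ax *\<^sub>v (\<beta> @\<^sub>v \<beta>' @\<^sub>v \<xi> @\<^sub>v \<theta>) = Ax *\<^sub>v \<xi>"
proof -
  note c3 = append_cols_carrier[OF A zero_carrier_mat[of M nT]]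
  note c2 = append_cols_carrier[OF zero_carrier_mat[of M "L * Q"] c3]
  have A\<xi>: "Ax *\<^sub>v \<xi> \<in> carrier_vec M" using A \<xi> by simp
  show ?thesis
    unfolding lifted_A_def
    using append_cols_mult[OF zero_carrier_mat[of M "L * Q"] c2 \<beta>]
      append_cols_mult[OF zero_carrier_mat[of M "L * Q"] c3 \<beta>']
      append_cols_mult[OF A zero_carrier_mat \<xi> \<theta>] \<beta>' \<xi> \<theta> A\<xi>
    by (simp add: zero_mat_mult_vec[OF \<beta>] zero_mat_mult_vec[OF \<beta>'] zero_mat_mult_vec[OF \<theta>])
qed

section \<open>The lifted quadratic objective\<close>

context
  fixes P R W :: "real Matrix.mat" and K nT N D2 :: nat
  assumes P: "P \<in> carrier_mat N D2" and rank: "full_column_rank P"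
    and R: "R \<in> carrier_mat D2 K" and W: "W \<in> carrier_mat nT D2"
begin

lemma lifted_P_carrier_transpose:
  assumes Tx: "Tx \<in> carrier_mat nT K"
  shows "lifted_P K nT L Q P R W Tx \<in> carrier_mat (L * Q + (L * Q + (K + nT))) (L * Q + (L * Q + (K + nT)))"
  "transpose_mat (lifted_P K nT L Q P R W Tx) = lifted_P K nT L Q P R W Tx"
proof -
  note G = gram_inv_props[OF P rank]
  let ?D = "2 * L * Q"
  let ?C = "(1/2) \<cdot>\<^sub>m (Tx + (1/2) \<cdot>\<^sub>m (W * gram_inv P * R))"
  let ?U = "(-1/4) \<cdot>\<^sub>m (transpose_mat R * gram_inv P * R)"
  let ?V = "(-1/4) \<cdot>\<^sub>m (W * gram_inv P * transpose_mat W)"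
  have C: "?C \<in> carrier_mat nT K" using W G R Tx by auto
  have Ct: "transpose_mat ?C \<in> carrier_mat K nT" using C by simp
  have U: "?U \<in> carrier_mat K K" and V: "?V \<in> carrier_mat nT nT" using R W G by auto
  \<comment> \<open>Covers both diagonal blocks, with \<open>Y = R\<close> and with
    \<open>Y = transpose_mat W\<close>.\<close>
  have form: "transpose_mat (c \<cdot>\<^sub>m (transpose_mat Y * gram_inv P * Y)) = c \<cdot>\<^sub>m (transpose_mat Y * gram_inv P * Y)"
    if Y: "Y \<in> carrier_mat D2 k" for c k and Y :: "real Matrix.mat"
  proof -
    have Yt: "transpose_mat Y \<in> carrier_mat k D2" using Y by simp
    have "transpose_mat (c \<cdot>\<^sub>m Z) = c \<cdot>\<^sub>m transpose_mat Z" for Z :: "real Matrix.mat"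
      by (intro eq_matI) auto
    moreover have "transpose_mat (transpose_mat Y * gram_inv P * Y) = transpose_mat Y * (gram_inv P * Y)"
      using transpose_mult[OF mult_carrier_mat[OF Yt G(1)] Y] transpose_mult[OF Yt G(1)] G(4) by simp
    ultimately show ?thesis using assoc_mult_mat[OF Yt G(1) Y] by simp
  qed
  have Ut: "transpose_mat ?U = ?U" by (rule form[OF R])
  have Vt: "transpose_mat ?V = ?V" using form[of "transpose_mat W" nT] W by simp
  let ?B = "four_block_mat ?U (transpose_mat ?C) ?C ?V"
  have B: "?B \<in> carrier_mat (K + nT) (K + nT)" using four_block_carrier_mat[OF U V] .
  have Bt: "transpose_mat ?B = ?B"
    using transpose_four_block_mat[OF U Ct C V] Ut Vt by simp
  have eq: "lifted_P K nT L Q P R W Tx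
      = four_block_mat (0\<^sub>m ?D ?D) (0\<^sub>m ?D (K + nT)) (0\<^sub>m (K + nT) ?D) ?B"
    unfolding lifted_P_def Let_def ..
  show "transpose_mat (lifted_P K nT L Q P R W Tx) = lifted_P K nT L Q P R W Tx"
    unfolding eq transpose_four_block_mat[OF zero_carrier_mat zero_carrier_mat zero_carrier_mat B] Bt
    by simp
  \<comment> \<open>\<open>lifted_P\<close> counts the two bit blocks as one block of size
    \<open>2 * L * Q\<close>, whereas the other lifted data list them separately.\<close>
  have "?D + (K + nT) = L * Q + (L * Q + (K + nT))" by simp
  then show "lifted_P K nT L Q P R W Tx
      \<in> carrier_mat (L * Q + (L * Q + (K + nT))) (L * Q + (L * Q + (K + nT)))"
    unfolding eq using four_block_carrier_mat[OF zero_carrier_mat B, of ?D ?D] by metis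
qed

text \<open>The two off-diagonal blocks contribute equally, which cancels the outer factor 1/2 and
  leaves the bilinear coupling of \<open>\<xi>\<close> and \<open>\<theta>\<close>.\<close>

lemma lifted_P_form:
  assumes Tx: "Tx \<in> carrier_mat nT K"
    and \<beta>: "\<beta> \<in> carrier_vec (L * Q)" and \<beta>': "\<beta>' \<in> carrier_vec (L * Q)"
    and \<xi>: "\<xi> \<in> carrier_vec K" and \<theta>: "\<theta> \<in> carrier_vec nT"
  shows "(\<beta> @\<^sub>v \<beta>' @\<^sub>v \<xi> @\<^sub>v \<theta>) \<bullet> (lifted_P K nT L Q P R W Tx *\<^sub>v (\<beta> @\<^sub>v \<beta>' @\<^sub>v \<xi> @\<^sub>v \<theta>))
    = (Tx *\<^sub>v \<xi>) \<bullet> \<theta> + 1/2 * ((W *\<^sub>v (gram_inv P *\<^sub>v (R *\<^sub>v \<xi>))) \<bullet> \<theta>)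
      - 1/4 * (\<theta> \<bullet> ((W * gram_inv P * transpose_mat W) *\<^sub>v \<theta>))
      - 1/4 * ((R *\<^sub>v \<xi>) \<bullet> (gram_inv P *\<^sub>v (R *\<^sub>v \<xi>)))"
proof -
  note G = gram_inv_props[OF P rank]
  let ?D = "2 * L * Q"
  let ?C = "(1/2) \<cdot>\<^sub>m (Tx + (1/2) \<cdot>\<^sub>m (W * gram_inv P * R))"
  let ?RGR = "transpose_mat R * gram_inv P * R"
  let ?WGW = "W * gram_inv P * transpose_mat W"
  let ?U = "(-1/4) \<cdot>\<^sub>m ?RGR"
  let ?V = "(-1/4) \<cdot>\<^sub>m ?WGW"
  have C: "?C \<in> carrier_mat nT K" using W G R Tx by auto
  have Ct: "transpose_mat ?C \<in> carrier_mat K nT" using C by simp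
  have U0: "?RGR \<in> carrier_mat K K" and V0: "?WGW \<in> carrier_mat nT nT" using R W G by auto
  have U: "?U \<in> carrier_mat K K" and V: "?V \<in> carrier_mat nT nT" using U0 V0 by auto
  let ?B = "four_block_mat ?U (transpose_mat ?C) ?C ?V"
  have B: "?B \<in> carrier_mat (K + nT) (K + nT)" using four_block_carrier_mat[OF U V] .
  let ?\<eta> = "\<beta> @\<^sub>v \<beta>'"
  let ?\<zeta> = "\<xi> @\<^sub>v \<theta>"
  have "?\<eta> \<in> carrier_vec (L * Q + L * Q)" using \<beta> \<beta>' by (rule append_carrier_vec)
  then have \<eta>: "?\<eta> \<in> carrier_vec ?D" by (simp add: mult_2 add_mult_distrib)
  have \<zeta>: "?\<zeta> \<in> carrier_vec (K + nT)" using \<xi> \<theta> by (rule append_carrier_vec)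
  have B\<zeta>: "?B *\<^sub>v ?\<zeta> \<in> carrier_vec (K + nT)" using B \<zeta> by simp
  have eq: "lifted_P K nT L Q P R W Tx
      = four_block_mat (0\<^sub>m ?D ?D) (0\<^sub>m ?D (K + nT)) (0\<^sub>m (K + nT) ?D) ?B"
    unfolding lifted_P_def Let_def ..
  have "(?\<eta> @\<^sub>v ?\<zeta>) \<bullet> (lifted_P K nT L Q P R W Tx *\<^sub>v (?\<eta> @\<^sub>v ?\<zeta>)) = (?\<eta> @\<^sub>v ?\<zeta>) \<bullet> (0\<^sub>v ?D @\<^sub>v (?B *\<^sub>v ?\<zeta>))"
    unfolding eq
    using four_block_mat_mult_vec[OF zero_carrier_mat zero_carrier_mat zero_carrier_mat B \<eta> \<zeta>] B\<zeta>
    by (simp add: zero_mat_mult_vec[OF \<eta>] zero_mat_mult_vec[OF \<zeta>])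
  also have "\<dots> = ?\<zeta> \<bullet> (?B *\<^sub>v ?\<zeta>)"
    using scalar_prod_append[OF \<eta> \<zeta> zero_carrier_vec B\<zeta>] scalar_prod_right_zero[OF \<eta>] by simp
  also have "\<dots> = ?\<zeta> \<bullet> ((?U *\<^sub>v \<xi> + transpose_mat ?C *\<^sub>v \<theta>) @\<^sub>v (?C *\<^sub>v \<xi> + ?V *\<^sub>v \<theta>))"
    by (simp only: four_block_mat_mult_vec[OF U Ct C V \<xi> \<theta>])
  also have "\<dots> = \<xi> \<bullet> (?U *\<^sub>v \<xi> + transpose_mat ?C *\<^sub>v \<theta>) + \<theta> \<bullet> (?C *\<^sub>v \<xi> + ?V *\<^sub>v \<theta>)"
    by (rule scalar_prod_append[OF \<xi> \<theta>
        add_carrier_vec[OF mult_mat_vec_carrier[OF U \<xi>] mult_mat_vec_carrier[OF Ct \<theta>]]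
        add_carrier_vec[OF mult_mat_vec_carrier[OF C \<xi>] mult_mat_vec_carrier[OF V \<theta>]]])
  also have "\<dots> = \<xi> \<bullet> (?U *\<^sub>v \<xi>) + \<xi> \<bullet> (transpose_mat ?C *\<^sub>v \<theta>) + (\<theta> \<bullet> (?C *\<^sub>v \<xi>) + \<theta> \<bullet> (?V *\<^sub>v \<theta>))"
    using scalar_prod_add_distrib[OF \<xi> mult_mat_vec_carrier[OF U \<xi>] mult_mat_vec_carrier[OF Ct \<theta>]]
      scalar_prod_add_distrib[OF \<theta> mult_mat_vec_carrier[OF C \<xi>] mult_mat_vec_carrier[OF V \<theta>]] by simp
  also have "\<xi> \<bullet> (transpose_mat ?C *\<^sub>v \<theta>) = (?C *\<^sub>v \<xi>) \<bullet> \<theta>"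
    by (rule scalar_prod_transpose_mult[OF C \<xi> \<theta>])
  also have "\<theta> \<bullet> (?C *\<^sub>v \<xi>) = (?C *\<^sub>v \<xi>) \<bullet> \<theta>"
    by (rule comm_scalar_prod[OF \<theta> mult_mat_vec_carrier[OF C \<xi>]])
  also have "(?C *\<^sub>v \<xi>) = (1/2) \<cdot>\<^sub>v (Tx *\<^sub>v \<xi> + (1/2) \<cdot>\<^sub>v (W *\<^sub>v (gram_inv P *\<^sub>v (R *\<^sub>v \<xi>))))"
  proof -
    have WG: "W * gram_inv P \<in> carrier_mat nT D2" using W G by auto
    have WGR: "W * gram_inv P * R \<in> carrier_mat nT K" using WG R by auto
    have smult: "(c \<cdot>\<^sub>m Z) *\<^sub>v \<xi> = c \<cdot>\<^sub>v (Z *\<^sub>v \<xi>)" if "Z \<in> carrier_mat nT K" for c Z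
      using that \<xi> by (intro eq_vecI) auto
    have "(W * gram_inv P * R) *\<^sub>v \<xi> = W *\<^sub>v (gram_inv P *\<^sub>v (R *\<^sub>v \<xi>))"
      using assoc_mult_mat_vec[OF WG R \<xi>] assoc_mult_mat_vec[OF W G(1) mult_mat_vec_carrier[OF R \<xi>]] by simp
    then show ?thesis
      using smult[of "Tx + (1/2) \<cdot>\<^sub>m (W * gram_inv P * R)" "1/2"] smult[OF WGR, of "1/2"]
        add_mult_distrib_mat_vec[OF Tx smult_carrier_mat[OF WGR] \<xi>] Tx WGR by simp
  qed
  also have "((1/2) \<cdot>\<^sub>v (Tx *\<^sub>v \<xi> + (1/2) \<cdot>\<^sub>v (W *\<^sub>v (gram_inv P *\<^sub>v (R *\<^sub>v \<xi>))))) \<bullet> \<theta>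
      = 1/2 * ((Tx *\<^sub>v \<xi>) \<bullet> \<theta>) + 1/4 * ((W *\<^sub>v (gram_inv P *\<^sub>v (R *\<^sub>v \<xi>))) \<bullet> \<theta>)"
  proof -
    have T\<xi>: "Tx *\<^sub>v \<xi> \<in> carrier_vec nT" and w: "W *\<^sub>v (gram_inv P *\<^sub>v (R *\<^sub>v \<xi>)) \<in> carrier_vec nT"
      using Tx W G R \<xi> by auto
    have hw: "(1/2) \<cdot>\<^sub>v (W *\<^sub>v (gram_inv P *\<^sub>v (R *\<^sub>v \<xi>))) \<in> carrier_vec nT" using w by simp
    show ?thesis
      by (simp add: smult_scalar_prod_distrib[OF add_carrier_vec[OF T\<xi> hw] \<theta>]
          add_scalar_prod_distrib[OF T\<xi> hw \<theta>] smult_scalar_prod_distrib[OF w \<theta>] del: scalar_prod_smult_left)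
  qed
  also have "\<xi> \<bullet> (?U *\<^sub>v \<xi>) = -1/4 * ((R *\<^sub>v \<xi>) \<bullet> (gram_inv P *\<^sub>v (R *\<^sub>v \<xi>)))"
  proof -
    have Rt: "transpose_mat R \<in> carrier_mat K D2" using R by simp
    have R\<xi>: "R *\<^sub>v \<xi> \<in> carrier_vec D2" using R \<xi> by simp
    have GR: "gram_inv P *\<^sub>v (R *\<^sub>v \<xi>) \<in> carrier_vec D2" using G(1) R\<xi> by simp
    have "?RGR *\<^sub>v \<xi> = transpose_mat R *\<^sub>v (gram_inv P *\<^sub>v (R *\<^sub>v \<xi>))"
      using assoc_mult_mat_vec[OF mult_carrier_mat[OF Rt G(1)] R \<xi>] assoc_mult_mat_vec[OF Rt G(1) R\<xi>] by simp
    then have "\<xi> \<bullet> (?RGR *\<^sub>v \<xi>) = (R *\<^sub>v \<xi>) \<bullet> (gram_inv P *\<^sub>v (R *\<^sub>v \<xi>))"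
      using scalar_prod_transpose_mult[OF R \<xi> GR] by simp
    moreover have "?U *\<^sub>v \<xi> = (-1/4) \<cdot>\<^sub>v (?RGR *\<^sub>v \<xi>)"
      using U0 \<xi> by (intro eq_vecI) auto
    ultimately show ?thesis using \<xi> U0 by simp
  qed
  also have "\<theta> \<bullet> (?V *\<^sub>v \<theta>) = -1/4 * (\<theta> \<bullet> (?WGW *\<^sub>v \<theta>))"
  proof -
    have "?V *\<^sub>v \<theta> = (-1/4) \<cdot>\<^sub>v (?WGW *\<^sub>v \<theta>)"
      using V0 \<theta> by (intro eq_vecI) auto
    then show ?thesis using \<theta> V0 by simp
  qed
  finally show ?thesis unfolding append_vec_assoc' by simp
qed

lemma lifted_b_carrier:
  assumes r: "r \<in> carrier_vec D2" and bx: "bx \<in> carrier_vec K" and hx: "hx \<in> carrier_vec nT"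
  shows "lifted_b L Q P R r W bx hx \<in> carrier_vec (L * Q + (L * Q + (K + nT)))"
  unfolding lifted_b_def using gram_inv_props(1)[OF P rank] R r W bx hx
  by (intro append_carrier_vec zero_carrier_vec) (auto intro!: carrier_vecI)

lemma lifted_b_form:
  assumes r: "r \<in> carrier_vec D2" and bx: "bx \<in> carrier_vec K" and hx: "hx \<in> carrier_vec nT"
    and \<beta>: "\<beta> \<in> carrier_vec (L * Q)" and \<beta>': "\<beta>' \<in> carrier_vec (L * Q)"
    and \<xi>: "\<xi> \<in> carrier_vec K" and \<theta>: "\<theta> \<in> carrier_vec nT"
  shows "lifted_b L Q P R r W bx hx \<bullet> (\<beta> @\<^sub>v \<beta>' @\<^sub>v \<xi> @\<^sub>v \<theta>)
    = bx \<bullet> \<xi> - 1/2 * (r \<bullet> (gram_inv P *\<^sub>v (R *\<^sub>v \<xi>)))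
      + hx \<bullet> \<theta> + 1/2 * ((W *\<^sub>v (gram_inv P *\<^sub>v r)) \<bullet> \<theta>)"
proof -
  note G = gram_inv_props[OF P rank]
  have Gr: "gram_inv P *\<^sub>v r \<in> carrier_vec D2" using G r by simp
  have R\<xi>: "R *\<^sub>v \<xi> \<in> carrier_vec D2" using R \<xi> by simp
  let ?v1 = "transpose_mat R *\<^sub>v (gram_inv P *\<^sub>v r)"
  let ?v2 = "W *\<^sub>v (gram_inv P *\<^sub>v r)"
  have v1: "?v1 \<in> carrier_vec K" using R by (auto intro!: carrier_vecI)
  have v2: "?v2 \<in> carrier_vec nT" using W Gr by simp
  have b1: "bx - (1/2) \<cdot>\<^sub>v ?v1 \<in> carrier_vec K" and b2: "hx + (1/2) \<cdot>\<^sub>v ?v2 \<in> carrier_vec nT"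
    using v1 v2 bx hx by auto
  note c2 = append_carrier_vec[OF b1 b2]
  have "lifted_b L Q P R r W bx hx \<bullet> (\<beta> @\<^sub>v \<beta>' @\<^sub>v \<xi> @\<^sub>v \<theta>)
      = (bx - (1/2) \<cdot>\<^sub>v ?v1) \<bullet> \<xi> + (hx + (1/2) \<cdot>\<^sub>v ?v2) \<bullet> \<theta>"
    unfolding lifted_b_def
    using scalar_prod_append[OF zero_carrier_vec append_carrier_vec[OF zero_carrier_vec c2] \<beta>
        append_carrier_vec[OF \<beta>' append_carrier_vec[OF \<xi> \<theta>]]]
      scalar_prod_append[OF zero_carrier_vec c2 \<beta>' append_carrier_vec[OF \<xi> \<theta>]]
      scalar_prod_append[OF b1 b2 \<xi> \<theta>] scalar_prod_left_zero[OF \<beta>] scalar_prod_left_zero[OF \<beta>'] by simp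
  also have "(bx - (1/2) \<cdot>\<^sub>v ?v1) \<bullet> \<xi> = bx \<bullet> \<xi> - 1/2 * (?v1 \<bullet> \<xi>)"
    using bx v1 \<xi> by (simp add: minus_scalar_prod_distrib[of _ K])
  also have "(hx + (1/2) \<cdot>\<^sub>v ?v2) \<bullet> \<theta> = hx \<bullet> \<theta> + 1/2 * (?v2 \<bullet> \<theta>)"
    using hx v2 \<theta> by (simp add: add_scalar_prod_distrib[of _ nT])
  also have "?v1 \<bullet> \<xi> = (gram_inv P *\<^sub>v r) \<bullet> (R *\<^sub>v \<xi>)"
    by (rule transpose_vec_mult_scalar[OF R \<xi> Gr])
  also have "\<dots> = r \<bullet> (gram_inv P *\<^sub>v (R *\<^sub>v \<xi>))"
    using scalar_prod_transpose_mult[OF G(1) r R\<xi>] G(4) by simp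
  finally show ?thesis by simp
qed

text \<open>The completed square for \<open>R *\<^sub>v \<xi> + r\<close> splits by degree in
  \<open>\<xi>\<close>: its quadratic part sits in \<open>lifted_P\<close>, its linear part in
  \<open>lifted_b\<close>, and its constant is the correction term of the copositive objective. The
  coupling with \<open>\<theta>\<close> splits in the same way.\<close>

lemma lifted_objective:
  assumes Tx: "Tx \<in> carrier_mat nT K"
    and r: "r \<in> carrier_vec D2" and bx: "bx \<in> carrier_vec K" and hx: "hx \<in> carrier_vec nT"
    and \<beta>: "\<beta> \<in> carrier_vec (L * Q)" and \<beta>': "\<beta>' \<in> carrier_vec (L * Q)"
    and \<xi>: "\<xi> \<in> carrier_vec K" and \<theta>: "\<theta> \<in> carrier_vec nT"
  defines "z \<equiv> \<beta> @\<^sub>v \<beta>' @\<^sub>v \<xi> @\<^sub>v \<theta>"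
  shows "z \<bullet> (lifted_P K nT L Q P R W Tx *\<^sub>v z) + lifted_b L Q P R r W bx hx \<bullet> z
      - 1/4 * (r \<bullet> (gram_inv P *\<^sub>v r))
    = bx \<bullet> \<xi> + dual_value P W (R *\<^sub>v \<xi> + r) (Tx *\<^sub>v \<xi> + hx) \<theta>"
proof -
  note G = gram_inv_props[OF P rank]
  have R\<xi>: "R *\<^sub>v \<xi> \<in> carrier_vec D2" and T\<xi>: "Tx *\<^sub>v \<xi> \<in> carrier_vec nT" using R Tx \<xi> by auto
  have GR: "gram_inv P *\<^sub>v (R *\<^sub>v \<xi>) \<in> carrier_vec D2" and Gr: "gram_inv P *\<^sub>v r \<in> carrier_vec D2"
    using G R\<xi> r by auto
  have W1: "W *\<^sub>v (gram_inv P *\<^sub>v (R *\<^sub>v \<xi>)) \<in> carrier_vec nT" and W2: "W *\<^sub>v (gram_inv P *\<^sub>v r) \<in> carrier_vec nT"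
    using W GR Gr by auto
  have "(W *\<^sub>v (gram_inv P *\<^sub>v (R *\<^sub>v \<xi> + r))) \<bullet> \<theta>
      = (W *\<^sub>v (gram_inv P *\<^sub>v (R *\<^sub>v \<xi>))) \<bullet> \<theta> + (W *\<^sub>v (gram_inv P *\<^sub>v r)) \<bullet> \<theta>"
    by (simp only: mult_add_distrib_mat_vec[OF G(1) R\<xi> r] mult_add_distrib_mat_vec[OF W GR Gr]
        add_scalar_prod_distrib[OF W1 W2 \<theta>])
  moreover have "(Tx *\<^sub>v \<xi> + hx) \<bullet> \<theta> = (Tx *\<^sub>v \<xi>) \<bullet> \<theta> + hx \<bullet> \<theta>"
    by (rule add_scalar_prod_distrib[OF T\<xi> hx \<theta>])
  ultimately show ?thesis
    unfolding z_def lifted_P_form[OF Tx \<beta> \<beta>' \<xi> \<theta>] lifted_b_form[OF r bx hx \<beta> \<beta>' \<xi> \<theta>]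
      dual_value_expand[OF P rank W add_carrier_vec[OF R\<xi> r] add_carrier_vec[OF T\<xi> hx] \<theta>]
      quadratic_form_add[OF G(1,4) R\<xi> r]
    by (simp add: algebra_simps)
qed

end

section \<open>Equivalence\<close>

lemma lifted_feasibleE:
  fixes z :: "real Matrix.vec"
  assumes z: "z \<in> carrier_vec (L * Q + (L * Q + (K + nT)))" "0\<^sub>v (L * Q + (L * Q + (K + nT))) \<le> z"
  obtains \<beta> \<beta>' \<xi> \<theta> where "z = \<beta> @\<^sub>v \<beta>' @\<^sub>v \<xi> @\<^sub>v \<theta>"
    "\<beta> \<in> carrier_vec (L * Q)" "\<beta>' \<in> carrier_vec (L * Q)" "\<xi> \<in> carrier_vec K" "\<theta> \<in> carrier_vec nT"
    "0\<^sub>v (L * Q) \<le> \<beta>" "0\<^sub>v (L * Q) \<le> \<beta>'" "0\<^sub>v K \<le> \<xi>" "0\<^sub>v nT \<le> \<theta>"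
    "\<And>i. i < L * Q \<Longrightarrow> z $ i = \<beta> $ i"
proof -
  define w where "w = vec_last z (L * Q + (K + nT))"
  define \<zeta> where "\<zeta> = vec_last w (K + nT)"
  define \<beta> where "\<beta> = vec_first z (L * Q)"
  define \<beta>' where "\<beta>' = vec_first w (L * Q)"
  define \<xi> where "\<xi> = vec_first \<zeta> K"
  define \<theta> where "\<theta> = vec_last \<zeta> nT"
  have split: "z = \<beta> @\<^sub>v w" "w = \<beta>' @\<^sub>v \<zeta>" "\<zeta> = \<xi> @\<^sub>v \<theta>"
    using z(1) unfolding \<beta>_def \<beta>'_def \<xi>_def \<theta>_def w_def \<zeta>_def by simp_all
  have carr: "\<beta> \<in> carrier_vec (L * Q)" "\<beta>' \<in> carrier_vec (L * Q)" "\<xi> \<in> carrier_vec K" "\<theta> \<in> carrier_vec nT"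
    "w \<in> carrier_vec (L * Q + (K + nT))" "\<zeta> \<in> carrier_vec (K + nT)"
    unfolding \<beta>_def \<beta>'_def \<xi>_def \<theta>_def w_def \<zeta>_def by simp_all
  have pos: "0\<^sub>v a \<le> u \<and> 0\<^sub>v b \<le> v"
    if uv: "0\<^sub>v (a + b) \<le> u @\<^sub>v v" "u \<in> carrier_vec a" "v \<in> carrier_vec b" for a b and u v :: "real Matrix.vec"
  proof -
    have "0\<^sub>v (a + b) = 0\<^sub>v a @\<^sub>v 0\<^sub>v b" by (intro eq_vecI) auto
    then show ?thesis using uv(1) append_vec_le[OF zero_carrier_vec uv(2)] by metis
  qed
  have "0\<^sub>v (L * Q) \<le> \<beta> \<and> 0\<^sub>v (L * Q + (K + nT)) \<le> w"
    using z(2) pos[OF _ carr(1,5)] unfolding split(1) by blast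
  moreover from this have "0\<^sub>v (L * Q) \<le> \<beta>' \<and> 0\<^sub>v (K + nT) \<le> \<zeta>"
    using pos[OF _ carr(2,6)] unfolding split(2) by blast
  moreover from this have "0\<^sub>v K \<le> \<xi> \<and> 0\<^sub>v nT \<le> \<theta>"
    using pos[OF _ carr(3,4)] unfolding split(3) by blast
  moreover have "z $ i = \<beta> $ i" if "i < L * Q" for i
    using that unfolding \<beta>_def vec_first_def by simp
  ultimately show ?thesis using that[of \<beta> \<beta>' \<xi> \<theta>] split carr by simp
qed

lemma lifted_t_carrier: "t \<in> carrier_vec J \<Longrightarrow> lifted_t L Q t \<in> carrier_vec (J + (L + L * Q))"
  unfolding lifted_t_def by (intro append_carrier_vec) auto

section \<open>Lifted feasible points and lifted recession directions\<close>

context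
  fixes J K nT L Q :: nat and S :: "real Matrix.mat" and t :: "real Matrix.vec"
  assumes S: "S \<in> carrier_mat J K" and LK: "L \<le> K" and t: "t \<in> carrier_vec J"
begin

text \<open>The outer blocks of the right-hand side are left general, so that the same equivalence
  serves the system with \<open>lifted_t\<close> and the homogeneous one.\<close>

lemma lifted_S_eq_iff:
  assumes \<beta>: "\<beta> \<in> carrier_vec (L * Q)" and \<beta>': "\<beta>' \<in> carrier_vec (L * Q)"
    and \<xi>: "\<xi> \<in> carrier_vec K" and \<theta>: "\<theta> \<in> carrier_vec nT"
    and a: "a \<in> carrier_vec J" and e: "e \<in> carrier_vec (L * Q)"
  shows "lifted_S J K nT L Q S *\<^sub>v (\<beta> @\<^sub>v \<beta>' @\<^sub>v \<xi> @\<^sub>v \<theta>) = a @\<^sub>v 0\<^sub>v L @\<^sub>v e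
    \<longleftrightarrow> S *\<^sub>v \<xi> = a \<and> (\<forall>l<L. \<xi> $ l = (\<Sum>q<Q. 2 ^ q * \<beta> $ (l * Q + q))) \<and> \<beta> + \<beta>' = e"
proof -
  let ?d = "Matrix.vec L (\<lambda>l. \<xi> $ l - (\<Sum>q<Q. 2 ^ q * \<beta> $ (l * Q + q)))"
  have S\<xi>: "S *\<^sub>v \<xi> \<in> carrier_vec J" using S \<xi> by simp
  have "?d = 0\<^sub>v L \<longleftrightarrow> (\<forall>l<L. \<xi> $ l = (\<Sum>q<Q. 2 ^ q * \<beta> $ (l * Q + q)))"
    by (auto simp: vec_eq_iff)
  then show ?thesis
    unfolding lifted_S_mult[OF S LK \<beta> \<beta>' \<xi> \<theta>] append_vec_eq[OF S\<xi> a]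
    by (subst append_vec_eq[where n = L]) auto
qed

text \<open>Row \<open>J + L + i\<close> adds the nonnegative complement \<open>\<beta>' $ i\<close>
  to \<open>\<beta> $ i\<close>. This supplies the hypothesis \<open>row\<close> of
  \<open>cop_strong_duality\<close>.\<close>

lemma lifted_bound_row:
  assumes i: "i < L * Q"
    and z: "z \<in> carrier_vec (L * Q + (L * Q + (K + nT)))" "0\<^sub>v (L * Q + (L * Q + (K + nT))) \<le> z"
  shows "\<exists>j<J + (L + L * Q). lifted_t L Q t $ j = 1 \<and> z $ i \<le> (lifted_S J K nT L Q S *\<^sub>v z) $ j"
proof -
  obtain \<beta> \<beta>' \<xi> \<theta> where zeq: "z = \<beta> @\<^sub>v \<beta>' @\<^sub>v \<xi> @\<^sub>v \<theta>"
    and c: "\<beta> \<in> carrier_vec (L * Q)" "\<beta>' \<in> carrier_vec (L * Q)" "\<xi> \<in> carrier_vec K" "\<theta> \<in> carrier_vec nT"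
    and nn: "0\<^sub>v (L * Q) \<le> \<beta>'" and zi: "z $ i = \<beta> $ i"
    using lifted_feasibleE[OF z] i by metis
  have S\<xi>: "S *\<^sub>v \<xi> \<in> carrier_vec J" using S c by simp
  have "(lifted_S J K nT L Q S *\<^sub>v z) $ (J + L + i) = \<beta> $ i + \<beta>' $ i"
    unfolding zeq lifted_S_mult[OF S LK c] using S c i by simp
  moreover have "0 \<le> \<beta>' $ i" using nn c i by (simp add: vec_nonneg_iff)
  moreover have "lifted_t L Q t $ (J + L + i) = 1" unfolding lifted_t_def using t i by simp
  ultimately show ?thesis using zi i by (intro exI[of _ "J + L + i"]) auto
qed

text \<open>Integrality of \<open>\<xi>\<close> is not part of the lifted system; it is inherited
  from the bits, as a sum of powers of 2 with binary coefficients.\<close>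

lemma lifted_S_feasible_imp_uncertainty:
  assumes c: "\<beta> \<in> carrier_vec (L * Q)" "\<beta>' \<in> carrier_vec (L * Q)" "\<xi> \<in> carrier_vec K" "\<theta> \<in> carrier_vec nT"
    and \<xi>: "0\<^sub>v K \<le> \<xi>"
    and eq: "lifted_S J K nT L Q S *\<^sub>v (\<beta> @\<^sub>v \<beta>' @\<^sub>v \<xi> @\<^sub>v \<theta>) = lifted_t L Q t"
    and bin: "\<forall>i<L * Q. \<beta> $ i \<in> {0, 1}"
  shows "\<xi> \<in> uncertainty_set K L S t"
proof -
  have e: "Matrix.vec (L * Q) (\<lambda>_. 1) \<in> carrier_vec (L * Q)" by simp
  note iff = eq[unfolded lifted_t_def lifted_S_eq_iff[OF c t e]]
  have "(\<Sum>q<Q. 2 ^ q * \<beta> $ (l * Q + q)) \<in> \<int>" if l: "l < L" for l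
  proof (intro Ints_sum Ints_mult Ints_power)
    fix q assume "q \<in> {..<Q}"
    then have "l * Q + q < Suc l * Q" by simp
    also have "\<dots> \<le> L * Q" using l by (intro mult_le_mono1) simp
    finally show "\<beta> $ (l * Q + q) \<in> \<int>" using bin by force
  qed auto
  then show ?thesis using iff c(3) \<xi> unfolding uncertainty_set_def by auto
qed

lemma uncertainty_imp_lifted_S_feasible:
  assumes \<xi>: "\<xi> \<in> uncertainty_set K L S t" and bits: "\<forall>l<L. \<xi> $ l \<in> real ` {0..2 ^ Q - 1}"
    and \<theta>: "\<theta> \<in> carrier_vec nT"
  obtains \<beta> \<beta>' where "\<beta> \<in> carrier_vec (L * Q)" "\<beta>' \<in> carrier_vec (L * Q)"
    "0\<^sub>v (L * Q) \<le> \<beta>" "0\<^sub>v (L * Q) \<le> \<beta>'" "\<forall>i<L * Q. \<beta> $ i \<in> {0, 1}"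
    "lifted_S J K nT L Q S *\<^sub>v (\<beta> @\<^sub>v \<beta>' @\<^sub>v \<xi> @\<^sub>v \<theta>) = lifted_t L Q t"
proof -
  have \<xi>K: "\<xi> \<in> carrier_vec K" "S *\<^sub>v \<xi> = t" using \<xi> unfolding uncertainty_set_def by auto
  have "\<forall>l. \<exists>n. l < L \<longrightarrow> n < 2 ^ Q \<and> \<xi> $ l = real n"
  proof (intro allI)
    fix l
    show "\<exists>n. l < L \<longrightarrow> n < 2 ^ Q \<and> \<xi> $ l = real n"
    proof (cases "l < L")
      case True
      then obtain n where "n \<le> 2 ^ Q - 1" "\<xi> $ l = real n" using bits by fastforce
      \<comment> \<open>The subtraction in \<open>2 ^ Q - 1\<close> is truncated, so the strict
        bound \<open>n < 2 ^ Q\<close> needs this.\<close>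
      moreover have "(0::nat) < 2 ^ Q" by simp
      ultimately show ?thesis by (intro exI[of _ n]) linarith
    qed auto
  qed
  then obtain n where n: "\<And>l. l < L \<Longrightarrow> n l < 2 ^ Q" "\<And>l. l < L \<Longrightarrow> \<xi> $ l = real (n l)" by metis
  \<comment> \<open>Entry \<open>l * Q + q\<close> is bit \<open>q\<close> of the integer
    \<open>\<xi> $ l\<close>, in the order fixed by the Kronecker product.\<close>
  define \<beta> :: "real Matrix.vec" where "\<beta> = Matrix.vec (L * Q) (\<lambda>i. of_bool (bit (n (i div Q)) (i mod Q)))"
  define \<beta>' :: "real Matrix.vec" where "\<beta>' = Matrix.vec (L * Q) (\<lambda>i. 1 - \<beta> $ i)"
  have c: "\<beta> \<in> carrier_vec (L * Q)" "\<beta>' \<in> carrier_vec (L * Q)" by (auto simp: \<beta>_def \<beta>'_def)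
  have bin: "\<forall>i<L * Q. \<beta> $ i \<in> {0, 1}" by (auto simp: \<beta>_def)
  have nn: "0\<^sub>v (L * Q) \<le> \<beta>" "0\<^sub>v (L * Q) \<le> \<beta>'"
    unfolding vec_nonneg_iff[OF c(1)] vec_nonneg_iff[OF c(2)] by (auto simp: \<beta>_def \<beta>'_def)
  have e: "Matrix.vec (L * Q) (\<lambda>_. 1) \<in> carrier_vec (L * Q)" by simp
  have "\<xi> $ l = (\<Sum>q<Q. 2 ^ q * \<beta> $ (l * Q + q))" if l: "l < L" for l
  proof -
    have "\<beta> $ (l * Q + q) = of_bool (bit (n l) q)" if q: "q < Q" for q
    proof -
      have "l * Q + q < Suc l * Q" using q by simp
      also have "\<dots> \<le> L * Q" using l by (intro mult_le_mono1) simp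
      finally show ?thesis unfolding \<beta>_def using q by simp
    qed
    then have "(\<Sum>q<Q. 2 ^ q * \<beta> $ (l * Q + q)) = real (\<Sum>q<Q. 2 ^ q * of_bool (bit (n l) q))"
      by simp
    then show ?thesis using binary_expansion[OF n(1)[OF l]] n(2)[OF l] by simp
  qed
  moreover have "\<beta> + \<beta>' = Matrix.vec (L * Q) (\<lambda>_. 1)"
    by (intro eq_vecI) (auto simp: \<beta>'_def)
  ultimately have "lifted_S J K nT L Q S *\<^sub>v (\<beta> @\<^sub>v \<beta>' @\<^sub>v \<xi> @\<^sub>v \<theta>) = lifted_t L Q t"
    unfolding lifted_t_def lifted_S_eq_iff[OF c \<xi>K(1) \<theta> t e] using \<xi>K(2) by simp
  then show ?thesis using that c nn bin by blast
qed

text \<open>The bits determine the rest: the last block row kills the complements, the middle one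
  the integer coordinates of \<open>\<xi>\<close>, and boundedness of the uncertainty set the
  remaining ones. Only \<open>\<theta>\<close>, on which \<open>lifted_S\<close> imposes nothing,
  can survive.\<close>

lemma lifted_recession:
  assumes ne: "uncertainty_set K L S t \<noteq> {}" and bdd: "bounded_vecs (uncertainty_set K L S t)"
    and c: "\<beta> \<in> carrier_vec (L * Q)" "\<beta>' \<in> carrier_vec (L * Q)" "\<xi> \<in> carrier_vec K" "\<theta> \<in> carrier_vec nT"
    and \<xi>: "0\<^sub>v K \<le> \<xi>"
    and eq: "lifted_S J K nT L Q S *\<^sub>v (\<beta> @\<^sub>v \<beta>' @\<^sub>v \<xi> @\<^sub>v \<theta>) = 0\<^sub>v (J + (L + L * Q))"
    and \<beta>0: "\<forall>i<L * Q. \<beta> $ i = 0"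
  shows "\<beta> = 0\<^sub>v (L * Q)" "\<beta>' = 0\<^sub>v (L * Q)" "\<xi> = 0\<^sub>v K"
proof -
  have "0\<^sub>v (J + (L + L * Q)) = 0\<^sub>v J @\<^sub>v 0\<^sub>v L @\<^sub>v (0\<^sub>v (L * Q) :: real Matrix.vec)"
    by (intro eq_vecI) auto
  from eq[unfolded this lifted_S_eq_iff[OF c zero_carrier_vec zero_carrier_vec]]
  have S0: "S *\<^sub>v \<xi> = 0\<^sub>v J" and l0: "\<forall>l<L. \<xi> $ l = (\<Sum>q<Q. 2 ^ q * \<beta> $ (l * Q + q))"
    and sum0: "\<beta> + \<beta>' = 0\<^sub>v (L * Q)" by auto
  show \<beta>: "\<beta> = 0\<^sub>v (L * Q)" using \<beta>0 c(1) by (intro eq_vecI) auto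
  then show "\<beta>' = 0\<^sub>v (L * Q)" using sum0 c(2) by simp
  have "\<xi> $ l = 0" if l: "l < L" for l
  proof -
    have "2 ^ q * \<beta> $ (l * Q + q) = 0" if "q < Q" for q
    proof -
      have "l * Q + q < Suc l * Q" using that by simp
      also have "\<dots> \<le> L * Q" using l by (intro mult_le_mono1) simp
      finally show ?thesis using \<beta>0 by simp
    qed
    then show ?thesis using l0 l by simp
  qed
  then show "\<xi> = 0\<^sub>v K"
    using uncertainty_set_recession[OF S LK ne bdd c(3) \<xi> S0] by simp
qed

end

text \<open>Once the first-stage decision is fixed, the affine maps are mere matrices and vectors
  and the first-stage cost is a constant, so the equality can be proved for such data.\<close>

lemma copositive_value_eq_worst_case:
  fixes P R W S Ax Tx :: "real Matrix.mat" and r t bx hx :: "real Matrix.vec"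
    and M K nT N D2 J L Q :: nat and c :: real
  assumes P: "P \<in> carrier_mat N D2" and rank: "full_column_rank P"
    and R: "R \<in> carrier_mat D2 K" and r: "r \<in> carrier_vec D2"
    and W: "W \<in> carrier_mat nT D2" and cr: "complete_recourse W"
    and Ax: "Ax \<in> carrier_mat M K" and bx: "bx \<in> carrier_vec K"
    and Tx: "Tx \<in> carrier_mat nT K" and hx: "hx \<in> carrier_vec nT"
    and S: "S \<in> carrier_mat J K" and t: "t \<in> carrier_vec J" and LK: "L \<le> K"
    and ne: "uncertainty_set K L S t \<noteq> {}" and bdd: "bounded_vecs (uncertainty_set K L S t)"
    and bits: "\<forall>\<xi>\<in>uncertainty_set K L S t. \<forall>l<L. \<xi> $ l \<in> real ` {0..2 ^ Q - 1}"
    and tb_def: "tb = lifted_t L Q t"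
  defines "F \<equiv> cop_feasible M (L * Q) (lifted_S J K nT L Q S) (lifted_A M nT L Q Ax)
           (lifted_b L Q P R r W bx hx) (lifted_P K nT L Q P R W Tx)"
    and "obj \<equiv> (\<lambda>(\<tau>, \<psi>, \<phi>, \<gamma> :: real Matrix.vec, H :: real Matrix.mat).
           c - 1/4 * (r \<bullet> (gram_inv P *\<^sub>v r)) + tb \<bullet> \<psi> + hadamard_vec tb tb \<bullet> \<phi> + \<tau>)"
    and "worst \<equiv> (SUP \<xi>\<in>uncertainty_set K L S t.
           ereal ((eucl_norm (Ax *\<^sub>v \<xi>))\<^sup>2 + bx \<bullet> \<xi> + c) + recourse P R r W Tx hx \<xi>)"
  shows "(INF p\<in>F. ereal (obj p)) = worst"
proof -
  let ?n = "L * Q + (L * Q + (K + nT))"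
  let ?Sb = "lifted_S J K nT L Q S"
  let ?Ab = "lifted_A M nT L Q Ax"
  let ?bb = "lifted_b L Q P R r W bx hx"
  let ?Pb = "lifted_P K nT L Q P R W Tx"
  let ?dual = "\<lambda>\<xi> \<theta>. dual_value P W (R *\<^sub>v \<xi> + r) (Tx *\<^sub>v \<xi> + hx) \<theta>"
  have Sb: "?Sb \<in> carrier_mat (J + (L + L * Q)) ?n" by (rule lifted_S_carrier[OF S LK])
  have Ab: "?Ab \<in> carrier_mat M ?n" by (rule lifted_A_carrier[OF Ax])
  have Pb: "?Pb \<in> carrier_mat ?n ?n" and Pbt: "transpose_mat ?Pb = ?Pb"
    by (rule lifted_P_carrier_transpose[OF P rank R W Tx])+
  have bb: "?bb \<in> carrier_vec ?n" by (rule lifted_b_carrier[OF P rank R W r bx hx])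
  have tbc: "tb \<in> carrier_vec (J + (L + L * Q))" unfolding tb_def by (rule lifted_t_carrier[OF t])
  have kn: "L * Q \<le> ?n" by simp
  have norm: "(eucl_norm v)\<^sup>2 = v \<bullet> v" for v
    unfolding eucl_norm_def using scalar_prod_self_nonneg by simp
  have lifted_value: "(?Ab *\<^sub>v z) \<bullet> (?Ab *\<^sub>v z) + z \<bullet> (?Pb *\<^sub>v z) + ?bb \<bullet> z + (c - 1/4 * (r \<bullet> (gram_inv P *\<^sub>v r)))
      = (eucl_norm (Ax *\<^sub>v \<xi>))\<^sup>2 + bx \<bullet> \<xi> + c + ?dual \<xi> \<theta>"
    if z: "z = \<beta> @\<^sub>v \<beta>' @\<^sub>v \<xi> @\<^sub>v \<theta>" and
      v: "\<beta> \<in> carrier_vec (L * Q)" "\<beta>' \<in> carrier_vec (L * Q)" "\<xi> \<in> carrier_vec K" "\<theta> \<in> carrier_vec nT"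
    for z \<beta> \<beta>' \<xi> \<theta>
    using lifted_objective[OF P rank R W Tx r bx hx v] lifted_A_mult[OF Ax v] unfolding z norm by simp
  note rec_dual = recourse_dual[OF P rank W cr R r Tx hx]
  show ?thesis
  proof (rule antisym)
    show "worst \<le> (INF p\<in>F. ereal (obj p))"
      unfolding worst_def
    proof (intro SUP_least INF_greatest)
      fix \<xi> p assume \<xi>: "\<xi> \<in> uncertainty_set K L S t" and p: "p \<in> F"
      obtain \<tau> \<psi> \<phi> \<gamma> H where pe: "p = (\<tau>, \<psi>, \<phi>, \<gamma>, H)" by (cases p) auto
      have \<xi>K: "\<xi> \<in> carrier_vec K" "0\<^sub>v K \<le> \<xi>" using \<xi> unfolding uncertainty_set_def by auto
      obtain \<theta> where \<theta>: "\<theta> \<in> carrier_vec nT" "0\<^sub>v nT \<le> \<theta>"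
        and le: "recourse P R r W Tx hx \<xi> \<le> ereal (?dual \<xi> \<theta>)"
        using rec_dual(2)[OF \<xi>K(1)] by blast
      obtain \<beta> \<beta>' where \<beta>: "\<beta> \<in> carrier_vec (L * Q)" "\<beta>' \<in> carrier_vec (L * Q)"
        "0\<^sub>v (L * Q) \<le> \<beta>" "0\<^sub>v (L * Q) \<le> \<beta>'" "\<forall>i<L * Q. \<beta> $ i \<in> {0, 1}"
        and eq: "?Sb *\<^sub>v (\<beta> @\<^sub>v \<beta>' @\<^sub>v \<xi> @\<^sub>v \<theta>) = tb"
        unfolding tb_def
        using uncertainty_imp_lifted_S_feasible[OF S LK t \<xi> _ \<theta>(1)] bits \<xi> by blast
      define z where "z = \<beta> @\<^sub>v \<beta>' @\<^sub>v \<xi> @\<^sub>v \<theta>"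
      have z: "z \<in> carrier_vec ?n" unfolding z_def using \<beta> \<xi>K \<theta> by (intro append_carrier_vec)
      have z0: "0\<^sub>v ?n \<le> z"
        unfolding vec_nonneg_iff[OF z] unfolding z_def using \<beta> \<xi>K \<theta> by (auto simp: vec_nonneg_iff)
      have zb: "\<forall>i<L * Q. z $ i \<in> {0, 1}" unfolding z_def using \<beta> by auto
      have "(?Ab *\<^sub>v z) \<bullet> (?Ab *\<^sub>v z) + z \<bullet> (?Pb *\<^sub>v z) + ?bb \<bullet> z
          \<le> tb \<bullet> \<psi> + hadamard_vec tb tb \<bullet> \<phi> + \<tau>"
        by (rule cop_weak_duality[OF Sb Ab Pb tbc bb kn p[unfolded pe F_def] z z0
              eq[folded z_def] zb])
      then have "(eucl_norm (Ax *\<^sub>v \<xi>))\<^sup>2 + bx \<bullet> \<xi> + c + ?dual \<xi> \<theta> \<le> obj p"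
        using lifted_value[OF z_def \<beta>(1,2) \<xi>K(1) \<theta>(1)] unfolding pe obj_def by simp
      then have "ereal ((eucl_norm (Ax *\<^sub>v \<xi>))\<^sup>2 + bx \<bullet> \<xi> + c) + ereal (?dual \<xi> \<theta>) \<le> ereal (obj p)"
        by simp
      then show "ereal ((eucl_norm (Ax *\<^sub>v \<xi>))\<^sup>2 + bx \<bullet> \<xi> + c) + recourse P R r W Tx hx \<xi> \<le> ereal (obj p)"
        using add_left_mono[OF le] order_trans by blast
    qed
    show "(INF p\<in>F. ereal (obj p)) \<le> worst"
    proof (rule ccontr)
      assume "\<not> ?thesis"
      \<comment> \<open>A real number lies strictly between two distinct extended reals, so infinite
        values need no separate case. A feasible point with objective \<open>v\<close> will then lie
        below the infimum.\<close>
      then obtain v where v: "worst < ereal v" "ereal v < (INF p\<in>F. ereal (obj p))"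
        using ereal_dense2 by (metis not_le)
      \<comment> \<open>\<open>cop_strong_duality\<close> knows nothing of the constants in the
        objective, so they are subtracted from the target.\<close>
      define v0 where "v0 = v - (c - 1/4 * (r \<bullet> (gram_inv P *\<^sub>v r)))"
      obtain \<tau> \<psi> \<phi> \<gamma> H where p: "(\<tau>, \<psi>, \<phi>, \<gamma>, H) \<in> cop_feasible M (L * Q) ?Sb ?Ab ?bb ?Pb"
        and o: "tb \<bullet> \<psi> + hadamard_vec tb tb \<bullet> \<phi> + \<tau> = v0"
      proof (rule cop_strong_duality[OF Sb Ab Pb tbc bb kn Pbt])
        show "\<exists>j<J + (L + L * Q). tb $ j = 1 \<and> z $ i \<le> (?Sb *\<^sub>v z) $ j"
          if "i < L * Q" "z \<in> carrier_vec ?n" "0\<^sub>v ?n \<le> z" for i z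
          unfolding tb_def using lifted_bound_row[OF S LK t that] .
        show "(?Ab *\<^sub>v z) \<bullet> (?Ab *\<^sub>v z) + z \<bullet> (?Pb *\<^sub>v z) + ?bb \<bullet> z < v0"
          if z: "z \<in> carrier_vec ?n" "0\<^sub>v ?n \<le> z" and eq: "?Sb *\<^sub>v z = tb"
            and bin: "\<forall>i<L * Q. z $ i \<in> {0, 1}" for z
        proof -
          obtain \<beta> \<beta>' \<xi> \<theta> where ze: "z = \<beta> @\<^sub>v \<beta>' @\<^sub>v \<xi> @\<^sub>v \<theta>"
            and b: "\<beta> \<in> carrier_vec (L * Q)" "\<beta>' \<in> carrier_vec (L * Q)" "\<xi> \<in> carrier_vec K" "\<theta> \<in> carrier_vec nT"
            and nn: "0\<^sub>v K \<le> \<xi>" "0\<^sub>v nT \<le> \<theta>"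
            and zi: "\<And>i. i < L * Q \<Longrightarrow> z $ i = \<beta> $ i"
            using lifted_feasibleE[OF z] by metis
          have "\<xi> \<in> uncertainty_set K L S t"
            using bin zi eq unfolding ze tb_def
            by (intro lifted_S_feasible_imp_uncertainty[OF S LK t b nn(1)]) auto
          then have "ereal ((eucl_norm (Ax *\<^sub>v \<xi>))\<^sup>2 + bx \<bullet> \<xi> + c) + recourse P R r W Tx hx \<xi> \<le> worst"
            unfolding worst_def by (rule SUP_upper)
          moreover have "ereal ((eucl_norm (Ax *\<^sub>v \<xi>))\<^sup>2 + bx \<bullet> \<xi> + c) + ereal (?dual \<xi> \<theta>)
              \<le> ereal ((eucl_norm (Ax *\<^sub>v \<xi>))\<^sup>2 + bx \<bullet> \<xi> + c) + recourse P R r W Tx hx \<xi>"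
            by (intro add_left_mono rec_dual(1)[OF b(3,4) nn(2)])
          ultimately have "ereal ((eucl_norm (Ax *\<^sub>v \<xi>))\<^sup>2 + bx \<bullet> \<xi> + c + ?dual \<xi> \<theta>) < ereal v"
            using v(1) by (metis order_trans order_le_less_trans plus_ereal.simps(1))
          then show ?thesis using lifted_value[OF ze b] unfolding v0_def by simp
        qed
        show "(?Ab *\<^sub>v z) \<bullet> (?Ab *\<^sub>v z) + z \<bullet> (?Pb *\<^sub>v z) < 0"
          if z: "z \<in> carrier_vec ?n" "0\<^sub>v ?n \<le> z" and eq: "?Sb *\<^sub>v z = 0\<^sub>v (J + (L + L * Q))"
            and z0: "\<forall>i<L * Q. z $ i = 0" and nz: "z \<noteq> 0\<^sub>v ?n" for z
        proof -
          obtain \<beta> \<beta>' \<xi> \<theta> where ze: "z = \<beta> @\<^sub>v \<beta>' @\<^sub>v \<xi> @\<^sub>v \<theta>"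
            and b: "\<beta> \<in> carrier_vec (L * Q)" "\<beta>' \<in> carrier_vec (L * Q)" "\<xi> \<in> carrier_vec K" "\<theta> \<in> carrier_vec nT"
            and nn: "0\<^sub>v K \<le> \<xi>" "0\<^sub>v nT \<le> \<theta>"
            and zi: "\<And>i. i < L * Q \<Longrightarrow> z $ i = \<beta> $ i"
            using lifted_feasibleE[OF z] by metis
          have \<beta>0: "\<forall>i<L * Q. \<beta> $ i = 0" using z0 zi by auto
          \<comment> \<open>All blocks but \<open>\<theta>\<close> vanish, so the quadratic part
            reduces to \<open>-1/4\<close> times the dual form, which is negative at a nonzero
            \<open>\<theta> \<ge> 0\<close>.\<close>
          note zero = lifted_recession[OF S LK t ne bdd b nn(1) eq[unfolded ze] \<beta>0]
          have "\<theta> \<noteq> 0\<^sub>v nT"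
          proof
            assume "\<theta> = 0\<^sub>v nT"
            then have "z = 0\<^sub>v ?n" unfolding ze zero by (intro eq_vecI) auto
            then show False using nz by simp
          qed
          from dual_form_pos[OF P rank W cr b(4) nn(2) this]
          have "0 < \<theta> \<bullet> ((W * gram_inv P * transpose_mat W) *\<^sub>v \<theta>)" .
          moreover have G: "gram_inv P \<in> carrier_mat D2 D2" by (rule gram_inv_props[OF P rank])
          have "?Ab *\<^sub>v z = 0\<^sub>v M"
            using lifted_A_mult[OF Ax b] mult_mat_zero_vec[OF Ax] unfolding ze zero(3) by simp
          moreover have "z \<bullet> (?Pb *\<^sub>v z) = - 1/4 * (\<theta> \<bullet> ((W * gram_inv P * transpose_mat W) *\<^sub>v \<theta>))"
            unfolding ze lifted_P_form[OF P rank R W Tx b]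
            using b(4) by (simp add: zero(3) mult_mat_zero_vec[OF R] mult_mat_zero_vec[OF Tx]
                mult_mat_zero_vec[OF G] mult_mat_zero_vec[OF W])
          ultimately show ?thesis by simp
        qed
      qed
      have "obj (\<tau>, \<psi>, \<phi>, \<gamma>, H) = v" using o unfolding obj_def v0_def by simp
      moreover have "(INF p\<in>F. ereal (obj p)) \<le> ereal (obj (\<tau>, \<psi>, \<phi>, \<gamma>, H))"
        using p unfolding F_def by (rule INF_lower)
      ultimately show False using v(2) by simp
    qed
  qed
qed

theorem theorem4:
  fixes X :: "(real^'d) set"
    and A Tm :: "real^'d \<Rightarrow> real Matrix.mat"
    and b h :: "real^'d \<Rightarrow> real Matrix.vec"
    and c :: "real^'d \<Rightarrow> real"
    and P R W S :: "real Matrix.mat"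
    and r t :: "real Matrix.vec"
    and M K nT N D2 J L Q :: nat
  assumes "polytope X"
    and "affine_mat_on X M K A"
    and "affine_vec_on X K b"
    and "affine_mat_on X nT K Tm"
    and "affine_vec_on X nT h"
    and "convex_quadratic_on X c"
    and "P \<in> carrier_mat N D2"
    and "R \<in> carrier_mat D2 K"
    and "r \<in> carrier_vec D2"
    and "W \<in> carrier_mat nT D2"
    and "S \<in> carrier_mat J K"
    and "t \<in> carrier_vec J"
    and "L \<le> K"
    and Xi: "Xi = uncertainty_set K L S t"
    and "Xi \<noteq> {}"
    and "bounded_vecs Xi"
    and "\<forall>\<xi>\<in>Xi. \<forall>l<L. \<xi> $ l \<in> real ` {0..2 ^ Q - 1}"
    and "complete_recourse W"
    and "full_column_rank P"
    and worst: "worst = (\<lambda>x. SUP \<xi>\<in>Xi.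
           ereal ((eucl_norm (A x *\<^sub>v \<xi>))\<^sup>2 + b x \<bullet> \<xi> + c x) + recourse P R r W (Tm x) (h x) \<xi>)"
    and tb: "tb = lifted_t L Q t"
    and feas: "feas = (\<lambda>x. cop_feasible M (L * Q) (lifted_S J K nT L Q S) (lifted_A M nT L Q (A x))
           (lifted_b L Q P R r W (b x) (h x)) (lifted_P K nT L Q P R W (Tm x)))"
    and obj: "obj = (\<lambda>x (\<tau>, \<psi>, \<phi>, \<gamma> :: real Matrix.vec, H :: real Matrix.mat).
           c x - 1/4 * (r \<bullet> (gram_inv P *\<^sub>v r)) + tb \<bullet> \<psi> + hadamard_vec tb tb \<bullet> \<phi> + \<tau>)"
  shows "(\<forall>x\<in>X. (INF p\<in>feas x. ereal (obj x p)) = worst x) \<and>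
         (INF (x, p) \<in> {(x, p). x \<in> X \<and> p \<in> feas x}. ereal (obj x p)) = (INF x\<in>X. worst x)"
proof -
  have inf: "(INF p\<in>feas x. ereal (obj x p)) = worst x" if x: "x \<in> X" for x
  proof -
    have "A x \<in> carrier_mat M K" "b x \<in> carrier_vec K" "Tm x \<in> carrier_mat nT K" "h x \<in> carrier_vec nT"
      using assms(2-5) x unfolding affine_mat_on_def affine_vec_on_def by auto
    from copositive_value_eq_worst_case[OF assms(7,19,8,9,10,18) this assms(11-13)
        assms(15-17)[unfolded Xi] tb, of "c x"]
    show ?thesis unfolding feas obj worst Xi .
  qed
  \<comment> \<open>The joint infimum is an iterated one; in the extended reals this needs no
    nonemptiness, as empty index sets contribute \<open>\<infinity>\<close> on both sides.\<close>
  moreover have "(INF (x, p) \<in> {(x, p). x \<in> X \<and> p \<in> feas x}. ereal (obj x p))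
      = (INF x\<in>X. INF p\<in>feas x. ereal (obj x p))"
  proof (rule antisym)
    show "(INF (x, p) \<in> {(x, p). x \<in> X \<and> p \<in> feas x}. ereal (obj x p))
        \<le> (INF x\<in>X. INF p\<in>feas x. ereal (obj x p))"
      by (intro INF_greatest INF_lower2) auto
    show "(INF x\<in>X. INF p\<in>feas x. ereal (obj x p))
        \<le> (INF (x, p) \<in> {(x, p). x \<in> X \<and> p \<in> feas x}. ereal (obj x p))"
    proof (rule INF_greatest, clarify)
      fix x p assume xp: "x \<in> X" "p \<in> feas x"
      have "(INF x\<in>X. INF p\<in>feas x. ereal (obj x p)) \<le> (INF p\<in>feas x. ereal (obj x p))"
        using xp(1) by (rule INF_lower)
      also have "\<dots> \<le> ereal (obj x p)" using xp(2) by (rule INF_lower)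
      finally show "(INF x\<in>X. INF p\<in>feas x. ereal (obj x p)) \<le> ereal (obj x p)" .
    qed
  qed
  moreover have "(INF x\<in>X. INF p\<in>feas x. ereal (obj x p)) = (INF x\<in>X. worst x)"
    by (rule INF_cong) (auto simp: inf)
  ultimately show ?thesis by simp
qed

end
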